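(* Let $\Omega\subset\mathbb{R}^n$ be an open set and let $u$ be a weak supersolution in $\Omega$. Then $$u(x)=\operatorname{ess\,lim\,inf}_{y\to x}u(y)\qquad\text{for a.e. }x\in\Omega.$$ In particular, $u$ has a representative that is lower semicontinuous in $\Omega$.
   Context: Standing assumptions: $n\ge1$ is an integer, $s\in(0,1)$, $p\in(1,\infty)$, $\Lambda\ge1$, and $K:\mathbb{R}^n\times\mathbb{R}^n\to[0,\infty)$ is a measurable symmetric kernel ($K(x,y)=K(y,x)$) with $\Lambda^{-1}\le K(x,y)|x-y|^{n+sp}\le\Lambda$ for a.e. $x,y\in\mathbb{R}^n$. $D\Subset\Omega$ means that $\overline D$ is a compact subset of $\Omega$; $u_-:=\max\{-u,0\}$; $\operatorname{ess\,lim\,inf}_{y\to x}u(y)=\lim_{r\to0}\operatorname{ess\,inf}_{B_r(x)}u$. $W^{s,p}(U)$ consists of $v\in L^p(U)$ with $\int_U\int_U\frac{|v(x)-v(y)|^p}{|x-y|^{n+sp}}\,dx\,dy<\infty$; $v\in W^{s,p}_{\rm loc}(\Omega)$ means $v\in W^{s,p}(D)$ for every open $D\Subset\Omega$. The tail space is $L^{p-1}_{sp}(\mathbb{R}^n):=\{f\in L^{p-1}_{\rm loc}(\mathbb{R}^n):\int_{\mathbb{R}^n}|f(x)|^{p-1}(1+|x|)^{-n-sp}\,dx<\infty\}$. A weak supersolution in $\Omega$ is a measurable function $u$ on $\mathbb{R}^n$ with $u\in W^{s,p}_{\rm loc}(\Omega)$, $u_-\in L^{p-1}_{sp}(\mathbb{R}^n)$,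 and $$\int_{\mathbb{R}^n}\int_{\mathbb{R}^n}|u(x)-u(y)|^{p-2}(u(x)-u(y))(\eta(x)-\eta(y))K(x,y)\,dx\,dy\ge0$$ for every nonnegative $\eta\in C_0^\infty(\Omega)$. *)

theory Defs
  imports "HOL-Analysis.Analysis"
begin

text \<open>Throughout, the dimension of the space is \<open>DIM('a)\<close>. On \<open>'a \<times> 'a\<close> the measure
  \<open>lebesgue\<close> is the completed Lebesgue measure of the product Euclidean space, so that functions
  of \<open>(x, y)\<close> built from Lebesgue measurable functions of \<open>x\<close> and of \<open>y\<close> are measurable.\<close>

definition admissible_kernel ::
    "real \<Rightarrow> real \<Rightarrow> real \<Rightarrow> ('a::euclidean_space \<Rightarrow> 'a \<Rightarrow> real) \<Rightarrow> bool" where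
  "admissible_kernel s p \<Lambda> K \<longleftrightarrow>
     (\<lambda>(x, y). K x y) \<in> borel_measurable lebesgue \<and>
     (\<forall>x y. 0 \<le> K x y) \<and>
     (\<forall>x y. K x y = K y x) \<and>
     (AE (x, y) in lebesgue.
        inverse \<Lambda> \<le> K x y * norm (x - y) powr (real DIM('a) + s * p) \<and>
        K x y * norm (x - y) powr (real DIM('a) + s * p) \<le> \<Lambda>)"

definition compactly_contained :: "'a::topological_space set \<Rightarrow> 'a set \<Rightarrow> bool" where
  "compactly_contained D \<Omega> \<longleftrightarrow> compact (closure D) \<and> closure D \<subseteq> \<Omega>"

text \<open>On the diagonal the quotient below is \<open>0 / 0 = 0\<close>; the diagonal is a null set.\<close>

definition frac_sobolev ::
    "real \<Rightarrow> real \<Rightarrow> 'a::euclidean_space set \<Rightarrow> ('a \<Rightarrow> real) set" where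
  "frac_sobolev s p U =
     {v. v \<in> borel_measurable (lebesgue_on U) \<and>
         (\<integral>\<^sup>+x\<in>U. ennreal (\<bar>v x\<bar> powr p) \<partial>lebesgue) < \<infinity> \<and>
         (\<integral>\<^sup>+(x, y)\<in>U \<times> U. ennreal (\<bar>v x - v y\<bar> powr p
             / norm (x - y) powr (real DIM('a) + s * p)) \<partial>lebesgue) < \<infinity>}"

definition frac_sobolev_loc ::
    "real \<Rightarrow> real \<Rightarrow> 'a::euclidean_space set \<Rightarrow> ('a \<Rightarrow> real) set" where
  "frac_sobolev_loc s p \<Omega> =
     {v. \<forall>D. open D \<and> compactly_contained D \<Omega> \<longrightarrow> v \<in> frac_sobolev s p D}"

definition tail_space :: "real \<Rightarrow> real \<Rightarrow> ('a::euclidean_space \<Rightarrow> real) set" where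
  "tail_space s p =
     {f. f \<in> borel_measurable lebesgue \<and>
         (\<forall>C. compact C \<longrightarrow> (\<integral>\<^sup>+x\<in>C. ennreal (\<bar>f x\<bar> powr (p - 1)) \<partial>lebesgue) < \<infinity>) \<and>
         (\<integral>\<^sup>+x. ennreal (\<bar>f x\<bar> powr (p - 1)
             * (1 + norm x) powr (- real DIM('a) - s * p)) \<partial>lebesgue) < \<infinity>}"

primrec C_diff :: "nat \<Rightarrow> ('a::euclidean_space \<Rightarrow> real) \<Rightarrow> bool" where
  "C_diff 0 f \<longleftrightarrow> continuous_on UNIV f"
| "C_diff (Suc k) f \<longleftrightarrow> f differentiable_on UNIV \<and>
     (\<forall>b\<in>Basis. C_diff k (\<lambda>x. frechet_derivative f (at x) b))"

definition test_functions :: "'a::euclidean_space set \<Rightarrow> ('a \<Rightarrow> real) set" where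
  "test_functions \<Omega> =
     {\<eta>. (\<forall>k. C_diff k \<eta>) \<and> compact (closure {x. \<eta> x \<noteq> 0}) \<and> closure {x. \<eta> x \<noteq> 0} \<subseteq> \<Omega>}"

definition energy_integrand ::
    "real \<Rightarrow> ('a \<Rightarrow> 'a \<Rightarrow> real) \<Rightarrow> ('a \<Rightarrow> real) \<Rightarrow> ('a \<Rightarrow> real) \<Rightarrow> 'a \<times> 'a \<Rightarrow> real" where
  "energy_integrand p K u \<eta> = (\<lambda>(x, y).
     \<bar>u x - u y\<bar> powr (p - 2) * (u x - u y) * (\<eta> x - \<eta> y) * K x y)"

text \<open>For a weak supersolution only the negative part of \<open>u\<close> is assumed to lie in the tail space,
  so the Bochner integral, which is \<open>0\<close> for non-integrable functions, cannot be used to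
  express that the double integral is nonnegative. The following predicate says that the Lebesgue
  integral of \<open>F\<close> exists as an extended real number (the integral of the positive part minus the
  integral of the negative part) and is nonnegative. As \<open>ennreal\<close> truncates negative
  numbers to \<open>0\<close>, \<open>ennreal (F z)\<close> and \<open>ennreal (- F z)\<close> are the two parts of \<open>F\<close>.\<close>

definition nonneg_lebesgue_integral :: "('b::euclidean_space \<Rightarrow> real) \<Rightarrow> bool" where
  "nonneg_lebesgue_integral F \<longleftrightarrow>
     F \<in> borel_measurable lebesgue \<and>
     (\<integral>\<^sup>+z. ennreal (- F z) \<partial>lebesgue) < \<infinity> \<and>
     (\<integral>\<^sup>+z. ennreal (- F z) \<partial>lebesgue) \<le> (\<integral>\<^sup>+z. ennreal (F z) \<partial>lebesgue)"

definition weak_supersolution ::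
    "real \<Rightarrow> real \<Rightarrow> ('a::euclidean_space \<Rightarrow> 'a \<Rightarrow> real) \<Rightarrow> 'a set \<Rightarrow> ('a \<Rightarrow> real) \<Rightarrow> bool" where
  "weak_supersolution s p K \<Omega> u \<longleftrightarrow>
     u \<in> borel_measurable lebesgue \<and>
     u \<in> frac_sobolev_loc s p \<Omega> \<and>
     (\<lambda>x. max (- u x) 0) \<in> tail_space s p \<and>
     (\<forall>\<eta>\<in>test_functions \<Omega>. (\<forall>x. 0 \<le> \<eta> x) \<longrightarrow>
        nonneg_lebesgue_integral (energy_integrand p K u \<eta>))"

definition ess_inf :: "'a::euclidean_space set \<Rightarrow> ('a \<Rightarrow> real) \<Rightarrow> ereal" where
  "ess_inf A u = Sup {c. AE y in lebesgue_on A. c \<le> ereal (u y)}"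

definition ess_lim_inf :: "('a::euclidean_space \<Rightarrow> real) \<Rightarrow> 'a \<Rightarrow> ereal" where
  "ess_lim_inf u x = Lim (at_right 0) (\<lambda>r. ess_inf (ball x r) u)"

definition lower_semicontinuous_on :: "'a::topological_space set \<Rightarrow> ('a \<Rightarrow> ereal) \<Rightarrow> bool" where
  "lower_semicontinuous_on S v \<longleftrightarrow> (\<forall>x\<in>S. v x \<le> Liminf (at x within S) v)"

end

theory Submission
  imports Defs
begin

text \<open>
  Fix a level \<open>k\<close> and let \<open>w = (k - u)\<^sub>+\<close>. Testing the inequality with \<open>w \<phi>\<^sup>p\<close> for a
  cutoff \<open>\<phi>\<close> gives a Caccioppoli estimate whose good side contains the nonlocal interaction of
  \<open>w\<^sup>p\<close> with the set \<open>{u \<ge> k}\<close>. If \<open>{u < k}\<close> occupies at most half of every ball of radius \<open>t\<close>, then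
  this interaction is at least \<open>c t powr (- s p) \<integral> w\<^sup>p\<close>, which is the gain that drives a De Giorgi
  iteration; no fractional Sobolev inequality is needed.

  The iteration starts if \<open>\<integral> w\<^sup>p\<close> over a small ball and the tail of \<open>w\<close> outside it are small. Both are
  small near almost every \<open>x\<close> with \<open>u x \<ge> k\<close>: there \<open>w x = 0\<close>, so finiteness of the fractional energy
  says that \<open>\<integral> w y powr p * norm (x - y) powr (- n - s p) dy < \<infinity>\<close>. Hence \<open>u \<ge> k - \<epsilon>\<close> almost
  everywhere near \<open>x\<close>. The opposite inequality holds for every measurable function.

  The functions \<open>w \<phi>\<^sup>p\<close> are not smooth. They are mollified, and the passage to the limit only needs
  Fatou's lemma, as by Jensen's inequality mollification increases neither the fractional energy nor
  the \<open>L\<^sup>p\<close> norms that occur in an upper bound for the integrand.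
\<close>

section \<open>Mollifiers\<close>

text \<open>A Sobolev inequality would make each iteration step superlinear in the mass. Here each
  step is linear, and the gain is a free radius t: by Chebyshev between two levels the sublevel set
  shrinks with the mass, so t may decrease geometrically, and t^(s p) then beats the geometric
  growth of the cutoff constants.

  The scale is set by \<epsilon>. With I the integral of w^p |x - y|^(-n - s p), the mass over the
  ball of radius 2r is at most (2r)^(n + s p) I, which is o(\<epsilon>^p r^n). The tail only has to
  be of the order \<epsilon>^(p - 1) r^(-s p): values of w below \<epsilon> contribute exactly this
  order, whatever r is, and \<open>degiorgi\<close> tolerates any fixed multiple of it.

  As nothing is assumed about the positive part of u far away, the energy integrand is bounded from
  above only, and its integrability for nonsmooth test functions is a conclusion of the limit
  passage. The levels must follow u x while each statement holds only off a null set, whence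
  rational levels and countably many balls.\<close>

lemma C_diff_SucI:
  fixes f :: "'a::euclidean_space \<Rightarrow> real"
  assumes "\<And>x. (f has_derivative f' x) (at x)"
    and "\<And>b. b \<in> Basis \<Longrightarrow> C_diff k (\<lambda>x. f' x b)"
  shows "C_diff (Suc k) f"
proof -
  have "frechet_derivative f (at x) = f' x" for x
    using frechet_derivative_at[OF assms(1)] by simp
  then show ?thesis
    using assms by (auto simp: differentiable_on_def differentiable_def)
qed

lemma C_diff_Suc_derivative:
  fixes f :: "'a::euclidean_space \<Rightarrow> real"
  assumes "C_diff (Suc k) f"
  shows "(f has_derivative frechet_derivative f (at x)) (at x)"
    and "b \<in> Basis \<Longrightarrow> C_diff k (\<lambda>x. frechet_derivative f (at x) b)"
  using assms by (auto simp: differentiable_on_def frechet_derivative_works[symmetric])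

lemma C_diff_SucD:
  fixes f :: "'a::euclidean_space \<Rightarrow> real"
  shows "C_diff (Suc k) f \<Longrightarrow> C_diff k f"
proof (induction k arbitrary: f)
  case 0
  then show ?case by (auto intro!: differentiable_imp_continuous_on)
next
  case (Suc k)
  show ?case
    by (rule C_diff_SucI[OF C_diff_Suc_derivative(1)[OF Suc.prems]])
      (rule Suc.IH[OF C_diff_Suc_derivative(2)[OF Suc.prems]])
qed

lemma C_diff_imp_continuous:
  fixes f :: "'a::euclidean_space \<Rightarrow> real"
  shows "C_diff k f \<Longrightarrow> continuous_on UNIV f"
  by (induction k) (auto intro!: differentiable_imp_continuous_on)

lemma C_diff_const: "C_diff k (\<lambda>x::'a::euclidean_space. c)"
proof (induction k arbitrary: c)
  case (Suc k)
  show ?case by (rule C_diff_SucI[where f' = "\<lambda>x h. 0"]) (auto intro: Suc.IH)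
qed simp

lemma C_diff_inner: "C_diff k (\<lambda>x::'a::euclidean_space. x \<bullet> a)"
proof (cases k)
  case (Suc j)
  show ?thesis unfolding Suc
    by (rule C_diff_SucI[where f' = "\<lambda>x h. h \<bullet> a"])
      (auto intro!: C_diff_const derivative_eq_intros)
qed (auto intro!: continuous_intros)

lemma C_diff_inner': "C_diff k (\<lambda>x::'a::euclidean_space. a \<bullet> x)"
  using C_diff_inner[of k a] by (simp add: inner_commute)

lemma C_diff_add:
  fixes f g :: "'a::euclidean_space \<Rightarrow> real"
  shows "C_diff k f \<Longrightarrow> C_diff k g \<Longrightarrow> C_diff k (\<lambda>x. f x + g x)"
proof (induction k arbitrary: f g)
  case (Suc k)
  note f' = C_diff_Suc_derivative[OF Suc.prems(1)] and g' = C_diff_Suc_derivative[OF Suc.prems(2)]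
  show ?case
    by (rule C_diff_SucI[where f' = "\<lambda>x h. frechet_derivative f (at x) h + frechet_derivative g (at x) h"])
      (auto intro!: has_derivative_add f' g' Suc.IH)
qed (auto intro: continuous_on_add)

lemma C_diff_mult:
  fixes f g :: "'a::euclidean_space \<Rightarrow> real"
  shows "C_diff k f \<Longrightarrow> C_diff k g \<Longrightarrow> C_diff k (\<lambda>x. f x * g x)"
proof (induction k arbitrary: f g)
  case (Suc k)
  note f' = C_diff_Suc_derivative[OF Suc.prems(1)] and g' = C_diff_Suc_derivative[OF Suc.prems(2)]
  show ?case
    by (rule C_diff_SucI[where f' = "\<lambda>x h. f x * frechet_derivative g (at x) h + frechet_derivative f (at x) h * g x"])
      (auto intro!: has_derivative_mult f' g' C_diff_add Suc.IH C_diff_SucD[OF Suc.prems(1)]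
        C_diff_SucD[OF Suc.prems(2)])
qed (auto intro: continuous_on_mult)

text \<open>The powers of 1/t are carried along because differentiation maps these functions to
  linear combinations of each other; smoothness of all orders then follows by an induction in which
  m is arbitrary. The case m = 0 is the classical flat function.\<close>

definition exp_bump :: "nat \<Rightarrow> real \<Rightarrow> real" where
  "exp_bump m t = (if 0 < t then inverse t ^ m * exp (- inverse t) else 0)"

lemma exp_bump_deriv:
  "(exp_bump m has_real_derivative (exp_bump (m + 2) t + - real m * exp_bump (m + 1) t)) (at t)"
proof -
  consider "t < 0" | "t = 0" | "t > 0" by linarith
  then show ?thesis
  proof cases
    case 1
    have "(exp_bump m has_real_derivative 0) (at t)"
    proof (rule has_field_derivative_transform_within_open[where f = "\<lambda>_. 0" and S = "{..<0}"])
    qed (use 1 in \<open>auto simp: exp_bump_def\<close>)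
    then show ?thesis using 1 by (simp add: exp_bump_def)
  next
    case 2
    \<comment> \<open>At the origin the right difference quotient is h^(-m-1) exp(-1/h); the
      substitution x = 1/h turns its limit into that of x^(m+1) exp(-x) at infinity.\<close>
    have "((\<lambda>x::real. x ^ (m + 1) * exp (- x)) \<longlongrightarrow> 0) at_top"
      using tendsto_power_div_exp_0[of "m + 1"] by (simp add: exp_minus field_simps)
    then have lim: "((\<lambda>h. inverse h ^ (m + 1) * exp (- inverse h)) \<longlongrightarrow> (0::real)) (at_right 0)"
      by (rule filterlim_compose[OF _ filterlim_inverse_at_top_right])
    have r: "((\<lambda>h. exp_bump m h / h) \<longlongrightarrow> 0) (at_right 0)"
      by (rule Lim_transform_eventually[OF lim])
        (auto simp: exp_bump_def eventually_at_filter field_simps)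
    have l: "((\<lambda>h. exp_bump m h / h) \<longlongrightarrow> 0) (at_left 0)"
      by (rule tendsto_eventually) (auto simp: exp_bump_def eventually_at_filter)
    have "((\<lambda>h. exp_bump m h / h) \<longlongrightarrow> 0) (at 0)"
      using l r by (simp add: filterlim_split_at)
    then have "(exp_bump m has_real_derivative 0) (at 0)"
      by (simp add: has_field_derivative_iff exp_bump_def)
    then show ?thesis using 2 by (simp add: exp_bump_def)
  next
    case 3
    let ?f = "\<lambda>t::real. inverse t ^ m * exp (- inverse t)"
    have "((\<lambda>t. inverse t ^ m) has_real_derivative - real m * inverse t ^ (m + 1)) (at t)"
    proof (cases m)
      case (Suc j)
      show ?thesis
        unfolding Suc
        using DERIV_power_Suc[OF DERIV_inverse'[OF DERIV_ident, of t], of j] 3 by (simp add: algebra_simps)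
    qed auto
    moreover have "((\<lambda>t. exp (- inverse t)) has_real_derivative inverse t ^ 2 * exp (- inverse t)) (at t)"
      using 3 by (auto intro!: derivative_eq_intros simp: field_simps power2_eq_square)
    ultimately have "(?f has_real_derivative
        (- real m * inverse t ^ (m + 1)) * exp (- inverse t) + (inverse t ^ 2 * exp (- inverse t)) * inverse t ^ m) (at t)"
      by (rule DERIV_mult)
    then have "(?f has_real_derivative (inverse t ^ (m + 2) - real m * inverse t ^ (m + 1)) * exp (- inverse t)) (at t)"
      by (simp add: algebra_simps power_add power2_eq_square)
    then have "(exp_bump m has_real_derivative (inverse t ^ (m + 2) - real m * inverse t ^ (m + 1)) * exp (- inverse t)) (at t)"
      by (rule has_field_derivative_transform_within_open[where S = "{0<..}"])
        (use 3 in \<open>auto simp: exp_bump_def\<close>)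
    then show ?thesis using 3 by (simp add: exp_bump_def algebra_simps)
  qed
qed

lemma C_diff_exp_bump_quadratic:
  "C_diff k (\<lambda>x::'a::euclidean_space. exp_bump m (1 - c * (x \<bullet> x)))"
proof (induction k arbitrary: m)
  case 0
  have "continuous_on UNIV (exp_bump m)"
    using exp_bump_deriv by (intro continuous_at_imp_continuous_on) (blast intro: DERIV_isCont)
  then have "continuous_on UNIV (\<lambda>x::'a. exp_bump m (1 - c * (x \<bullet> x)))"
    by (rule continuous_on_compose2) (auto intro!: continuous_intros)
  then show ?case by simp
next
  case (Suc k)
  let ?q = "\<lambda>x::'a. 1 - c * (x \<bullet> x)"
  let ?d = "\<lambda>t. exp_bump (m + 2) t + - real m * exp_bump (m + 1) t"
  have "((\<lambda>x. exp_bump m (?q x)) has_derivative (\<lambda>h. ?d (?q x) * ((-2 * c) * (h \<bullet> x)))) (at x)" for x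
  proof -
    have "(?q has_derivative (\<lambda>h. (-2 * c) * (h \<bullet> x))) (at x)"
      by (auto intro!: derivative_eq_intros simp: inner_commute)
    from has_derivative_compose[OF this has_field_derivative_imp_has_derivative[OF exp_bump_deriv]]
    show ?thesis by simp
  qed
  then show ?case
    by (rule C_diff_SucI)
      (intro C_diff_mult C_diff_add C_diff_const C_diff_inner Suc.IH C_diff_inner')
qed


lemma exp_bump_0: "0 \<le> exp_bump 0 t" "exp_bump 0 t \<le> 1" "0 < exp_bump 0 t \<longleftrightarrow> 0 < t"
  "exp_bump 0 t \<noteq> 0 \<longleftrightarrow> 0 < t"
  by (auto simp: exp_bump_def)

lemma exp_bump_nonpos: "t \<le> 0 \<Longrightarrow> exp_bump m t = 0"
  by (simp add: exp_bump_def)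

lemma exp_bump_0_ge: "1/2 \<le> t \<Longrightarrow> exp (-2) \<le> exp_bump 0 t"
  by (auto simp: exp_bump_def field_simps)


text \<open>The height bound with M independent of e is what later turns finite energy into a
  convergence rate: on the support, e^(-n) is at most e^(s p) times the fractional kernel.\<close>

lemma mollifier_exists:
  obtains M :: real where "0 < M"
    and "\<And>e. 0 < e \<Longrightarrow> \<exists>\<rho>::'a::euclidean_space \<Rightarrow> real. (\<forall>k. C_diff k \<rho>) \<and> (\<forall>x. 0 \<le> \<rho> x) \<and>
      (\<forall>x. e \<le> norm x \<longrightarrow> \<rho> x = 0) \<and> (\<forall>x. \<rho> x \<le> M * e powr - real DIM('a)) \<and>
      (\<integral>\<^sup>+x. ennreal (\<rho> x) \<partial>lborel) = 1"
proof
  let ?\<omega> = "unit_ball_vol (real DIM('a))"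
  \<comment> \<open>The reciprocal of a lower bound for the integral of the profile at e = 1: the
    profile is at least exp(-2) on the ball of half the radius.\<close>
  let ?M = "exp 2 * 2 ^ DIM('a) / ?\<omega>"
  have \<omega>: "?\<omega> > 0" by simp
  then show "0 < ?M" by simp
  fix e :: real assume e: "0 < e"
  define h where "h x = exp_bump 0 (1 - 1 / e\<^sup>2 * (x \<bullet> x))" for x :: 'a
  have pos: "0 < 1 - 1 / e\<^sup>2 * (x \<bullet> x) \<longleftrightarrow> norm x < e" for x :: 'a
    using e power2_less_imp_less[of "norm x" e] power_strict_mono[of "norm x" e 2]
    by (auto simp: power2_norm_eq_inner[symmetric] field_simps)
  have h0: "0 \<le> h x" "h x \<le> 1" "e \<le> norm x \<Longrightarrow> h x = 0" for x
    using pos[of x] exp_bump_nonpos[of "1 - 1 / e\<^sup>2 * (x \<bullet> x)" 0] unfolding h_def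
    by (auto simp: exp_bump_0 not_less simp del: times_divide_eq_left)
  have low: "exp (-2) \<le> h x" if "norm x \<le> e / 2" for x
  proof -
    have "x \<bullet> x \<le> (e / 2)\<^sup>2"
      using that e by (simp add: power2_norm_eq_inner[symmetric] power_mono)
    moreover have "(e / 2)\<^sup>2 = e\<^sup>2 / 4" by (simp add: power_divide)
    ultimately have "2 * (x \<bullet> x) \<le> e\<^sup>2" using inner_ge_zero[of x] by linarith
    then show ?thesis
      using e unfolding h_def by (intro exp_bump_0_ge) (simp add: field_simps)
  qed
  have C: "C_diff k h" for k
    unfolding h_def by (rule C_diff_exp_bump_quadratic)
  have [measurable]: "h \<in> borel_measurable borel"
    using C[of 0] by (intro borel_measurable_continuous_onI) simp
  define I where "I = (\<integral>\<^sup>+x. ennreal (h x) \<partial>lborel)"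
  have "I \<le> (\<integral>\<^sup>+x. indicator (ball (0::'a) e) x \<partial>lborel)"
    unfolding I_def using h0 by (intro nn_integral_mono) (auto split: split_indicator simp: not_less)
  also have "\<dots> < \<infinity>" using e by (simp add: emeasure_ball)
  finally have fin: "I < \<infinity>" .
  have "ennreal (exp (-2) * (?\<omega> * (e/2) ^ DIM('a))) = (\<integral>\<^sup>+x. ennreal (exp (-2)) * indicator (ball 0 (e/2)::'a set) x \<partial>lborel)"
    using e by (simp add: emeasure_ball nn_integral_cmult_indicator ennreal_mult)
  also have "\<dots> \<le> I"
    unfolding I_def using low h0 by (intro nn_integral_mono) (auto split: split_indicator)
  finally have lo: "ennreal (exp (-2) * (?\<omega> * (e/2) ^ DIM('a))) \<le> I" .
  define c where "c = enn2real I"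
  have Ic: "I = ennreal c" using fin by (simp add: c_def)
  have c: "exp (-2) * (?\<omega> * (e/2) ^ DIM('a)) \<le> c"
    using lo unfolding Ic by (subst (asm) ennreal_le_iff) (auto simp: c_def)
  have c0: "0 < c" using c e \<omega> by (smt (verit) exp_gt_zero mult_pos_pos zero_less_power half_gt_zero)
  show "\<exists>\<rho>::'a \<Rightarrow> real. (\<forall>k. C_diff k \<rho>) \<and> (\<forall>x. 0 \<le> \<rho> x) \<and>
      (\<forall>x. e \<le> norm x \<longrightarrow> \<rho> x = 0) \<and> (\<forall>x. \<rho> x \<le> ?M * e powr - real DIM('a)) \<and>
      (\<integral>\<^sup>+x. ennreal (\<rho> x) \<partial>lborel) = 1"
  proof (intro exI[of _ "\<lambda>x. inverse c * h x"] conjI allI impI)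
    show "C_diff k (\<lambda>x. inverse c * h x)" for k
      by (intro C_diff_mult C_diff_const C)
    show "inverse c * h x \<le> ?M * e powr - real DIM('a)" for x
    proof -
      have "inverse c * h x \<le> inverse c * 1" using c0 h0 by (intro mult_left_mono) auto
      also have "\<dots> \<le> inverse (exp (-2) * (?\<omega> * (e/2) ^ DIM('a)))"
        using c e \<omega> by (simp only: mult_1_right, intro le_imp_inverse_le) auto
      also have "\<dots> = ?M * e powr - real DIM('a)"
        using e by (simp add: powr_minus powr_realpow exp_minus field_simps)
      finally show ?thesis .
    qed
    have "(\<integral>\<^sup>+x. ennreal (inverse c * h x) \<partial>lborel) = ennreal (inverse c) * I"
      unfolding I_def using c0 h0 by (simp add: ennreal_mult nn_integral_cmult)
    then show "(\<integral>\<^sup>+x. ennreal (inverse c * h x) \<partial>lborel) = 1"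
      using c0 by (simp add: Ic ennreal_mult[symmetric])
  qed (use h0 c0 in auto)
qed

lemma frechet_derivative_outside:
  fixes \<rho> :: "'a::euclidean_space \<Rightarrow> real"
  assumes supp: "\<And>x. R \<le> norm x \<Longrightarrow> \<rho> x = 0" and "R < norm x"
  shows "frechet_derivative \<rho> (at x) = (\<lambda>h. 0)"
proof -
  have "open {x::'a. R < norm x}" by (intro open_Collect_less continuous_intros)
  then have "(\<rho> has_derivative (\<lambda>h. 0)) (at x)"
    by (rule has_derivative_transform_within_open[where f = "\<lambda>_. 0", rotated])
      (use assms in auto)
  then show ?thesis using frechet_derivative_at by metis
qed

lemma linear_eq_sum_Basis:
  fixes f :: "'a::euclidean_space \<Rightarrow> real"
  assumes "linear f"
  shows "f h = (\<Sum>b\<in>Basis. (h \<bullet> b) * f b)"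
proof -
  have "f h = f (\<Sum>b\<in>Basis. (h \<bullet> b) *\<^sub>R b)" by (simp add: euclidean_representation)
  also have "\<dots> = (\<Sum>b\<in>Basis. (h \<bullet> b) * f b)"
    using assms by (simp add: linear_sum linear_scale)
  finally show ?thesis .
qed

text \<open>Uniformity in x is what permits differentiation under the integral against a merely
  integrable function. It comes from uniform continuity of the gradient on a compact ball and the
  mean value inequality; well outside the support all terms vanish.\<close>

lemma C_diff_uniform_linearization:
  fixes \<rho> :: "'a::euclidean_space \<Rightarrow> real"
  assumes C: "C_diff (Suc k) \<rho>" and supp: "\<And>x. R \<le> norm x \<Longrightarrow> \<rho> x = 0" and "0 < e"
  obtains d where "0 < d"
    and "\<And>x h. norm h < d \<Longrightarrow> \<bar>\<rho> (x + h) - \<rho> x - frechet_derivative \<rho> (at x) h\<bar> \<le> e * norm h"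
proof -
  let ?D = "\<lambda>x. frechet_derivative \<rho> (at x)"
  define g where "g x = (\<Sum>b\<in>Basis. ?D x b *\<^sub>R b)" for x
  note D = C_diff_Suc_derivative[OF C]
  have Dg: "?D x = (\<lambda>h. g x \<bullet> h)" for x
  proof
    fix h
    have "?D x h = (\<Sum>b\<in>Basis. (h \<bullet> b) * ?D x b)"
      using D(1) by (intro linear_eq_sum_Basis) (rule has_derivative_linear)
    also have "\<dots> = g x \<bullet> h"
      by (simp add: g_def inner_sum_left inner_commute[of h] mult.commute)
    finally show "?D x h = g x \<bullet> h" .
  qed
  have "continuous_on UNIV g"
    unfolding g_def using D(2) by (intro continuous_intros) (auto intro: C_diff_imp_continuous)
  \<comment> \<open>Radius R + 2 because x may have norm up to R + 1 and norm h < 1; for larger x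
    both x and x + h lie where \<rho> vanishes.\<close>
  then have "uniformly_continuous_on (cball 0 (R + 2)) g"
    by (intro compact_uniformly_continuous) (auto intro: continuous_on_subset)
  then obtain d0 where d0: "d0 > 0"
    "\<And>x y. x \<in> cball 0 (R + 2) \<Longrightarrow> y \<in> cball 0 (R + 2) \<Longrightarrow> dist y x < d0 \<Longrightarrow> dist (g y) (g x) < e"
    unfolding uniformly_continuous_on_def using \<open>0 < e\<close> by meson
  show ?thesis
  proof
    show "0 < min d0 1" using d0 by simp
    fix x h :: 'a assume h: "norm h < min d0 1"
    show "\<bar>\<rho> (x + h) - \<rho> x - ?D x h\<bar> \<le> e * norm h"
    proof (cases "norm x \<le> R + 1")
      case True
      have "norm (\<rho> (x + h) - \<rho> x - ?D x ((x + h) - x)) \<le> norm ((x + h) - x) * e"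
      proof (rule differentiable_bound_linearization[where S = "cball x (norm h)"])
        fix t :: real assume "t \<in> {0..1}"
        then show "x + t *\<^sub>R (x + h - x) \<in> cball x (norm h)"
          by (auto simp: dist_norm mult_left_le_one_le)
      next
        fix y assume y: "y \<in> cball x (norm h)"
        have "norm y \<le> norm x + norm h"
          using y norm_triangle_ineq4[of y x] norm_triangle_sub[of y x]
          by (auto simp: dist_norm norm_minus_commute)
        then have "dist (g y) (g x) < e"
          using y h True by (intro d0) (auto simp: dist_commute)
        then show "onorm (?D y - ?D x) \<le> e"
          unfolding Dg fun_diff_def inner_diff_left[symmetric]
          by (intro onorm_le) (metis Cauchy_Schwarz_ineq2 dist_norm less_eq_real_def mult_right_mono
              norm_ge_zero order_trans real_norm_def)
      qed (auto intro: has_derivative_at_withinI D)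
      then show ?thesis by (simp add: mult.commute)
    next
      case False
      have z: "\<rho> y = 0" if "y \<in> ball x 1" for y
        using that False norm_triangle_sub[of x y] by (intro supp) (auto simp: dist_norm)
      have "?D x = (\<lambda>h. 0)"
        using False by (intro frechet_derivative_outside[OF supp]) auto
      moreover have "\<rho> x = 0" "\<rho> (x + h) = 0" using h by (auto intro!: z simp: dist_norm)
      ultimately show ?thesis using \<open>0 < e\<close> by simp
    qed
  qed
qed

lemma C_diff_bounded:
  fixes \<rho> :: "'a::euclidean_space \<Rightarrow> real"
  assumes "C_diff k \<rho>" and supp: "\<And>x. R \<le> norm x \<Longrightarrow> \<rho> x = 0"
  obtains B where "\<And>x. \<bar>\<rho> x\<bar> \<le> B"
proof -
  have "bounded (\<rho> ` cball 0 R)"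
    using C_diff_imp_continuous[OF assms(1)]
    by (intro compact_imp_bounded compact_continuous_image) (auto intro: continuous_on_subset)
  then obtain B where B: "\<And>x. norm x \<le> R \<Longrightarrow> \<bar>\<rho> x\<bar> \<le> B"
    unfolding bounded_iff by (metis image_eqI mem_cball_0 real_norm_def)
  have "\<bar>\<rho> x\<bar> \<le> max B 0" for x
    using B[of x] supp[of x] by (cases "norm x \<le> R") auto
  then show ?thesis by (rule that)
qed

section \<open>Convolution with smooth kernels\<close>

definition convolve :: "('a::euclidean_space \<Rightarrow> real) \<Rightarrow> ('a \<Rightarrow> real) \<Rightarrow> 'a \<Rightarrow> real" where
  "convolve \<rho> \<eta> x = (\<integral>y. \<rho> (x - y) * \<eta> y \<partial>lborel)"

lemma convolve_integrable:
  fixes \<rho> \<eta> :: "'a::euclidean_space \<Rightarrow> real"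
  assumes [measurable]: "\<rho> \<in> borel_measurable borel" and "\<And>x. \<bar>\<rho> x\<bar> \<le> B" "integrable lborel \<eta>"
  shows "integrable lborel (\<lambda>y. \<rho> (x - y) * \<eta> y)"
proof (rule Bochner_Integration.integrable_bound)
  show "integrable lborel (\<lambda>y. B * \<eta> y)" using assms by simp
  have [measurable]: "\<eta> \<in> borel_measurable borel" using assms(3) by auto
  show "(\<lambda>y. \<rho> (x - y) * \<eta> y) \<in> borel_measurable lborel" by simp
  show "AE y in lborel. norm (\<rho> (x - y) * \<eta> y) \<le> norm (B * \<eta> y)"
    using assms(2) by (auto simp: abs_mult intro!: mult_right_mono order_trans[OF assms(2) abs_ge_self])
qed

lemma has_derivative_convolve:
  fixes \<rho> \<eta> :: "'a::euclidean_space \<Rightarrow> real"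
  assumes C: "\<And>k. C_diff k \<rho>" and supp: "\<And>x. R \<le> norm x \<Longrightarrow> \<rho> x = 0"
    and \<eta>: "integrable lborel \<eta>"
  shows "(convolve \<rho> \<eta> has_derivative
     (\<lambda>h. \<Sum>b\<in>Basis. (h \<bullet> b) * convolve (\<lambda>x. frechet_derivative \<rho> (at x) b) \<eta> x)) (at x)"
    (is "(_ has_derivative ?F) _")
proof -
  let ?D = "\<lambda>x. frechet_derivative \<rho> (at x)"
  have lin: "linear (?D z)" for z
    using C_diff_Suc_derivative(1)[OF C] has_derivative_linear by blast
  have int_\<rho>: "integrable lborel (\<lambda>z. \<rho> (y - z) * \<eta> z)" for y
  proof -
    obtain B where "\<And>x. \<bar>\<rho> x\<bar> \<le> B" using C_diff_bounded[OF C supp] by blast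
    then show ?thesis
      using C_diff_imp_continuous[OF C] by (intro convolve_integrable \<eta> borel_measurable_continuous_onI)
  qed
  have int_D: "integrable lborel (\<lambda>z. ?D (y - z) b * \<eta> z)" if "b \<in> Basis" for y b
  proof -
    have Cb: "C_diff 0 (\<lambda>x. ?D x b)" using C_diff_Suc_derivative(2)[OF C that] .
    moreover have "?D x b = 0" if "R + 1 \<le> norm x" for x
      using frechet_derivative_outside[OF supp, where x = x] that by simp
    ultimately obtain B where "\<And>x. \<bar>?D x b\<bar> \<le> B" using C_diff_bounded by blast
    then show ?thesis
      using Cb by (intro convolve_integrable \<eta> borel_measurable_continuous_onI) auto
  qed
  define N where "N = (\<integral>z. \<bar>\<eta> z\<bar> \<partial>lborel)"
  have N: "0 \<le> N" by (simp add: N_def)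
  show ?thesis
    unfolding has_derivative_at_alt
  proof (intro conjI allI impI)
    show "bounded_linear ?F"
      by (intro bounded_linear_sum bounded_linear_mult_left
          bounded_linear_compose[OF bounded_linear_mult_left] bounded_linear_inner_left)
    \<comment> \<open>The tolerance below is divided by N + 1, with N the L^1 norm of \<eta>; adding
      1 covers N = 0.\<close>
    fix e :: real assume e: "0 < e"
    obtain d where d: "0 < d"
      "\<And>x h. norm h < d \<Longrightarrow> \<bar>\<rho> (x + h) - \<rho> x - ?D x h\<bar> \<le> e / (N + 1) * norm h"
      using C_diff_uniform_linearization[OF C supp, of R "e / (N + 1)"] e N by auto
    show "\<exists>d>0. \<forall>y. norm (y - x) < d \<longrightarrow>
        norm (convolve \<rho> \<eta> y - convolve \<rho> \<eta> x - ?F (y - x)) \<le> e * norm (y - x)"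
    proof (intro exI[of _ d] conjI allI impI d)
      fix y assume y: "norm (y - x) < d"
      have "?F (y - x) = (\<integral>z. (\<Sum>b\<in>Basis. ((y - x) \<bullet> b) * (?D (x - z) b * \<eta> z)) \<partial>lborel)"
        using int_D by (simp add: convolve_def)
      also have "\<dots> = (\<integral>z. ?D (x - z) (y - x) * \<eta> z \<partial>lborel)"
        by (simp add: linear_eq_sum_Basis[OF lin, of _ "y - x"] sum_distrib_right mult.assoc)
      finally have F: "?F (y - x) = (\<integral>z. ?D (x - z) (y - x) * \<eta> z \<partial>lborel)" .
      have int_h: "integrable lborel (\<lambda>z. ?D (x - z) (y - x) * \<eta> z)"
        using int_D by (simp add: linear_eq_sum_Basis[OF lin, of _ "y - x"] sum_distrib_right mult.assoc)
      have "convolve \<rho> \<eta> y - convolve \<rho> \<eta> x - ?F (y - x) =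
          (\<integral>z. \<rho> (y - z) * \<eta> z \<partial>lborel) - (\<integral>z. \<rho> (x - z) * \<eta> z \<partial>lborel)
          - (\<integral>z. ?D (x - z) (y - x) * \<eta> z \<partial>lborel)"
        unfolding F by (simp add: convolve_def)
      also have "\<dots> = (\<integral>z. (\<rho> (y - z) - \<rho> (x - z) - ?D (x - z) (y - x)) * \<eta> z \<partial>lborel)"
        unfolding left_diff_distrib using int_\<rho> int_h by simp
      also have "\<bar>\<dots>\<bar> \<le> (\<integral>z. e / (N + 1) * norm (y - x) * \<bar>\<eta> z\<bar> \<partial>lborel)"
      proof (rule integral_abs_bound[THEN order_trans], rule integral_mono)
        show "integrable lborel (\<lambda>z. \<bar>(\<rho> (y - z) - \<rho> (x - z) - ?D (x - z) (y - x)) * \<eta> z\<bar>)"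
          unfolding left_diff_distrib using int_\<rho> int_h by simp
        fix z
        show "\<bar>(\<rho> (y - z) - \<rho> (x - z) - ?D (x - z) (y - x)) * \<eta> z\<bar> \<le> e / (N + 1) * norm (y - x) * \<bar>\<eta> z\<bar>"
          unfolding abs_mult
        proof (rule mult_right_mono)
          show "\<bar>\<rho> (y - z) - \<rho> (x - z) - ?D (x - z) (y - x)\<bar> \<le> e / (N + 1) * norm (y - x)"
            using d(2)[OF y, of "x - z"] by simp
        qed simp
      qed (use \<eta> in simp)
      also have "\<dots> = (e * norm (y - x)) * (N / (N + 1))" by (simp add: N_def)
      also have "\<dots> \<le> (e * norm (y - x)) * 1"
        using e N by (intro mult_left_mono) auto
      finally show "norm (convolve \<rho> \<eta> y - convolve \<rho> \<eta> x - ?F (y - x)) \<le> e * norm (y - x)"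
        by simp
    qed
  qed
qed

lemma C_diff_convolve:
  fixes \<rho> \<eta> :: "'a::euclidean_space \<Rightarrow> real"
  assumes \<eta>: "integrable lborel \<eta>"
    and C: "\<And>k. C_diff k \<rho>" and supp: "\<And>x. R \<le> norm x \<Longrightarrow> \<rho> x = 0"
  shows "C_diff k (convolve \<rho> \<eta>)"
  using C supp
proof (induction k arbitrary: \<rho> R)
  case 0
  show ?case
    using has_derivative_continuous[OF has_derivative_convolve[OF 0 \<eta>]]
    by (auto intro!: continuous_at_imp_continuous_on)
next
  case (Suc k)
  show ?case
  proof (rule C_diff_SucI[OF has_derivative_convolve[OF Suc.prems \<eta>]])
    fix b :: 'a assume b: "b \<in> Basis"
    \<comment> \<open>The derivative of \<rho> is known to vanish only strictly outside radius R, so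
      the induction passes to a radius larger by one.\<close>
    have "C_diff k (convolve (\<lambda>x. frechet_derivative \<rho> (at x) b) \<eta>)"
    proof (rule Suc.IH[where R = "R + 1"])
      show "C_diff k (\<lambda>x. frechet_derivative \<rho> (at x) b)" for k
        by (rule C_diff_Suc_derivative(2)[OF Suc.prems(1) b])
      show "frechet_derivative \<rho> (at x) b = 0" if "R + 1 \<le> norm x" for x
        using frechet_derivative_outside[OF Suc.prems(2), where x = x] that by simp
    qed
    moreover have "(\<Sum>c\<in>Basis. (b \<bullet> c) * convolve (\<lambda>x. frechet_derivative \<rho> (at x) c) \<eta> x)
        = convolve (\<lambda>x. frechet_derivative \<rho> (at x) b) \<eta> x" for x
      using b by (simp add: inner_Basis sum.If_cases if_distrib[of "\<lambda>t. t * _"] sum.delta cong: if_cong)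
    ultimately show "C_diff k (\<lambda>x. \<Sum>c\<in>Basis. (b \<bullet> c) * convolve (\<lambda>x. frechet_derivative \<rho> (at x) c) \<eta> x)"
      by simp
  qed
qed

section \<open>Tangent inequality and Jensen's inequality for powers\<close>

lemma powr_tangent:
  fixes a b :: real
  assumes "0 \<le> a" "0 \<le> b" "1 \<le> p"
  shows "a powr p + p * a powr (p - 1) * (b - a) \<le> b powr p"
proof (cases "a = 0 \<or> b = 0")
  case True
  then consider "a = 0" | "b = 0" "a > 0" using assms by force
  then show ?thesis
  proof cases
    case 2
    then have "a powr p = a * a powr (p - 1)" by (simp add: powr_mult_base)
    then have "a powr p + p * a powr (p - 1) * (b - a) = (1 - p) * a powr p"
      using 2 by (simp add: algebra_simps)
    then show ?thesis using 2 assms by (simp add: mult_nonpos_nonneg)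
  qed (use assms in auto)
next
  case False
  then have ab: "0 < a" "0 < b" using assms by auto
  let ?x = "b / a"
  \<comment> \<open>After division by a^p the claim is Bernoulli's inequality p x \<le> x^p + p - 1
    for x = b/a, which is Young's inequality for the factors x^p and 1 with weights 1/p and 1 -
    1/p.\<close>
  have gen: "p * t \<le> A + (p - 1)" if "t \<le> 1 / p * A + (1 - 1 / p) * 1" for t A
  proof -
    have "p * t \<le> p * (1 / p * A + (1 - 1 / p) * 1)"
      using that assms by (intro mult_left_mono) auto
    also have "\<dots> = A + (p - 1)" using assms by (simp add: field_simps)
    finally show ?thesis .
  qed
  have "?x = (?x powr p) powr (1/p) * 1 powr (1 - 1/p)" using ab assms by (simp add: powr_powr)
  also have "\<dots> \<le> 1/p * ?x powr p + (1 - 1/p) * 1"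
    using ab assms by (intro Youngs_inequality_0) auto
  finally have "p * ?x \<le> ?x powr p + (p - 1)" by (rule gen)
  then have "a powr p * (1 + p * (?x - 1)) \<le> a powr p * ?x powr p"
    using ab by (intro mult_left_mono) (auto simp: algebra_simps)
  also have "a powr p * ?x powr p = b powr p" using ab by (simp add: powr_divide)
  also have "a powr p * (1 + p * (?x - 1)) = a powr p + p * a powr (p - 1) * (b - a)"
    using ab by (simp add: powr_diff field_simps)
  finally show ?thesis .
qed

text \<open>The tangent inequality at the mean \<open>a\<close> of |X| is integrated against \<rho>.
  Integrability comes for free: an infinite right side is trivial, and a finite one dominates |X|
  through |t| \<le> 1 + |t|^p.\<close>

lemma jensen_powr:
  fixes \<rho> X :: "'a \<Rightarrow> real"
  assumes [measurable]: "\<rho> \<in> borel_measurable M" "X \<in> borel_measurable M"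
    and \<rho>: "\<And>z. 0 \<le> \<rho> z" "(\<integral>\<^sup>+z. ennreal (\<rho> z) \<partial>M) = 1" and p: "1 \<le> p"
  shows "ennreal (\<bar>\<integral>z. \<rho> z * X z \<partial>M\<bar> powr p) \<le> (\<integral>\<^sup>+z. ennreal (\<rho> z * \<bar>X z\<bar> powr p) \<partial>M)"
proof (cases "(\<integral>\<^sup>+z. ennreal (\<rho> z * \<bar>X z\<bar> powr p) \<partial>M) = \<infinity>")
  case False
  have int\<rho>: "integrable M \<rho>" using \<rho> by (intro integrableI_nonneg) auto
  have i1: "(\<integral>z. \<rho> z \<partial>M) = 1" using \<rho> by (simp add: integral_eq_nn_integral)
  have intp: "integrable M (\<lambda>z. \<rho> z * \<bar>X z\<bar> powr p)"
    using False \<rho> by (intro integrableI_nonneg) (auto simp: less_top)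
  have le: "\<bar>t\<bar> \<le> 1 + \<bar>t\<bar> powr p" for t :: real
  proof (cases "\<bar>t\<bar> \<le> 1")
    case False
    then have "\<bar>t\<bar> powr 1 \<le> \<bar>t\<bar> powr p" using p by (intro powr_mono) auto
    then show ?thesis using False by simp
  qed (simp add: add_increasing2)
  have intX: "integrable M (\<lambda>z. \<rho> z * \<bar>X z\<bar>)"
  proof (rule Bochner_Integration.integrable_bound)
    show "integrable M (\<lambda>z. \<rho> z + \<rho> z * \<bar>X z\<bar> powr p)" using int\<rho> intp by simp
    show "AE z in M. norm (\<rho> z * \<bar>X z\<bar>) \<le> norm (\<rho> z + \<rho> z * \<bar>X z\<bar> powr p)"
    proof (rule AE_I2)
      fix z
      have "\<rho> z * \<bar>X z\<bar> \<le> \<rho> z * (1 + \<bar>X z\<bar> powr p)" using \<rho> le by (intro mult_left_mono) auto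
      then show "norm (\<rho> z * \<bar>X z\<bar>) \<le> norm (\<rho> z + \<rho> z * \<bar>X z\<bar> powr p)"
        using \<rho>(1)[of z] by (simp add: algebra_simps)
    qed
  qed simp
  define a where "a = (\<integral>z. \<rho> z * \<bar>X z\<bar> \<partial>M)"
  have a0: "0 \<le> a" using \<rho> by (simp add: a_def)
  have "\<bar>\<integral>z. \<rho> z * X z \<partial>M\<bar> \<le> a"
    unfolding a_def using integral_abs_bound[of M "\<lambda>z. \<rho> z * X z"] \<rho> by (simp add: abs_mult)
  then have "\<bar>\<integral>z. \<rho> z * X z \<partial>M\<bar> powr p \<le> a powr p" using p by (intro powr_mono2) auto
  \<comment> \<open>The added linear term integrates to zero because \<open>a\<close> is the mean
    and \<rho> has mass one.\<close>
  also have "a powr p = (\<integral>z. \<rho> z * a powr p + p * a powr (p - 1) * (\<rho> z * \<bar>X z\<bar> - a * \<rho> z) \<partial>M)"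
    using int\<rho> intX by (simp add: i1 a_def[symmetric])
  also have "\<dots> \<le> (\<integral>z. \<rho> z * \<bar>X z\<bar> powr p \<partial>M)"
  proof (rule integral_mono)
    fix z
    have "\<rho> z * (a powr p + p * a powr (p - 1) * (\<bar>X z\<bar> - a)) \<le> \<rho> z * \<bar>X z\<bar> powr p"
      using \<rho> a0 p by (intro mult_left_mono powr_tangent) auto
    then show "\<rho> z * a powr p + p * a powr (p - 1) * (\<rho> z * \<bar>X z\<bar> - a * \<rho> z) \<le> \<rho> z * \<bar>X z\<bar> powr p"
      by (simp add: algebra_simps)
  qed (use int\<rho> intX intp in auto)
  finally have "ennreal (\<bar>\<integral>z. \<rho> z * X z \<partial>M\<bar> powr p) \<le> ennreal (\<integral>z. \<rho> z * \<bar>X z\<bar> powr p \<partial>M)"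
    by (rule ennreal_leI)
  also have "\<dots> = (\<integral>\<^sup>+z. ennreal (\<rho> z * \<bar>X z\<bar> powr p) \<partial>M)"
    using intp \<rho> by (intro nn_integral_eq_integral[symmetric]) auto
  finally show ?thesis .
qed simp

section \<open>Norms and energies under mollification\<close>

lemma distr_lborel_minus: "distr lborel borel (\<lambda>z. x - z) = (lborel :: 'a::euclidean_space measure)"
proof -
  have "distr lborel borel (\<lambda>z. x - z) = density (distr lborel borel (\<lambda>z. x - z)) (\<lambda>_. 1)"
    by (simp add: density_1)
  also have "\<dots> = lborel"
    using lborel_affine[of "-1" x] by simp
  finally show ?thesis .
qed

lemma nn_integral_lborel_minus:
  fixes f :: "'a::euclidean_space \<Rightarrow> ennreal"
  assumes [measurable]: "f \<in> borel_measurable borel"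
  shows "(\<integral>\<^sup>+z. f (x - z) \<partial>lborel) = (\<integral>\<^sup>+z. f z \<partial>lborel)"
  by (subst (2) distr_lborel_minus[of x, symmetric]) (simp add: nn_integral_distr)

lemma nn_integral_lborel_translate:
  fixes f :: "'a::euclidean_space \<Rightarrow> ennreal"
  assumes [measurable]: "f \<in> borel_measurable borel"
  shows "(\<integral>\<^sup>+x. f (x - z) \<partial>lborel) = (\<integral>\<^sup>+x. f x \<partial>lborel)"
proof -
  have "(\<integral>\<^sup>+x. f (x - z) \<partial>lborel) = (\<integral>\<^sup>+x. f (0 - x) \<partial>lborel)"
    using nn_integral_lborel_minus[of "\<lambda>x. f (0 - x)" z] by simp
  then show ?thesis using nn_integral_lborel_minus[of f 0] by simp
qed

lemma convolve_commute:
  fixes \<rho> \<eta> :: "'a::euclidean_space \<Rightarrow> real"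
  assumes [measurable]: "\<rho> \<in> borel_measurable borel" "\<eta> \<in> borel_measurable borel"
  shows "convolve \<rho> \<eta> x = (\<integral>z. \<rho> z * \<eta> (x - z) \<partial>lborel)"
  unfolding convolve_def
  by (subst distr_lborel_minus[of x, symmetric]) (simp add: integral_distr)

context
  fixes \<rho> \<eta> :: "'a::euclidean_space \<Rightarrow> real" and B p :: real
  assumes \<rho>m[measurable]: "\<rho> \<in> borel_measurable borel" and \<rho>B: "\<And>x. \<rho> x \<le> B"
    and \<rho>0: "\<And>x. 0 \<le> \<rho> x" and \<rho>1: "(\<integral>\<^sup>+x. ennreal (\<rho> x) \<partial>lborel) = 1"
    and \<eta>: "integrable lborel \<eta>" and p: "1 \<le> p"
begin

lemma convolve_measurable[measurable]: "convolve \<rho> \<eta> \<in> borel_measurable borel"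
proof -
  have [measurable]: "\<eta> \<in> borel_measurable borel" using \<eta> by auto
  show ?thesis unfolding convolve_def[abs_def] by measurable
qed

lemma convolve_integrable_shift: "integrable lborel (\<lambda>z. \<rho> z * \<eta> (x - z))"
proof -
  have [measurable]: "\<eta> \<in> borel_measurable borel" using \<eta> by auto
  have "integrable lborel (\<lambda>y. \<rho> (x - y) * \<eta> y)"
    by (rule convolve_integrable[where B = B]) (use \<eta> \<rho>B \<rho>0 in auto)
  then show ?thesis
    by (subst (asm) distr_lborel_minus[of x, symmetric]) (simp add: integrable_distr_eq)
qed

lemma convolve_powr_le:
  "(\<integral>\<^sup>+x. ennreal (\<bar>convolve \<rho> \<eta> x\<bar> powr p) \<partial>lborel) \<le> (\<integral>\<^sup>+x. ennreal (\<bar>\<eta> x\<bar> powr p) \<partial>lborel)"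
proof -
  have [measurable]: "\<eta> \<in> borel_measurable borel" using \<eta> by auto
  have "(\<integral>\<^sup>+x. ennreal (\<bar>convolve \<rho> \<eta> x\<bar> powr p) \<partial>lborel)
      \<le> (\<integral>\<^sup>+x. (\<integral>\<^sup>+z. ennreal (\<rho> z) * ennreal (\<bar>\<eta> (x - z)\<bar> powr p) \<partial>lborel) \<partial>lborel)"
    unfolding convolve_commute[OF \<rho>m \<open>\<eta> \<in> _\<close>] ennreal_mult''[OF powr_ge_zero, symmetric]
    by (intro nn_integral_mono jensen_powr \<rho>0 \<rho>1 p) auto
  also have "\<dots> = (\<integral>\<^sup>+z. (\<integral>\<^sup>+x. ennreal (\<rho> z) * ennreal (\<bar>\<eta> (x - z)\<bar> powr p) \<partial>lborel) \<partial>lborel)"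
    by (rule lborel_pair.Fubini') simp
  also have "\<dots> = (\<integral>\<^sup>+z. ennreal (\<rho> z) * (\<integral>\<^sup>+x. ennreal (\<bar>\<eta> x\<bar> powr p) \<partial>lborel) \<partial>lborel)"
    by (simp add: nn_integral_cmult nn_integral_lborel_translate[of "\<lambda>x. ennreal (\<bar>\<eta> x\<bar> powr p)"])
  also have "\<dots> = (\<integral>\<^sup>+x. ennreal (\<bar>\<eta> x\<bar> powr p) \<partial>lborel)"
    by (simp add: nn_integral_multc \<rho>1)
  finally show ?thesis .
qed

text \<open>The increment of a convolution is the average of the increments of translates, and k
  depends on x - y only, so translating x and y together leaves the double integral
  unchanged.\<close>

lemma convolve_increment_powr_le:
  fixes k :: "'a \<Rightarrow> ennreal"
  assumes [measurable]: "k \<in> borel_measurable borel"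
  shows "(\<integral>\<^sup>+x. (\<integral>\<^sup>+y. ennreal (\<bar>convolve \<rho> \<eta> x - convolve \<rho> \<eta> y\<bar> powr p) * k (x - y) \<partial>lborel) \<partial>lborel)
    \<le> (\<integral>\<^sup>+x. (\<integral>\<^sup>+y. ennreal (\<bar>\<eta> x - \<eta> y\<bar> powr p) * k (x - y) \<partial>lborel) \<partial>lborel)" (is "?L \<le> ?R")
proof -
  have m[measurable]: "\<eta> \<in> borel_measurable borel" using \<eta> by auto
  let ?G = "\<lambda>x y. ennreal (\<bar>\<eta> x - \<eta> y\<bar> powr p) * k (x - y)"
  have "ennreal (\<bar>convolve \<rho> \<eta> x - convolve \<rho> \<eta> y\<bar> powr p)
      \<le> (\<integral>\<^sup>+z. ennreal (\<rho> z) * ennreal (\<bar>\<eta> (x - z) - \<eta> (y - z)\<bar> powr p) \<partial>lborel)" for x y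
  proof -
    have "convolve \<rho> \<eta> x - convolve \<rho> \<eta> y = (\<integral>z. \<rho> z * (\<eta> (x - z) - \<eta> (y - z)) \<partial>lborel)"
      unfolding convolve_commute[OF \<rho>m m] right_diff_distrib using convolve_integrable_shift by simp
    then show ?thesis
      unfolding ennreal_mult''[OF powr_ge_zero, symmetric] by (auto intro!: jensen_powr \<rho>0 \<rho>1 p)
  qed
  then have "?L \<le> (\<integral>\<^sup>+x. (\<integral>\<^sup>+y. (\<integral>\<^sup>+z. ennreal (\<rho> z) * ennreal (\<bar>\<eta> (x - z) - \<eta> (y - z)\<bar> powr p) \<partial>lborel)
      * k (x - y) \<partial>lborel) \<partial>lborel)"
    by (intro nn_integral_mono mult_right_mono) auto
  also have "\<dots> = (\<integral>\<^sup>+x. (\<integral>\<^sup>+y. (\<integral>\<^sup>+z. ennreal (\<rho> z) * ?G (x - z) (y - z) \<partial>lborel) \<partial>lborel) \<partial>lborel)"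
    by (simp add: nn_integral_multc[symmetric] mult.assoc)
  also have "\<dots> = (\<integral>\<^sup>+x. (\<integral>\<^sup>+z. (\<integral>\<^sup>+y. ennreal (\<rho> z) * ?G (x - z) (y - z) \<partial>lborel) \<partial>lborel) \<partial>lborel)"
    by (intro nn_integral_cong lborel_pair.Fubini') simp
  also have "\<dots> = (\<integral>\<^sup>+x. (\<integral>\<^sup>+z. ennreal (\<rho> z) * (\<integral>\<^sup>+y. ?G (x - z) y \<partial>lborel) \<partial>lborel) \<partial>lborel)"
    by (intro nn_integral_cong)
      (subst nn_integral_cmult, simp, rule arg_cong2[where f = "(*)"], simp,
       rule nn_integral_lborel_translate[where f = "\<lambda>y. ?G _ y"], simp)
  also have "\<dots> = (\<integral>\<^sup>+z. (\<integral>\<^sup>+x. ennreal (\<rho> z) * (\<integral>\<^sup>+y. ?G (x - z) y \<partial>lborel) \<partial>lborel) \<partial>lborel)"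
    by (rule lborel_pair.Fubini') simp
  also have "\<dots> = (\<integral>\<^sup>+z. ennreal (\<rho> z) * (\<integral>\<^sup>+x. (\<integral>\<^sup>+y. ?G x y \<partial>lborel) \<partial>lborel) \<partial>lborel)"
    by (intro nn_integral_cong)
      (subst nn_integral_cmult, simp, rule arg_cong2[where f = "(*)"], simp,
       rule nn_integral_lborel_translate[where f = "\<lambda>x. \<integral>\<^sup>+y. ?G x y \<partial>lborel"], simp)
  also have "\<dots> = ?R"
    by (simp add: nn_integral_multc \<rho>1)
  finally show ?thesis .
qed

text \<open>The mollification error is written as a double integral of increments weighted by
  \<rho>(x - y): once \<rho> is compared with the fractional kernel, finite energy yields a
  rate.\<close>

lemma convolve_diff_powr_le:
  "(\<integral>\<^sup>+x. ennreal (\<bar>convolve \<rho> \<eta> x - \<eta> x\<bar> powr p) \<partial>lborel)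
    \<le> (\<integral>\<^sup>+x. (\<integral>\<^sup>+y. ennreal (\<rho> (x - y) * \<bar>\<eta> x - \<eta> y\<bar> powr p) \<partial>lborel) \<partial>lborel)"
proof (intro nn_integral_mono)
  fix x
  have m[measurable]: "\<eta> \<in> borel_measurable borel" using \<eta> by auto
  have int\<rho>: "integrable lborel \<rho>" using \<rho>0 \<rho>1 by (intro integrableI_nonneg) auto
  have "(\<integral>z. \<rho> z \<partial>lborel) = 1" using \<rho>0 \<rho>1 by (simp add: integral_eq_nn_integral)
  then have "convolve \<rho> \<eta> x - \<eta> x = (\<integral>z. \<rho> z * (\<eta> (x - z) - \<eta> x) \<partial>lborel)"
    unfolding convolve_commute[OF \<rho>m m] right_diff_distrib using convolve_integrable_shift int\<rho> by simp
  then have "ennreal (\<bar>convolve \<rho> \<eta> x - \<eta> x\<bar> powr p) \<le> (\<integral>\<^sup>+z. ennreal (\<rho> z * \<bar>\<eta> (x - z) - \<eta> x\<bar> powr p) \<partial>lborel)"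
    by (auto intro!: jensen_powr \<rho>0 \<rho>1 p)
  also have "\<dots> = (\<integral>\<^sup>+y. ennreal (\<rho> (x - y) * \<bar>\<eta> x - \<eta> y\<bar> powr p) \<partial>lborel)"
    using nn_integral_lborel_minus[of "\<lambda>z. ennreal (\<rho> z * \<bar>\<eta> (x - z) - \<eta> x\<bar> powr p)" x]
    by (simp add: abs_minus_commute)
  finally show "ennreal (\<bar>convolve \<rho> \<eta> x - \<eta> x\<bar> powr p) \<le> (\<integral>\<^sup>+y. ennreal (\<rho> (x - y) * \<bar>\<eta> x - \<eta> y\<bar> powr p) \<partial>lborel)" .
qed

lemma convolve_nonneg: "(\<And>x. 0 \<le> \<eta> x) \<Longrightarrow> 0 \<le> convolve \<rho> \<eta> x"
  unfolding convolve_def using \<rho>0 by (intro integral_nonneg_AE) auto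

lemma convolve_support:
  assumes "\<And>x. e \<le> norm x \<Longrightarrow> \<rho> x = 0" "\<And>x. R \<le> dist x0 x \<Longrightarrow> \<eta> x = 0" "R + e \<le> dist x0 x"
  shows "convolve \<rho> \<eta> x = 0"
proof -
  have "\<rho> (x - y) * \<eta> y = 0" for y
    using assms(1)[of "x - y"] assms(2)[of y] assms(3) dist_triangle[of x0 x y]
    by (cases "R \<le> dist x0 y") (auto simp: dist_norm norm_minus_commute)
  then show ?thesis unfolding convolve_def by (simp only: Bochner_Integration.integral_zero)
qed

end

section \<open>Integrals of the fractional kernel\<close>

text \<open>At the origin the value is 0, since \<open>0 powr a = 0\<close>; lower bounds by powers
  of a radius therefore hold only for z different from 0.\<close>

definition kern :: "real \<Rightarrow> 'a::euclidean_space \<Rightarrow> real" where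
  "kern a z = norm z powr (- real DIM('a) - a)"

lemma kern_eq_inverse: "kern a z = inverse (norm (z::'a::euclidean_space) powr (real DIM('a) + a))"
proof -
  have neg: "- real DIM('a) - a = - (real DIM('a) + a)" by simp
  show ?thesis unfolding kern_def neg by (rule powr_minus)
qed

lemma kern_nonneg [simp]: "0 \<le> kern a z"
  by (simp add: kern_def)

lemma kern_minus: "kern a (x - y) = kern a (y - x)"
  by (simp add: kern_def norm_minus_commute)

lemma kern_measurable [measurable]: "kern a \<in> borel_measurable borel"
  unfolding kern_def[abs_def] by measurable

lemma kern_mono: "0 < c \<Longrightarrow> c \<le> norm z \<Longrightarrow> 0 < a \<Longrightarrow> kern a (z::'a::euclidean_space) \<le> c powr (- real DIM('a) - a)"
  unfolding kern_def by (intro powr_mono2') auto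

lemma dyadic_interval:
  fixes t :: real
  assumes "1 \<le> t"
  obtains i :: nat where "2 ^ i \<le> t" "t < 2 ^ Suc i"
proof
  let ?i = "nat \<lfloor>log 2 t\<rfloor>"
  have l: "0 \<le> log 2 t" using assms by simp
  have "2 ^ ?i = 2 powr real ?i" by (simp add: powr_realpow)
  also have "\<dots> \<le> 2 powr log 2 t" using l by (intro powr_mono) (auto simp: of_nat_nat)
  finally show "2 ^ ?i \<le> t" using assms by simp
  have "t = 2 powr log 2 t" using assms by simp
  also have "\<dots> < 2 powr real (Suc ?i)"
  proof (rule powr_less_mono)
    have "real (Suc ?i) = of_int \<lfloor>log 2 t\<rfloor> + 1" using l by simp
    then show "log 2 t < real (Suc ?i)" using real_of_int_floor_add_one_gt by metis
  qed simp
  finally show "t < 2 ^ Suc ?i" by (simp only: powr_realpow zero_less_numeral)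
qed

text \<open>Balls rather than annuli serve as dyadic pieces: overlaps only enlarge the dominating
  series, and the volume of a ball is explicit.\<close>

lemma nn_integral_dyadic_bound:
  fixes f :: "'a::euclidean_space \<Rightarrow> ennreal" and c \<rho> :: "nat \<Rightarrow> real"
  assumes f: "\<And>z. f z \<noteq> 0 \<Longrightarrow> \<exists>i. norm z < \<rho> i \<and> f z \<le> ennreal (c i)"
    and \<rho>: "\<And>i. 0 \<le> \<rho> i" and c: "\<And>i. 0 \<le> c i"
    and sums: "(\<lambda>i. c i * \<rho> i ^ DIM('a)) sums S"
  shows "(\<integral>\<^sup>+z. f z \<partial>lborel) \<le> ennreal (unit_ball_vol (real DIM('a)) * S)"
proof -
  have "f z \<le> (\<Sum>i. ennreal (c i) * indicator (ball 0 (\<rho> i)) z)" for z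
  proof (cases "f z = 0")
    case False
    then obtain i where i: "norm z < \<rho> i" "f z \<le> ennreal (c i)" using f by blast
    then have "f z \<le> (\<Sum>i\<in>{i}. ennreal (c i) * indicator (ball 0 (\<rho> i)) z)" by simp
    also have "\<dots> \<le> (\<Sum>i. ennreal (c i) * indicator (ball 0 (\<rho> i)) z)" by (intro sum_le_suminf) auto
    finally show ?thesis .
  qed simp
  then have "(\<integral>\<^sup>+z. f z \<partial>lborel) \<le> (\<integral>\<^sup>+z. (\<Sum>i. ennreal (c i) * indicator (ball 0 (\<rho> i)) (z::'a)) \<partial>lborel)"
    by (intro nn_integral_mono) auto
  also have "\<dots> = (\<Sum>i. ennreal (c i) * ennreal (unit_ball_vol (real DIM('a)) * \<rho> i ^ DIM('a)))"
  proof (subst nn_integral_suminf)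
    show "(\<lambda>z::'a. ennreal (c i) * indicator (ball 0 (\<rho> i)) z) \<in> borel_measurable lborel" for i
      by (intro borel_measurable_times_ennreal borel_measurable_const borel_measurable_indicator) simp
  qed (use \<rho> in \<open>simp add: nn_integral_cmult_indicator emeasure_ball\<close>)
  also have "\<dots> = (\<Sum>i. ennreal (unit_ball_vol (real DIM('a)) * (c i * \<rho> i ^ DIM('a))))"
    using c \<rho> by (simp add: ennreal_mult[symmetric] mult_ac)
  also have "\<dots> = ennreal (unit_ball_vol (real DIM('a)) * S)"
    using sums_mult[OF sums, of "unit_ball_vol (real DIM('a))"] c \<rho>
    by (intro suminf_ennreal_eq) auto
  finally show ?thesis .
qed

lemma nn_integral_kern_outside:
  assumes a: "0 < a"
  obtains C where "0 < C"
    and "\<And>r x::'a::euclidean_space. 0 < r \<Longrightarrow> (\<integral>\<^sup>+y. ennreal (kern a (x - y)) * indicator {y. r \<le> dist x y} y \<partial>lborel)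
      \<le> ennreal (C * r powr - a)"
proof
  let ?n = "real DIM('a)"
  let ?S = "2 ^ DIM('a) * (1 / (1 - 2 powr - a))"
  let ?I = "\<lambda>(x::'a) r. \<integral>\<^sup>+y. ennreal (kern a (x - y)) * indicator {y. r \<le> dist x y} y \<partial>lborel"
  have q: "2 powr - a < (1::real)" using a by (simp add: powr_less_one)
  then show "0 < unit_ball_vol ?n * ?S" by simp
  fix r :: real and x :: 'a assume r: "0 < r"
  have "?I x r = (\<integral>\<^sup>+z. ennreal (kern a z) * indicator {z. r \<le> norm z} (z::'a) \<partial>lborel)"
    using nn_integral_lborel_minus[of "\<lambda>z. ennreal (kern a z) * indicator {z. r \<le> norm z} z" x]
    by (simp add: dist_norm indicator_def)
  also have "\<dots> \<le> ennreal (unit_ball_vol ?n * (r powr - a * ?S))"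
  \<comment> \<open>On the annulus with inner radius 2^i r the kernel is at most its value there,
    and the ball of twice that radius has volume of order (2^i r)^n; the products form a geometric
    series with ratio 2^(-a).\<close>
  proof (rule nn_integral_dyadic_bound[where c = "\<lambda>i. (2 ^ i * r) powr (- ?n - a)" and \<rho> = "\<lambda>i. 2 ^ Suc i * r"])
    fix z :: 'a assume "ennreal (kern a z) * indicator {z. r \<le> norm z} z \<noteq> 0"
    then have rz: "r \<le> norm z" by (auto split: split_indicator_asm)
    then obtain i where i: "2 ^ i \<le> norm z / r" "norm z / r < 2 ^ Suc i"
      using dyadic_interval[of "norm z / r"] r by auto
    then show "\<exists>i. norm z < 2 ^ Suc i * r \<and> ennreal (kern a z) * indicator {z. r \<le> norm z} z \<le> ennreal ((2 ^ i * r) powr (- ?n - a))"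
      using r a rz by (intro exI[of _ i]) (auto simp: field_simps intro!: ennreal_leI kern_mono)
  next
    have "(\<lambda>i. r powr - a * (2 ^ DIM('a) * (2 powr - a) ^ i)) sums (r powr - a * ?S)"
      using q by (intro sums_mult geometric_sums) auto
    also have "(\<lambda>i. r powr - a * (2 ^ DIM('a) * (2 powr - a) ^ i)) =
        (\<lambda>i. (2 ^ i * r) powr (- ?n - a) * (2 ^ Suc i * r) ^ DIM('a))"
    proof
      fix i
      have "(2 ^ i * r) powr (- ?n - a) = (2 ^ i * r) powr (- a) / (2 ^ i * r) ^ DIM('a)"
        using r by (simp add: powr_diff powr_minus powr_realpow field_simps)
      moreover have "(2 ^ i * r) powr (- a) = (2 powr - a) ^ i * r powr - a"
        using r by (simp add: powr_mult powr_realpow[symmetric] powr_powr mult.commute)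
      ultimately show "r powr - a * (2 ^ DIM('a) * (2 powr - a) ^ i) = (2 ^ i * r) powr (- ?n - a) * (2 ^ Suc i * r) ^ DIM('a)"
        using r by (simp add: power_mult_distrib)
    qed
    finally show "(\<lambda>i. (2 ^ i * r) powr (- ?n - a) * (2 ^ Suc i * r) ^ DIM('a)) sums (r powr - a * ?S)" .
  qed (use r in auto)
  finally show "?I x r \<le> ennreal (unit_ball_vol ?n * ?S * r powr - a)" by (simp add: mult_ac)
qed

text \<open>With a = - b the kernel is |z|^(b - n), which is integrable near 0. It arises when the
  singular kernel is multiplied by the p-th power of a Lipschitz increment, with b = p - s
  p.\<close>

lemma nn_integral_kern_inside:
  assumes b: "0 < b"
  obtains C where "0 < C"
    and "\<And>r x::'a::euclidean_space. 0 < r \<Longrightarrow> (\<integral>\<^sup>+y. ennreal (kern (- b) (x - y)) * indicator {y. dist x y < r} y \<partial>lborel)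
      \<le> ennreal (C * r powr b)"
proof
  let ?n = "real DIM('a)"
  let ?S = "2 ^ DIM('a) * (1 / (1 - 2 powr - b))"
  let ?I = "\<lambda>(x::'a) r. \<integral>\<^sup>+y. ennreal (kern (- b) (x - y)) * indicator {y. dist x y < r} y \<partial>lborel"
  have q: "2 powr - b < (1::real)" using b by (simp add: powr_less_one)
  then show "0 < unit_ball_vol ?n * ?S" by simp
  fix r :: real and x :: 'a assume r: "0 < r"
  have "?I x r = (\<integral>\<^sup>+z. ennreal (kern (- b) z) * indicator {z. norm z < r} (z::'a) \<partial>lborel)"
    using nn_integral_lborel_minus[of "\<lambda>z. ennreal (kern (- b) z) * indicator {z. norm z < r} z" x]
    by (simp add: dist_norm indicator_def)
  also have "\<dots> \<le> ennreal (unit_ball_vol ?n * (r powr b * ?S))"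
  proof (rule nn_integral_dyadic_bound[where c = "\<lambda>i. (r / 2 ^ i) powr b * (r / 2 ^ Suc i) powr (- ?n)"
        and \<rho> = "\<lambda>i. r / 2 ^ i"])
    fix z :: 'a assume "ennreal (kern (- b) z) * indicator {z. norm z < r} z \<noteq> 0"
    then have rz: "norm z < r" "0 < norm z" by (auto simp: kern_def split: split_indicator_asm)
    then obtain i where i: "2 ^ i \<le> r / norm z" "r / norm z < 2 ^ Suc i"
      using dyadic_interval[of "r / norm z"] r by (auto simp: field_simps)
    have i': "norm z \<le> r / 2 ^ i" "r / 2 ^ Suc i \<le> norm z"
      using i rz by (auto simp: field_simps)
    \<comment> \<open>The exponent b - n may have either sign, so the increasing factor |z|^b is
      bounded at the outer radius and the decreasing factor |z|^(-n) at the inner one.\<close>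
    have le: "kern (- b) z \<le> (r / 2 ^ i) powr b * (r / 2 ^ Suc i) powr (- ?n)"
    proof -
      have "kern (- b) z = norm z powr b * norm z powr (- ?n)"
        using rz by (simp add: kern_def powr_add[symmetric])
      also have "\<dots> \<le> (r / 2 ^ i) powr b * (r / 2 ^ Suc i) powr (- ?n)"
        using i' r b by (intro mult_mono powr_mono2 powr_mono2') auto
      finally show ?thesis .
    qed
    show "\<exists>i. norm z < r / 2 ^ i \<and> ennreal (kern (- b) z) * indicator {z. norm z < r} z
        \<le> ennreal ((r / 2 ^ i) powr b * (r / 2 ^ Suc i) powr (- ?n))"
    \<comment> \<open>The dyadic bound asks for the strict inequality norm z < r/2^i. On the sphere
      of equality the previous index is used; it exists because norm z < r excludes i = 0.\<close>
    proof (cases "norm z < r / 2 ^ i")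
      case True then show ?thesis using le rz by (intro exI[of _ i]) (auto intro!: ennreal_leI)
    next
      case False
      then have e: "norm z = r / 2 ^ i" using i' by simp
      then obtain j where j: "i = Suc j" using rz by (cases i) auto
      have "kern (- b) z \<le> (r / 2 ^ j) powr b * (r / 2 ^ Suc j) powr (- ?n)"
      proof -
        have "kern (- b) z = norm z powr b * norm z powr (- ?n)"
          using rz by (simp add: kern_def powr_add[symmetric])
        also have "\<dots> \<le> (r / 2 ^ j) powr b * (r / 2 ^ Suc j) powr (- ?n)"
          using e r b by (intro mult_mono powr_mono2 powr_mono2') (auto simp: j field_simps)
        finally show ?thesis .
      qed
      then show ?thesis
        using e r rz by (intro exI[of _ j]) (auto intro!: ennreal_leI simp: j field_simps)
    qed
  next
    have "(\<lambda>i. r powr b * (2 ^ DIM('a) * (2 powr - b) ^ i)) sums (r powr b * ?S)"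
      using q by (intro sums_mult geometric_sums) auto
    also have "(\<lambda>i. r powr b * (2 ^ DIM('a) * (2 powr - b) ^ i)) =
        (\<lambda>i. (r / 2 ^ i) powr b * (r / 2 ^ Suc i) powr (- ?n) * (r / 2 ^ i) ^ DIM('a))"
    proof
      fix i
      have "(r / 2 ^ Suc i) powr (- ?n) * (r / 2 ^ i) ^ DIM('a) = 2 ^ DIM('a)"
        using r by (simp add: powr_minus powr_realpow power_divide power_mult_distrib field_simps)
      moreover have "(r / 2 ^ i) powr b = (2 powr - b) ^ i * r powr b"
      proof -
        have "(2 ^ i) powr b = (2 powr b :: real) ^ i" by (induction i) (auto simp: powr_mult)
        then show ?thesis using r by (simp add: powr_divide powr_minus power_inverse field_simps)
      qed
      ultimately show "r powr b * (2 ^ DIM('a) * (2 powr - b) ^ i) = (r / 2 ^ i) powr b * (r / 2 ^ Suc i) powr (- ?n) * (r / 2 ^ i) ^ DIM('a)"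
        by (simp only: mult.assoc) (simp add: mult_ac)
    qed
    finally show "(\<lambda>i. (r / 2 ^ i) powr b * (r / 2 ^ Suc i) powr (- ?n) * (r / 2 ^ i) ^ DIM('a)) sums (r powr b * ?S)" .
  qed (use r in auto)
  finally show "?I x r \<le> ennreal (unit_ball_vol ?n * ?S * r powr b)" by (simp add: mult_ac)
qed

section \<open>Passage to the limit\<close>

lemma integral_nonneg_fatou:
  fixes F U :: "'b \<Rightarrow> real" and Fj Uj :: "nat \<Rightarrow> 'b \<Rightarrow> real"
  assumes [measurable]: "\<And>j. Fj j \<in> borel_measurable M" "\<And>j. Uj j \<in> borel_measurable M"
      "F \<in> borel_measurable M" "U \<in> borel_measurable M"
    and lim: "AE z in M. (\<lambda>j. Fj j z) \<longlonglongrightarrow> F z" "AE z in M. (\<lambda>j. Uj j z) \<longlonglongrightarrow> U z"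
    and le: "\<And>j. AE z in M. Fj j z \<le> Uj j z" and U0: "\<And>j z. 0 \<le> Uj j z" "\<And>z. 0 \<le> U z"
    and fin: "(\<integral>\<^sup>+z. ennreal (U z) \<partial>M) < \<infinity>"
    and bnd: "\<And>j. (\<integral>\<^sup>+z. ennreal (Uj j z) \<partial>M) \<le> (\<integral>\<^sup>+z. ennreal (U z) \<partial>M)"
    and Fj: "\<And>j. (\<integral>\<^sup>+z. ennreal (- Fj j z) \<partial>M) < \<infinity>"
      "\<And>j. (\<integral>\<^sup>+z. ennreal (- Fj j z) \<partial>M) \<le> (\<integral>\<^sup>+z. ennreal (Fj j z) \<partial>M)"
  shows "integrable M F" "0 \<le> (\<integral>z. F z \<partial>M)"
proof -
  have iU: "integrable M U" using fin U0 by (intro integrableI_nonneg) auto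
  have iUj: "integrable M (Uj j)" for j
    using fin bnd[of j] U0 by (intro integrableI_nonneg) auto
  have UjU: "(\<integral>z. Uj j z \<partial>M) \<le> (\<integral>z. U z \<partial>M)" for j
    using bnd[of j] iU iUj[of j] U0
    by (simp add: nn_integral_eq_integral integral_nonneg_AE)
  \<comment> \<open>The majorant controls the positive part and the hypothesis the negative part;
    only now may the extended integral be read as a Bochner integral.\<close>
  have iFj: "integrable M (Fj j)" for j
  proof -
    have "(\<integral>\<^sup>+z. ennreal (Fj j z) \<partial>M) \<le> (\<integral>\<^sup>+z. ennreal (Uj j z) \<partial>M)"
      using le[of j] by (intro nn_integral_mono_AE) (auto intro: ennreal_leI)
    then have "(\<integral>\<^sup>+z. ennreal (Fj j z) \<partial>M) < \<infinity>"
      using fin bnd[of j] by (meson le_less_trans)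
    then show ?thesis using Fj(1)[of j] by (auto simp: real_integrable_def less_top)
  qed
  have Fj0: "0 \<le> (\<integral>z. Fj j z \<partial>M)" for j
  proof -
    have "enn2real (\<integral>\<^sup>+z. ennreal (- Fj j z) \<partial>M) \<le> enn2real (\<integral>\<^sup>+z. ennreal (Fj j z) \<partial>M)"
      using Fj(2)[of j] iFj[of j] by (intro enn2real_mono) (auto simp: real_integrable_def less_top)
    then show ?thesis by (simp add: real_lebesgue_integral_def[OF iFj])
  qed
  have leF: "AE z in M. F z \<le> U z"
  proof -
    have "AE z in M. \<forall>j. Fj j z \<le> Uj j z" using le by (simp add: AE_all_countable)
    then show ?thesis using lim by eventually_elim (blast intro: LIMSEQ_le)
  qed
  have "(\<integral>\<^sup>+z. ennreal (U z - F z) \<partial>M) = (\<integral>\<^sup>+z. liminf (\<lambda>j. ennreal (Uj j z - Fj j z)) \<partial>M)"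
  proof (rule nn_integral_cong_AE)
    show "AE z in M. ennreal (U z - F z) = liminf (\<lambda>j. ennreal (Uj j z - Fj j z))"
      using lim
    proof eventually_elim
      case (elim z)
      then have "(\<lambda>j. ennreal (Uj j z - Fj j z)) \<longlonglongrightarrow> ennreal (U z - F z)"
        by (intro tendsto_ennrealI tendsto_diff)
      then show ?case by (simp add: lim_imp_Liminf)
    qed
  qed
  also have "\<dots> \<le> liminf (\<lambda>j. \<integral>\<^sup>+z. ennreal (Uj j z - Fj j z) \<partial>M)"
    by (rule nn_integral_liminf) simp
  also have "\<dots> \<le> liminf (\<lambda>j::nat. ennreal (\<integral>z. U z \<partial>M))"
  \<comment> \<open>Fatou is applied to Uj - Fj \<ge> 0. As Fj has nonnegative integral, Uj - Fj has
    integral at most that of Uj, hence of U; so U - F has integral at most that of U, which gives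
    both claims about F. A bound on the integrals of the majorants replaces a common dominating
    function.\<close>
  proof (intro Liminf_mono always_eventually allI)
    fix j
    have "(\<integral>\<^sup>+z. ennreal (Uj j z - Fj j z) \<partial>M) = ennreal (\<integral>z. Uj j z - Fj j z \<partial>M)"
      using le[of j] iUj iFj by (intro nn_integral_eq_integral) auto
    also have "\<dots> \<le> ennreal (\<integral>z. U z \<partial>M)"
      using UjU[of j] Fj0[of j] iUj iFj by (intro ennreal_leI) simp
    finally show "(\<integral>\<^sup>+z. ennreal (Uj j z - Fj j z) \<partial>M) \<le> ennreal (\<integral>z. U z \<partial>M)" .
  qed
  finally have le2: "(\<integral>\<^sup>+z. ennreal (U z - F z) \<partial>M) \<le> ennreal (\<integral>z. U z \<partial>M)"
    by (simp add: Liminf_const)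
  have iUF: "integrable M (\<lambda>z. U z - F z)"
    using leF le2 by (intro integrableI_nonneg) (auto intro: le_less_trans)
  have "integrable M (\<lambda>z. U z - (U z - F z))" using iU iUF by (rule Bochner_Integration.integrable_diff)
  then show iF: "integrable M F" by simp
  have "(\<integral>\<^sup>+z. ennreal (U z - F z) \<partial>M) = ennreal (\<integral>z. U z - F z \<partial>M)"
    using leF iUF by (intro nn_integral_eq_integral) auto
  with le2 have "(\<integral>z. U z - F z \<partial>M) \<le> (\<integral>z. U z \<partial>M)"
    using U0 by (simp add: integral_nonneg_AE)
  then show "0 \<le> (\<integral>z. F z \<partial>M)" using iU iF by simp
qed

lemma AE_pair_lborel:
  fixes P :: "'a::euclidean_space \<Rightarrow> bool"
  assumes "AE x in lborel. P x"
  shows "AE z in lborel \<Otimes>\<^sub>M lborel. P (fst z) \<and> P (snd z)"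
proof -
  obtain N where N: "N \<in> null_sets lborel" "{x. \<not> P x} \<subseteq> N"
    using assms by (auto simp: eventually_ae_filter)
  then have [measurable]: "N \<in> sets borel" by auto
  have "AE x in lborel. x \<notin> N" using AE_not_in[OF N(1)] .
  then have "AE x in lborel. AE y in lborel. fst (x, y) \<notin> N \<and> snd (x, y) \<notin> N"
    by (auto elim: eventually_mono)
  then have "AE z in lborel \<Otimes>\<^sub>M lborel. fst z \<notin> N \<and> snd z \<notin> N"
  proof (intro lborel_pair.AE_pair_measure)
    have "Measurable.pred (lborel \<Otimes>\<^sub>M lborel) (\<lambda>z::'a \<times> 'a. fst z \<notin> N \<and> snd z \<notin> N)"
      by measurable
    then show "{z \<in> space (lborel \<Otimes>\<^sub>M lborel). fst z \<notin> N \<and> snd z \<notin> N} \<in> sets (lborel \<Otimes>\<^sub>M lborel)"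
      unfolding pred_def .
  qed
  then show ?thesis using N(2) by (auto elim: eventually_mono)
qed

lemma nn_integral_pair_mult:
  fixes f h :: "'a::euclidean_space \<Rightarrow> real"
  assumes [measurable]: "f \<in> borel_measurable borel" "h \<in> borel_measurable borel"
    and "\<And>x. 0 \<le> f x" "\<And>x. 0 \<le> h x"
  shows "(\<integral>\<^sup>+z. ennreal (f (fst z) * h (snd z)) \<partial>(lborel \<Otimes>\<^sub>M lborel)) = (\<integral>\<^sup>+x. f x \<partial>lborel) * (\<integral>\<^sup>+x. h x \<partial>lborel)"
    and "(\<integral>\<^sup>+z. ennreal (f (snd z) * h (fst z)) \<partial>(lborel \<Otimes>\<^sub>M lborel)) = (\<integral>\<^sup>+x. f x \<partial>lborel) * (\<integral>\<^sup>+x. h x \<partial>lborel)"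
proof -
  show "(\<integral>\<^sup>+z. ennreal (f (fst z) * h (snd z)) \<partial>(lborel \<Otimes>\<^sub>M lborel)) = (\<integral>\<^sup>+x. f x \<partial>lborel) * (\<integral>\<^sup>+x. h x \<partial>lborel)"
    using assms(3,4) by (subst lborel.nn_integral_fst[symmetric])
      (simp_all add: ennreal_mult nn_integral_cmult nn_integral_multc)
  show "(\<integral>\<^sup>+z. ennreal (f (snd z) * h (fst z)) \<partial>(lborel \<Otimes>\<^sub>M lborel)) = (\<integral>\<^sup>+x. f x \<partial>lborel) * (\<integral>\<^sup>+x. h x \<partial>lborel)"
    using assms(3,4) by (subst lborel.nn_integral_fst[symmetric])
      (simp_all add: ennreal_mult nn_integral_cmult nn_integral_multc)
qed

text \<open>The series of the |f j|^p has finite integral, so it converges almost everywhere and its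
  terms tend to zero. Summable errors thus give convergence of the full sequence, without passing to
  a subsequence.\<close>

lemma AE_tendsto_of_summable:
  fixes f :: "nat \<Rightarrow> 'b \<Rightarrow> real"
  assumes [measurable]: "\<And>j. f j \<in> borel_measurable M"
    and le: "\<And>j. (\<integral>\<^sup>+x. ennreal (\<bar>f j x\<bar> powr p) \<partial>M) \<le> ennreal (c j)"
    and c: "summable c" "\<And>j. 0 \<le> c j" and p: "0 < p"
  shows "AE x in M. (\<lambda>j. f j x) \<longlonglongrightarrow> 0"
proof -
  have "(\<integral>\<^sup>+x. (\<Sum>j. ennreal (\<bar>f j x\<bar> powr p)) \<partial>M) = (\<Sum>j. \<integral>\<^sup>+x. ennreal (\<bar>f j x\<bar> powr p) \<partial>M)"
    by (rule nn_integral_suminf) simp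
  also have "\<dots> \<le> (\<Sum>j. ennreal (c j))" by (intro suminf_le le) auto
  also have "\<dots> = ennreal (\<Sum>j. c j)" using c by (intro suminf_ennreal2) auto
  finally have "(\<integral>\<^sup>+x. (\<Sum>j. ennreal (\<bar>f j x\<bar> powr p)) \<partial>M) \<noteq> \<infinity>" by (auto simp: top_unique)
  then have "AE x in M. (\<Sum>j. ennreal (\<bar>f j x\<bar> powr p)) \<noteq> \<infinity>"
    by (intro nn_integral_PInf_AE) auto
  then show ?thesis
  proof eventually_elim
    case (elim x)
    then have "summable (\<lambda>j. \<bar>f j x\<bar> powr p)" by (intro summable_suminf_not_top) auto
    then have "(\<lambda>j. \<bar>f j x\<bar> powr p) \<longlonglongrightarrow> 0" by (rule summable_LIMSEQ_zero)
    then have "(\<lambda>j. (\<bar>f j x\<bar> powr p) powr (1 / p)) \<longlonglongrightarrow> 0"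
      by (rule tendsto_zero_powrI[where b = "1/p"]) (use p in auto)
    then have "(\<lambda>j. \<bar>f j x\<bar>) \<longlonglongrightarrow> 0" using p by (simp add: powr_powr)
    then show ?case by (simp add: tendsto_rabs_zero_iff)
  qed
qed

section \<open>The weight at infinity and elementary bounds for the flux\<close>

definition weight :: "real \<Rightarrow> 'a::euclidean_space \<Rightarrow> real" where
  "weight a y = (1 + norm y) powr (- real DIM('a) - a)"

lemma weight_nonneg [simp]: "0 \<le> weight a y"
  by (simp add: weight_def)

lemma weight_measurable [measurable]: "weight a \<in> borel_measurable borel"
  unfolding weight_def[abs_def] by measurable

text \<open>By the triangle inequality 1 + |y| \<le> (1 + Q) + |x - y|, and |x - y| \<ge> d gives 1
  + Q \<le> ((1 + Q)/d) |x - y|; the two coefficients add up to the base of the constant.\<close>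

lemma kern_le_weight:
  fixes x y :: "'a::euclidean_space"
  assumes "0 < d" "d \<le> norm (x - y)" "norm x \<le> Q" "0 < a"
  shows "kern a (x - y) \<le> ((1 + Q) / d + 1) powr (real DIM('a) + a) * weight a y"
proof -
  let ?L = "(1 + Q) / d + 1"
  have Q: "0 \<le> Q" using assms(3) norm_ge_zero order_trans by blast
  then have L: "0 < ?L" using assms by (simp add: add_pos_pos add_nonneg_pos)
  have "1 + norm y \<le> 1 + Q + norm (x - y)"
    using assms(3) norm_triangle_sub[of y x] by (simp add: norm_minus_commute)
  also have "\<dots> \<le> (1 + Q) * (norm (x - y) / d) + norm (x - y)"
  proof -
    have "(1 + Q) * 1 \<le> (1 + Q) * (norm (x - y) / d)"
      using assms Q by (intro mult_left_mono) auto
    then show ?thesis by simp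
  qed
  also have "\<dots> = ?L * norm (x - y)" by (simp add: algebra_simps)
  finally have "(1 + norm y) / ?L \<le> norm (x - y)" using L by (simp add: field_simps)
  then have "kern a (x - y) \<le> ((1 + norm y) / ?L) powr (- real DIM('a) - a)"
    using L assms(4) by (intro kern_mono divide_pos_pos) (auto intro: add_pos_nonneg)
  also have "\<dots> = ?L powr (real DIM('a) + a) * weight a y"
  proof -
    have neg: "- real DIM('a) - a = - (real DIM('a) + a)" by simp
    have "((1 + norm y) / ?L) powr (real DIM('a) + a) = (1 + norm y) powr (real DIM('a) + a) / ?L powr (real DIM('a) + a)"
      by (rule powr_divide)
    then show ?thesis by (simp only: weight_def neg powr_minus inverse_divide) (simp only: divide_inverse)
  qed
  finally show ?thesis .
qed

lemma nn_integral_weight_finite: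
  assumes "0 < a"
  shows "(\<integral>\<^sup>+y. ennreal (weight a (y::'a::euclidean_space)) \<partial>lborel) < \<infinity>"
proof -
  obtain C where C: "\<And>r x::'a. 0 < r \<Longrightarrow> (\<integral>\<^sup>+y. ennreal (kern a (x - y)) * indicator {y. r \<le> dist x y} y \<partial>lborel)
      \<le> ennreal (C * r powr - a)"
    using nn_integral_kern_outside[OF assms] by blast
  have [measurable]: "ball (0::'a) 1 \<in> sets borel" by simp
  have "ennreal (weight a y) \<le> indicator (ball 0 1) y + ennreal (kern a (0 - y)) * indicator {y. 1 \<le> dist 0 y} y" for y :: 'a
  proof (cases "norm y < 1")
    case True
    have "weight a y \<le> 1 powr (- real DIM('a) - a)"
      unfolding weight_def using assms by (intro powr_mono2') auto
    then show ?thesis using True by (simp add: ennreal_le_1)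
  next
    case False
    then have "weight a y \<le> kern a (0 - y)"
      unfolding weight_def kern_def using assms by (intro powr_mono2') auto
    then show ?thesis using False by (simp add: ennreal_leI)
  qed
  then have "(\<integral>\<^sup>+y. ennreal (weight a (y::'a)) \<partial>lborel) \<le>
     (\<integral>\<^sup>+y. indicator (ball (0::'a) 1) y + ennreal (kern a (0 - y)) * indicator {y. 1 \<le> dist 0 y} y \<partial>lborel)"
    by (intro nn_integral_mono)
  also have "\<dots> = emeasure lborel (ball (0::'a) 1) + (\<integral>\<^sup>+y. ennreal (kern a ((0::'a) - y)) * indicator {y. 1 \<le> dist 0 y} y \<partial>lborel)"
    by (subst nn_integral_add) auto
  also have "\<dots> < \<infinity>"
    using C[of 1 0] by (auto simp: emeasure_ball less_top[symmetric] top_unique)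
  finally show ?thesis .
qed

text \<open>Young's inequality with constant 1, obtained by replacing the smaller of A and g by the
  larger.\<close>

lemma powr_pred_mult_le:
  fixes A g :: real
  assumes "0 \<le> A" "0 \<le> g" "1 < p"
  shows "A powr (p - 1) * g \<le> A powr p + g powr p"
proof (cases "g \<le> A")
  case True
  then have "A powr (p - 1) * g \<le> A powr (p - 1) * A" by (intro mult_left_mono) auto
  also have "\<dots> = A powr p" using assms by (cases "A = 0") (auto simp: powr_mult_base mult.commute)
  finally show ?thesis by (simp add: add_increasing2)
next
  case False
  then have "A powr (p - 1) * g \<le> g powr (p - 1) * g" using assms by (intro mult_right_mono powr_mono2) auto
  also have "\<dots> = g powr p" using assms by (cases "g = 0") (auto simp: powr_mult_base mult.commute)
  finally show ?thesis by (simp add: add_increasing)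
qed

text \<open>Valid at t = 0 since \<open>0 powr q = 0\<close>; by the same convention the flux |t|^(p
  - 2) t vanishes at 0 even for p < 2.\<close>

lemma abs_powr_pred: "\<bar>t\<bar> powr (p - 2) * \<bar>t\<bar> = \<bar>t\<bar> powr (p - 1)" for t p :: real
  using powr_mult_base[of "\<bar>t\<bar>" "p - 2"] by (simp add: mult.commute)

text \<open>One constant for all q \<ge> 0, because it is applied with q = p and also with q = p -
  1, where the power may be concave.\<close>

lemma powr_add_le:
  fixes A B :: real
  assumes "0 \<le> A" "0 \<le> B" "0 \<le> q"
  shows "(A + B) powr q \<le> 2 powr q * (A powr q + B powr q)"
proof -
  have "(A + B) powr q \<le> (2 * max A B) powr q" using assms by (intro powr_mono2) auto
  also have "\<dots> = 2 powr q * max A B powr q" using assms by (simp add: powr_mult)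
  also have "max A B powr q \<le> A powr q + B powr q" by (auto simp: max_def)
  finally show ?thesis by simp
qed

text \<open>Meant for t = u x - u y with A = |u x| and B the negative part of u at y. Only an upper
  bound on t enters, so large positive values of u y cost nothing.\<close>

lemma powr_flux_le:
  fixes t g A B :: real
  assumes "0 \<le> A" "0 \<le> B" "t \<le> A + B" "0 \<le> g" "1 < p"
  shows "\<bar>t\<bar> powr (p - 2) * t * g \<le> 2 powr (p - 1) * ((A powr p + g powr p) + B powr (p - 1) * g)"
proof (cases "t \<le> 0")
  case True
  then have "\<bar>t\<bar> powr (p - 2) * t * g \<le> 0" using assms by (simp add: mult_nonneg_nonpos mult_nonpos_nonneg)
  also have "0 \<le> 2 powr (p - 1) * ((A powr p + g powr p) + B powr (p - 1) * g)" using assms by simp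
  finally show ?thesis .
next
  case False
  then have "\<bar>t\<bar> powr (p - 2) * t * g = t powr (p - 1) * g" using abs_powr_pred[of t p] by simp
  also have "\<dots> \<le> (A + B) powr (p - 1) * g" using assms False by (intro mult_right_mono powr_mono2) auto
  also have "\<dots> \<le> 2 powr (p - 1) * (A powr (p - 1) + B powr (p - 1)) * g"
    using assms by (intro mult_right_mono powr_add_le) auto
  also have "\<dots> = 2 powr (p - 1) * (A powr (p - 1) * g + B powr (p - 1) * g)" by (simp add: algebra_simps)
  also have "\<dots> \<le> 2 powr (p - 1) * ((A powr p + g powr p) + B powr (p - 1) * g)"
    using assms by (intro mult_left_mono add_mono powr_pred_mult_le) auto
  finally show ?thesis .
qed

lemma powr_flux_le':
  fixes t d :: real
  assumes "1 < p"
  shows "\<bar>t\<bar> powr (p - 2) * t * d \<le> \<bar>t\<bar> powr p + \<bar>d\<bar> powr p"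
proof -
  have "\<bar>t\<bar> powr (p - 2) * t * d \<le> \<bar>t\<bar> powr (p - 2) * \<bar>t\<bar> * \<bar>d\<bar>"
    by (metis abs_ge_self abs_mult abs_of_nonneg powr_ge_zero)
  also have "\<dots> = \<bar>t\<bar> powr (p - 1) * \<bar>d\<bar>" by (simp add: abs_powr_pred)
  also have "\<dots> \<le> \<bar>t\<bar> powr p + \<bar>d\<bar> powr p" using assms by (intro powr_pred_mult_le) auto
  finally show ?thesis .
qed

section \<open>Nonsmooth test functions\<close>

text \<open>Formulated for Borel functions and the product of two Borel Lebesgue measures, where
  Tonelli's theorem applies directly; data on completed spaces are brought into this form at the
  end. The energy is finite on balls only, and far away nothing but the tail of the negative part is
  known.\<close>

locale borel_supersolution =
  fixes s p \<Lambda> :: real and K :: "'a::euclidean_space \<Rightarrow> 'a \<Rightarrow> real" and \<Omega> :: "'a set" and u :: "'a \<Rightarrow> real"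
  assumes s: "0 < s" "s < 1" and p: "1 < p" and \<Lambda>: "1 \<le> \<Lambda>"
    and u_measurable [measurable]: "u \<in> borel_measurable borel"
    and K_measurable [measurable]: "(\<lambda>(x, y). K x y) \<in> borel_measurable (borel \<Otimes>\<^sub>M borel)"
    and K_nonneg: "\<And>x y. 0 \<le> K x y"
    and K_le: "AE z in lborel \<Otimes>\<^sub>M lborel. K (fst z) (snd z) \<le> \<Lambda> * kern (s * p) (fst z - snd z)"
    and K_ge: "AE z in lborel \<Otimes>\<^sub>M lborel. kern (s * p) (fst z - snd z) \<le> \<Lambda> * K (fst z) (snd z)"
    and u_powr_finite: "\<And>x0 R. cball x0 R \<subseteq> \<Omega> \<Longrightarrow>
      (\<integral>\<^sup>+x. ennreal (indicator (ball x0 R) x * \<bar>u x\<bar> powr p) \<partial>lborel) < \<infinity>"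
    and u_energy_finite: "\<And>x0 R. cball x0 R \<subseteq> \<Omega> \<Longrightarrow>
      (\<integral>\<^sup>+z. ennreal (indicator (ball x0 R) (fst z) * indicator (ball x0 R) (snd z) *
        \<bar>u (fst z) - u (snd z)\<bar> powr p * kern (s * p) (fst z - snd z)) \<partial>(lborel \<Otimes>\<^sub>M lborel)) < \<infinity>"
    and u_tail_finite: "(\<integral>\<^sup>+x. ennreal (max (- u x) 0 powr (p - 1) * weight (s * p) x) \<partial>lborel) < \<infinity>"
    and u_test: "\<And>\<eta>. \<eta> \<in> test_functions \<Omega> \<Longrightarrow> (\<And>x. 0 \<le> \<eta> x) \<Longrightarrow>
      (\<integral>\<^sup>+z. ennreal (- energy_integrand p K u \<eta> z) \<partial>(lborel \<Otimes>\<^sub>M lborel)) < \<infinity> \<and>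
      (\<integral>\<^sup>+z. ennreal (- energy_integrand p K u \<eta> z) \<partial>(lborel \<Otimes>\<^sub>M lborel))
        \<le> (\<integral>\<^sup>+z. ennreal (energy_integrand p K u \<eta> z) \<partial>(lborel \<Otimes>\<^sub>M lborel))"
begin

lemma sp_pos: "0 < s * p" using s p by simp

lemma energy_integrand_measurable [measurable]:
  assumes [measurable]: "g \<in> borel_measurable borel"
  shows "energy_integrand p K u g \<in> borel_measurable (borel \<Otimes>\<^sub>M borel)"
  unfolding energy_integrand_def by measurable

text \<open>
  The energy integrand of a test function \<open>g\<close> supported well inside the ball \<open>D\<close> is bounded by
  \<open>majorant c D g\<close>. Only \<open>u\<^sub>-\<close> enters outside \<open>D\<close>, as large values of \<open>u\<close> there make the integrand
  negative; and \<open>g\<close> enters only through quantities that do not grow under mollification.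
\<close>

definition far_majorant :: "real \<Rightarrow> 'a set \<Rightarrow> ('a \<Rightarrow> real) \<Rightarrow> 'a \<Rightarrow> 'a \<Rightarrow> real" where
  "far_majorant c D g x y = (indicator D x * \<bar>u x\<bar> powr p + g x powr p) * (c * weight (s * p) y)
     + g x * (c * (max (- u y) 0 powr (p - 1) * weight (s * p) y))"

definition majorant :: "real \<Rightarrow> 'a set \<Rightarrow> ('a \<Rightarrow> real) \<Rightarrow> 'a \<times> 'a \<Rightarrow> real" where
  "majorant c D g z = \<Lambda> * (indicator D (fst z) * indicator D (snd z) * \<bar>u (fst z) - u (snd z)\<bar> powr p
       * kern (s * p) (fst z - snd z))
     + \<Lambda> * (\<bar>g (fst z) - g (snd z)\<bar> powr p * kern (s * p) (fst z - snd z))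
     + far_majorant c D g (fst z) (snd z) + far_majorant c D g (snd z) (fst z)"

lemma far_majorant_nonneg: "0 \<le> c \<Longrightarrow> (\<And>x. 0 \<le> g x) \<Longrightarrow> 0 \<le> far_majorant c D g x y"
  unfolding far_majorant_def by simp

lemma majorant_nonneg: "0 \<le> c \<Longrightarrow> (\<And>x. 0 \<le> g x) \<Longrightarrow> 0 \<le> majorant c D g z"
  unfolding majorant_def using \<Lambda> by (intro add_nonneg_nonneg far_majorant_nonneg mult_nonneg_nonneg) auto

lemma majorant_measurable:
  assumes [measurable]: "g \<in> borel_measurable borel" "D \<in> sets borel"
  shows "majorant c D g \<in> borel_measurable (borel \<Otimes>\<^sub>M borel)"
  unfolding majorant_def[abs_def] far_majorant_def by measurable

text \<open>The constant depends on the two radii but not on g, so one choice serves all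
  mollifications. Near pairs are handled by Young's inequality; for a far pair the gap R2 - R bounds
  the kernel by the weight.\<close>

lemma energy_integrand_le_majorant:
  assumes "R < R2"
  obtains c where "0 \<le> c"
    and "\<And>g. (\<And>x. 0 \<le> g x) \<Longrightarrow> (\<And>x. R \<le> dist x0 x \<Longrightarrow> g x = 0) \<Longrightarrow>
      AE z in lborel \<Otimes>\<^sub>M lborel. energy_integrand p K u g z \<le> majorant c (ball x0 R2) g z"
proof -
  define C where "C = ((1 + (norm x0 + R)) / (R2 - R) + 1) powr (real DIM('a) + s * p)"
  define c where "c = 2 powr (p - 1) * (\<Lambda> * C)"
  have C0: "0 \<le> C" by (simp add: C_def)
  have c0: "0 \<le> c" using \<Lambda> C0 by (simp add: c_def)
  have far: "kern (s * p) (x - y) \<le> C * weight (s * p) y" if "dist x0 x < R" "R2 \<le> dist x0 y" for x y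
    unfolding C_def
  proof (rule kern_le_weight)
    show "R2 - R \<le> norm (x - y)" using that dist_triangle[of x0 y x] by (simp add: dist_norm)
    show "norm x \<le> norm x0 + R" using that norm_triangle_sub[of x x0] by (simp add: dist_norm norm_minus_commute)
  qed (use assms sp_pos in auto)
  have flux: "\<bar>u x - u y\<bar> powr (p - 2) * (u x - u y) * g x * k \<le> far_majorant c (ball x0 R2) g x y"
    if "dist x0 x < R" "R2 \<le> dist x0 y" "0 \<le> g x" "0 \<le> k" "k \<le> \<Lambda> * kern (s * p) (x - y)" for x y g k
  proof -
    let ?B = "(\<bar>u x\<bar> powr p + g x powr p) + max (- u y) 0 powr (p - 1) * g x"
    have "\<bar>u x - u y\<bar> powr (p - 2) * (u x - u y) * g x * k \<le> 2 powr (p - 1) * ?B * k"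
      using that p by (intro mult_right_mono powr_flux_le) auto
    also have "\<dots> \<le> 2 powr (p - 1) * ?B * (\<Lambda> * (C * weight (s * p) y))"
    proof (rule mult_left_mono)
      have "k \<le> \<Lambda> * kern (s * p) (x - y)" by fact
      also have "\<dots> \<le> \<Lambda> * (C * weight (s * p) y)" using far[OF that(1,2)] \<Lambda> by (intro mult_left_mono) auto
      finally show "k \<le> \<Lambda> * (C * weight (s * p) y)" .
    qed (use that in simp)
    also have "\<dots> = far_majorant c (ball x0 R2) g x y"
      using that(1) assms by (simp add: far_majorant_def c_def algebra_simps)
    finally show ?thesis .
  qed
  show ?thesis
  proof (rule that[OF c0])
    fix g :: "'a \<Rightarrow> real" assume g0: "\<And>x. 0 \<le> g x" and g: "\<And>x. R \<le> dist x0 x \<Longrightarrow> g x = 0"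
    show "AE z in lborel \<Otimes>\<^sub>M lborel. energy_integrand p K u g z \<le> majorant c (ball x0 R2) g z"
      using K_le
    proof eventually_elim
      case (elim z)
      obtain x y where z: "z = (x, y)" by (cases z)
      have Kk: "0 \<le> K x y" "K x y \<le> \<Lambda> * kern (s * p) (x - y)" using elim K_nonneg by (auto simp: z)
      let ?D = "ball x0 R2"
      let ?near = "\<Lambda> * (indicator ?D x * indicator ?D y * \<bar>u x - u y\<bar> powr p * kern (s * p) (x - y))"
      let ?g = "\<Lambda> * (\<bar>g x - g y\<bar> powr p * kern (s * p) (x - y))"
      have nn: "0 \<le> ?near" "0 \<le> ?g" "0 \<le> far_majorant c ?D g x y" "0 \<le> far_majorant c ?D g y x"
        using \<Lambda> c0 g0 by (auto intro!: far_majorant_nonneg mult_nonneg_nonneg)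
      have M: "majorant c ?D g z = ?near + ?g + far_majorant c ?D g x y + far_majorant c ?D g y x"
        by (simp add: majorant_def z)
      have E: "energy_integrand p K u g z = \<bar>u x - u y\<bar> powr (p - 2) * (u x - u y) * (g x - g y) * K x y"
        by (simp add: energy_integrand_def z)
      \<comment> \<open>The cases are exhaustive because a point of the annulus forms a near pair
        with any point of the inner ball and gives zero together with any other point.\<close>
      consider "R \<le> dist x0 x" "R \<le> dist x0 y" | "dist x0 x < R2" "dist x0 y < R2"
        | "dist x0 x < R" "R2 \<le> dist x0 y" | "dist x0 y < R" "R2 \<le> dist x0 x"
        using assms by linarith
      then show ?case
      proof cases
        case 1
        then have "energy_integrand p K u g z = 0" by (simp add: E g)
        then show ?thesis using nn M by simp
      next
        case 2
        have "energy_integrand p K u g z \<le> (\<bar>u x - u y\<bar> powr p + \<bar>g x - g y\<bar> powr p) * K x y"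
          unfolding E using Kk p by (intro mult_right_mono powr_flux_le') auto
        also have "\<dots> \<le> (\<bar>u x - u y\<bar> powr p + \<bar>g x - g y\<bar> powr p) * (\<Lambda> * kern (s * p) (x - y))"
          using Kk by (intro mult_left_mono) auto
        also have "\<dots> = ?near + ?g" using 2 by (simp add: algebra_simps)
        finally show ?thesis using nn M by linarith
      next
        case 3
        then have "g y = 0" using assms by (intro g) simp
        then have "energy_integrand p K u g z \<le> far_majorant c ?D g x y"
          using flux[of x y g "K x y"] 3 g0 Kk by (simp add: E)
        then show ?thesis using nn M by linarith
      next
        case 4
        then have "g x = 0" using assms by (intro g) simp
        then have "energy_integrand p K u g z = \<bar>u y - u x\<bar> powr (p - 2) * (u y - u x) * g y * K x y"
          by (simp add: E abs_minus_commute algebra_simps)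
        also have "\<dots> \<le> far_majorant c ?D g y x"
          using flux[of y x g "K x y"] 4 g0 Kk by (simp add: kern_minus[of _ y x])
        finally show ?thesis using nn M by linarith
      qed
    qed
  qed
qed

definition near_energy :: "'a set \<Rightarrow> ennreal" where
  "near_energy D = (\<integral>\<^sup>+z. ennreal (indicator D (fst z) * indicator D (snd z) *
        \<bar>u (fst z) - u (snd z)\<bar> powr p * kern (s * p) (fst z - snd z)) \<partial>(lborel \<Otimes>\<^sub>M lborel))"

text \<open>An identity rather than a bound, so that g enters only through three integrals, its
  energy, that of its p-th power and its own, none of which mollification increases.\<close>

lemma nn_integral_majorant:
  assumes [measurable]: "g \<in> borel_measurable borel" "D \<in> sets borel" and c: "0 \<le> c" and g0: "\<And>x. 0 \<le> g x"
  shows "(\<integral>\<^sup>+z. ennreal (majorant c D g z) \<partial>(lborel \<Otimes>\<^sub>M lborel)) =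
     ennreal \<Lambda> * near_energy D
     + ennreal \<Lambda> * (\<integral>\<^sup>+x. (\<integral>\<^sup>+y. ennreal (\<bar>g x - g y\<bar> powr p) * ennreal (kern (s * p) (x - y)) \<partial>lborel) \<partial>lborel)
     + 2 * (((\<integral>\<^sup>+x. ennreal (indicator D x * \<bar>u x\<bar> powr p) \<partial>lborel) + (\<integral>\<^sup>+x. ennreal (g x powr p) \<partial>lborel))
          * (ennreal c * (\<integral>\<^sup>+y. ennreal (weight (s * p) (y::'a)) \<partial>lborel))
        + (\<integral>\<^sup>+x. ennreal (g x) \<partial>lborel)
          * (ennreal c * (\<integral>\<^sup>+y. ennreal (max (- u y) 0 powr (p - 1) * weight (s * p) y) \<partial>lborel)))"
    (is "?L = ?near + ?g + 2 * ?F")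
proof -
  let ?M = "lborel \<Otimes>\<^sub>M lborel :: ('a \<times> 'a) measure"
  let ?f1 = "\<lambda>x. indicator D x * \<bar>u x\<bar> powr p + g x powr p"
  let ?h1 = "\<lambda>y::'a. c * weight (s * p) y"
  let ?h2 = "\<lambda>y. c * (max (- u y) 0 powr (p - 1) * weight (s * p) y)"
  have \<Lambda>0: "0 \<le> \<Lambda>" using \<Lambda> by simp
  have int: "(\<integral>\<^sup>+x. ennreal (?f1 x) \<partial>lborel) = (\<integral>\<^sup>+x. ennreal (indicator D x * \<bar>u x\<bar> powr p) \<partial>lborel) + (\<integral>\<^sup>+x. ennreal (g x powr p) \<partial>lborel)"
    "(\<integral>\<^sup>+y. ennreal (?h1 y) \<partial>lborel) = ennreal c * (\<integral>\<^sup>+y. ennreal (weight (s * p) (y::'a)) \<partial>lborel)"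
    "(\<integral>\<^sup>+y. ennreal (?h2 y) \<partial>lborel) = ennreal c * (\<integral>\<^sup>+y. ennreal (max (- u y) 0 powr (p - 1) * weight (s * p) y) \<partial>lborel)"
    using c by (simp_all add: nn_integral_add nn_integral_cmult ennreal_mult)
  have far1: "(\<integral>\<^sup>+z. ennreal (far_majorant c D g (fst z) (snd z)) \<partial>?M) = ?F"
  proof -
    have "(\<integral>\<^sup>+z. ennreal (far_majorant c D g (fst z) (snd z)) \<partial>?M) =
        (\<integral>\<^sup>+z. ennreal (?f1 (fst z) * ?h1 (snd z)) + ennreal (g (fst z) * ?h2 (snd z)) \<partial>?M)"
      unfolding far_majorant_def using c g0 by (intro nn_integral_cong ennreal_plus) auto
    also have "\<dots> = (\<integral>\<^sup>+z. ennreal (?f1 (fst z) * ?h1 (snd z)) \<partial>?M) + (\<integral>\<^sup>+z. ennreal (g (fst z) * ?h2 (snd z)) \<partial>?M)"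
      by (rule nn_integral_add) measurable
    also have "\<dots> = ?F"
      using c g0 by (subst (1 2) nn_integral_pair_mult(1)) (auto simp: int simp del: ennreal_plus)
    finally show ?thesis .
  qed
  have far2: "(\<integral>\<^sup>+z. ennreal (far_majorant c D g (snd z) (fst z)) \<partial>?M) = ?F"
  proof -
    have "(\<integral>\<^sup>+z. ennreal (far_majorant c D g (snd z) (fst z)) \<partial>?M) =
        (\<integral>\<^sup>+z. ennreal (?f1 (snd z) * ?h1 (fst z)) + ennreal (g (snd z) * ?h2 (fst z)) \<partial>?M)"
      unfolding far_majorant_def using c g0 by (intro nn_integral_cong ennreal_plus) auto
    also have "\<dots> = (\<integral>\<^sup>+z. ennreal (?f1 (snd z) * ?h1 (fst z)) \<partial>?M) + (\<integral>\<^sup>+z. ennreal (g (snd z) * ?h2 (fst z)) \<partial>?M)"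
      by (rule nn_integral_add) measurable
    also have "\<dots> = ?F"
      using c g0 by (subst (1 2) nn_integral_pair_mult(2)) (auto simp: int simp del: ennreal_plus)
    finally show ?thesis .
  qed
  have [measurable]: "(\<lambda>z. far_majorant c D g (fst z) (snd z)) \<in> borel_measurable ?M"
    "(\<lambda>z. far_majorant c D g (snd z) (fst z)) \<in> borel_measurable ?M"
    unfolding far_majorant_def by measurable
  let ?N = "\<lambda>z. indicator D (fst z) * indicator D (snd z) * \<bar>u (fst z) - u (snd z)\<bar> powr p * kern (s * p) (fst z - snd z)"
  let ?G = "\<lambda>z. \<bar>g (fst z) - g (snd z)\<bar> powr p * kern (s * p) (fst z - snd z)"
  have "?L = (\<integral>\<^sup>+z. ennreal \<Lambda> * ennreal (?N z) + ennreal \<Lambda> * ennreal (?G z)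
      + ennreal (far_majorant c D g (fst z) (snd z)) + ennreal (far_majorant c D g (snd z) (fst z)) \<partial>?M)"
    unfolding majorant_def using \<Lambda>0 far_majorant_nonneg[OF c g0]
    by (intro nn_integral_cong) (simp add: ennreal_plus[symmetric] ennreal_mult[symmetric] del: ennreal_plus)
  also have "\<dots> = ennreal \<Lambda> * near_energy D + ennreal \<Lambda> * (\<integral>\<^sup>+z. ennreal (?G z) \<partial>?M) + ?F + ?F"
    unfolding near_energy_def far1[symmetric] by (subst far1, subst far2[symmetric]) (simp add: nn_integral_add nn_integral_cmult)
  also have "(\<integral>\<^sup>+z. ennreal (?G z) \<partial>?M) = (\<integral>\<^sup>+x. (\<integral>\<^sup>+y. ennreal (\<bar>g x - g y\<bar> powr p) * ennreal (kern (s * p) (x - y)) \<partial>lborel) \<partial>lborel)"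
    by (subst lborel.nn_integral_fst[symmetric]) (auto simp: ennreal_mult)
  finally show ?thesis by (simp add: mult_2 add.assoc)
qed


lemma weak_inequality:
  fixes \<eta> :: "'a \<Rightarrow> real"
  assumes \<eta>m [measurable]: "\<eta> \<in> borel_measurable borel" and \<eta>0: "\<And>x. 0 \<le> \<eta> x"
    and supp: "\<And>x. R1 \<le> dist x0 x \<Longrightarrow> \<eta> x = 0" and R: "R1 < R2" and \<Omega>: "cball x0 R2 \<subseteq> \<Omega>"
    and \<eta>p: "(\<integral>\<^sup>+x. ennreal (\<eta> x powr p) \<partial>lborel) < \<infinity>"
    and E: "(\<integral>\<^sup>+x. (\<integral>\<^sup>+y. ennreal (\<bar>\<eta> x - \<eta> y\<bar> powr p) * ennreal (kern (s * p) (x - y)) \<partial>lborel) \<partial>lborel) < \<infinity>"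
      (is "?E < \<infinity>")
  shows "integrable (lborel \<Otimes>\<^sub>M lborel) (energy_integrand p K u \<eta>)"
    and "0 \<le> (\<integral>z. energy_integrand p K u \<eta> z \<partial>(lborel \<Otimes>\<^sub>M lborel))"
proof -
  \<comment> \<open>The midpoint leaves room twice: from R1 to R for the supports of the
    mollifications, from R to R2 for the kernel bound in the majorant.\<close>
  define R where "R = (R1 + R2) / 2"
  have R12: "R1 < R" "R < R2" using R by (auto simp: R_def)
  let ?D = "ball x0 R2"
  have Dm [measurable]: "?D \<in> sets borel" by simp
  obtain M where M: "0 < M"
    and moll: "\<And>e. 0 < e \<Longrightarrow> \<exists>\<rho>::'a \<Rightarrow> real. (\<forall>k. C_diff k \<rho>) \<and> (\<forall>x. 0 \<le> \<rho> x) \<and>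
      (\<forall>x. e \<le> norm x \<longrightarrow> \<rho> x = 0) \<and> (\<forall>x. \<rho> x \<le> M * e powr - real DIM('a)) \<and>
      (\<integral>\<^sup>+x. ennreal (\<rho> x) \<partial>lborel) = 1"
    using mollifier_exists[where 'a = 'a] by metis
  \<comment> \<open>At most R - R1 to keep the supports within radius R, and geometric so that the
    errors, of order e_j^(s p), are summable.\<close>
  define e where "e j = (R - R1) / 2 ^ j" for j :: nat
  have e: "0 < e j" "e j \<le> R - R1" for j
    using R12 divide_left_mono[of 1 "2 ^ j" "R - R1"] by (auto simp: e_def)
  obtain \<rho> where \<rho>: "\<And>j k. C_diff k (\<rho> j)" "\<And>j x. 0 \<le> \<rho> j x"
      "\<And>j x. e j \<le> norm x \<Longrightarrow> \<rho> j x = (0::real)" "\<And>j x::'a. \<rho> j x \<le> M * e j powr - real DIM('a)"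
      "\<And>j. (\<integral>\<^sup>+x. ennreal (\<rho> j x) \<partial>lborel) = 1"
    using moll[OF e(1)] by metis
  have \<rho>m [measurable]: "\<rho> j \<in> borel_measurable borel" for j
    using C_diff_imp_continuous[OF \<rho>(1)] by (intro borel_measurable_continuous_onI)
  have \<eta>i: "integrable lborel \<eta>"
  proof (rule integrableI_nonneg)
    have le: "ennreal (\<eta> x) \<le> indicator (cball x0 R1) x + ennreal (\<eta> x powr p)" for x
    proof (cases "\<eta> x \<le> 1")
      case True
      then show ?thesis
        using supp[of x] by (cases "dist x0 x \<le> R1") (auto simp: ennreal_le_1 add_increasing2)
    next
      case False
      then have "\<eta> x powr 1 \<le> \<eta> x powr p" using p by (intro powr_mono) auto
      then have "ennreal (\<eta> x) \<le> ennreal (\<eta> x powr p)" using False by (intro ennreal_leI) auto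
      then show ?thesis by (simp add: add_increasing)
    qed
    have [measurable]: "cball x0 R1 \<in> sets borel" by simp
    have "(\<integral>\<^sup>+x. ennreal (\<eta> x) \<partial>lborel) \<le> (\<integral>\<^sup>+x. indicator (cball x0 R1) x + ennreal (\<eta> x powr p) \<partial>lborel)"
      by (intro nn_integral_mono le)
    also have "\<dots> = emeasure lborel (cball x0 R1) + (\<integral>\<^sup>+x. ennreal (\<eta> x powr p) \<partial>lborel)"
      by (subst nn_integral_add) auto
    also have "\<dots> < \<infinity>" using \<eta>p emeasure_bounded_finite[of "cball x0 R1"] by auto
    finally show "(\<integral>\<^sup>+x. ennreal (\<eta> x) \<partial>lborel) < \<infinity>" .
  qed (use \<eta>0 in auto)
  define \<phi> where "\<phi> j = convolve (\<rho> j) \<eta>" for j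
  note conv = \<rho>m \<rho>(4) \<rho>(2) \<rho>(5) \<eta>i
  have p1: "1 \<le> p" using p by simp
  have \<phi>m [measurable]: "\<phi> j \<in> borel_measurable borel" for j
    unfolding \<phi>_def by (rule convolve_measurable[OF conv p1])
  have \<phi>0: "0 \<le> \<phi> j x" for j x
    unfolding \<phi>_def by (rule convolve_nonneg[OF conv p1 \<eta>0])
  have \<phi>supp: "\<phi> j x = 0" if "R \<le> dist x0 x" for j x
    unfolding \<phi>_def
    by (rule convolve_support[OF conv p1 \<rho>(3) supp]) (use that e(2)[of j] in auto)
  have \<phi>test: "\<phi> j \<in> test_functions \<Omega>" for j
  proof -
    have "closure {x. \<phi> j x \<noteq> 0} \<subseteq> cball x0 R"
      using \<phi>supp[of _ j] by (intro closure_minimal) (force, simp)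
    moreover have "cball x0 R \<subseteq> \<Omega>" using \<Omega> R12 by (auto intro: order_trans)
    moreover have "compact (closure {x. \<phi> j x \<noteq> 0})"
      using calculation(1) by (meson bounded_cball bounded_subset closed_closure compact_eq_bounded_closed)
    ultimately show ?thesis
      using C_diff_convolve[OF \<eta>i \<rho>(1) \<rho>(3)] by (auto simp: test_functions_def \<phi>_def)
  qed
  have near: "AE x in lborel. (\<lambda>j. \<phi> j x) \<longlonglongrightarrow> \<eta> x"
  proof -
    let ?c = "\<lambda>j. M * enn2real ?E * e j powr (s * p)"
    have "AE x in lborel. (\<lambda>j. \<phi> j x - \<eta> x) \<longlonglongrightarrow> 0"
    proof (rule AE_tendsto_of_summable[where p = p and c = ?c])
      fix j
      \<comment> \<open>On the support of \<open>\<rho> j\<close> one has |x - y| < e_j, so e_j^(-n)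
        is at most e_j^(s p) |x - y|^(-n - s p). On the diagonal both sides vanish.\<close>
      have le: "ennreal (\<rho> j (x - y) * \<bar>\<eta> x - \<eta> y\<bar> powr p)
         \<le> ennreal (M * e j powr (s * p)) * (ennreal (\<bar>\<eta> x - \<eta> y\<bar> powr p) * ennreal (kern (s * p) (x - y)))" for x y
      proof (cases "x = y \<or> e j \<le> norm (x - y)")
        case True
        then show ?thesis using \<rho>(3)[of j "x - y"] p by auto
      next
        case False
        have "e j powr - real DIM('a) = e j powr (s * p) * e j powr (- real DIM('a) - s * p)"
          by (simp add: powr_add[symmetric])
        also have "\<dots> \<le> e j powr (s * p) * kern (s * p) (x - y)"
          unfolding kern_def using False sp_pos by (intro mult_left_mono powr_mono2') auto
        finally have "M * e j powr - real DIM('a) \<le> M * (e j powr (s * p) * kern (s * p) (x - y))"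
          using M by (intro mult_left_mono) auto
        then have "\<rho> j (x - y) \<le> M * e j powr (s * p) * kern (s * p) (x - y)"
          using \<rho>(4)[of j "x - y"] by (simp add: mult.assoc)
        then have "\<rho> j (x - y) * \<bar>\<eta> x - \<eta> y\<bar> powr p \<le> M * e j powr (s * p) * kern (s * p) (x - y) * \<bar>\<eta> x - \<eta> y\<bar> powr p"
          by (rule mult_right_mono) simp
        then show ?thesis
          using M by (simp add: ennreal_mult[symmetric] mult_ac ennreal_leI)
      qed
      have "(\<integral>\<^sup>+x. ennreal (\<bar>\<phi> j x - \<eta> x\<bar> powr p) \<partial>lborel)
         \<le> (\<integral>\<^sup>+x. (\<integral>\<^sup>+y. ennreal (\<rho> j (x - y) * \<bar>\<eta> x - \<eta> y\<bar> powr p) \<partial>lborel) \<partial>lborel)"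
        unfolding \<phi>_def by (rule convolve_diff_powr_le[OF conv p1])
      also have "\<dots> \<le> (\<integral>\<^sup>+x. (\<integral>\<^sup>+y. ennreal (M * e j powr (s * p)) *
          (ennreal (\<bar>\<eta> x - \<eta> y\<bar> powr p) * ennreal (kern (s * p) (x - y))) \<partial>lborel) \<partial>lborel)"
        by (intro nn_integral_mono le)
      also have "\<dots> = ennreal (M * e j powr (s * p)) * ?E"
        by (simp add: nn_integral_cmult)
      also have "?E = ennreal (enn2real ?E)" using E by simp
      finally show "(\<integral>\<^sup>+x. ennreal (\<bar>\<phi> j x - \<eta> x\<bar> powr p) \<partial>lborel) \<le> ennreal (?c j)"
        using M by (simp add: ennreal_mult mult_ac)
    next
      have "(\<lambda>j. M * enn2real ?E * e j powr (s * p)) =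
          (\<lambda>j. M * enn2real ?E * (R - R1) powr (s * p) * (2 powr - (s * p)) ^ j)"
      proof
        fix j
        have "(2 ^ j) powr (s * p) = (2 powr (s * p) :: real) ^ j" by (induction j) (auto simp: powr_mult)
        moreover have "e j powr (s * p) = (R - R1) powr (s * p) / (2 ^ j) powr (s * p)"
          unfolding e_def by (rule powr_divide)
        ultimately have "e j powr (s * p) = (R - R1) powr (s * p) * (2 powr - (s * p)) ^ j"
          by (simp add: powr_minus power_inverse divide_inverse)
        then show "?c j = M * enn2real ?E * (R - R1) powr (s * p) * (2 powr - (s * p)) ^ j"
          by simp
      qed
      moreover have "2 powr - (s * p) < (1::real)" using sp_pos by (simp add: powr_less_one)
      ultimately show "summable ?c" by (auto intro!: summable_mult summable_geometric)
    qed (use p M in auto)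
    then show ?thesis by eventually_elim (simp add: LIM_zero_iff)
  qed
  have near2: "AE z in lborel \<Otimes>\<^sub>M lborel. (\<lambda>j. \<phi> j (fst z)) \<longlonglongrightarrow> \<eta> (fst z) \<and> (\<lambda>j. \<phi> j (snd z)) \<longlonglongrightarrow> \<eta> (snd z)"
    by (rule AE_pair_lborel[OF near])
  obtain c where c: "0 \<le> c" and maj: "\<And>g. (\<And>x. 0 \<le> g x) \<Longrightarrow> (\<And>x. R \<le> dist x0 x \<Longrightarrow> g x = 0) \<Longrightarrow>
      AE z in lborel \<Otimes>\<^sub>M lborel. energy_integrand p K u g z \<le> majorant c ?D g z"
    using energy_integrand_le_majorant[OF R12(2)] by metis
  let ?F = "energy_integrand p K u" and ?U = "majorant c ?D"
  have limU: "AE z in lborel \<Otimes>\<^sub>M lborel. (\<lambda>j. ?U (\<phi> j) z) \<longlonglongrightarrow> ?U \<eta> z"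
    using near2
  proof eventually_elim
    case (elim z)
    have pw: "(\<lambda>j. \<phi> j x powr p) \<longlonglongrightarrow> \<eta> x powr p" if "(\<lambda>j. \<phi> j x) \<longlonglongrightarrow> \<eta> x" for x
      using that p \<phi>0 by (intro tendsto_powr') auto
    have dpw: "(\<lambda>j. \<bar>\<phi> j (fst z) - \<phi> j (snd z)\<bar> powr p) \<longlonglongrightarrow> \<bar>\<eta> (fst z) - \<eta> (snd z)\<bar> powr p"
      using elim p by (intro tendsto_powr' tendsto_rabs tendsto_diff tendsto_const) auto
    show ?case
      unfolding majorant_def far_majorant_def
      by (intro tendsto_add tendsto_mult tendsto_const dpw pw elim[THEN conjunct1] elim[THEN conjunct2])
  qed
  have limF: "AE z in lborel \<Otimes>\<^sub>M lborel. (\<lambda>j. ?F (\<phi> j) z) \<longlonglongrightarrow> ?F \<eta> z"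
    using near2 unfolding energy_integrand_def case_prod_beta
    by eventually_elim (intro tendsto_mult tendsto_diff tendsto_const; simp)
  have UU: "(\<integral>\<^sup>+z. ennreal (?U (\<phi> j) z) \<partial>(lborel \<Otimes>\<^sub>M lborel)) \<le> (\<integral>\<^sup>+z. ennreal (?U \<eta> z) \<partial>(lborel \<Otimes>\<^sub>M lborel))" for j
  proof -
    have 1: "(\<integral>\<^sup>+x. ennreal (\<phi> j x powr p) \<partial>lborel) \<le> (\<integral>\<^sup>+x. ennreal (\<eta> x powr p) \<partial>lborel)"
      using convolve_powr_le[OF conv p1, of j] \<eta>0 \<phi>0 by (simp add: \<phi>_def)
    have 2: "(\<integral>\<^sup>+x. ennreal (\<phi> j x) \<partial>lborel) \<le> (\<integral>\<^sup>+x. ennreal (\<eta> x) \<partial>lborel)"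
      using convolve_powr_le[OF conv order_refl, of j] \<eta>0 \<phi>0 by (simp add: \<phi>_def)
    have 3: "(\<integral>\<^sup>+x. (\<integral>\<^sup>+y. ennreal (\<bar>\<phi> j x - \<phi> j y\<bar> powr p) * ennreal (kern (s * p) (x - y)) \<partial>lborel) \<partial>lborel) \<le> ?E"
      unfolding \<phi>_def by (rule convolve_increment_powr_le[OF conv p1]) simp
    show ?thesis
      unfolding nn_integral_majorant[OF \<phi>m Dm c \<phi>0] nn_integral_majorant[OF \<eta>m Dm c \<eta>0]
      by (intro add_mono mult_left_mono mult_right_mono 1 2 3 order_refl) auto
  qed
  have fin: "(\<integral>\<^sup>+z. ennreal (?U \<eta> z) \<partial>(lborel \<Otimes>\<^sub>M lborel)) < \<infinity>"
  proof -
    have "(\<integral>\<^sup>+x. ennreal (\<eta> x) \<partial>lborel) < \<infinity>"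
      using \<eta>i \<eta>0 by (auto simp: integrable_iff_bounded)
    then show ?thesis
      unfolding nn_integral_majorant[OF \<eta>m Dm c \<eta>0] near_energy_def
      using u_energy_finite[OF \<Omega>] E \<eta>p u_powr_finite[OF \<Omega>] u_tail_finite nn_integral_weight_finite[OF sp_pos, where 'a = 'a]
      by (auto simp: less_top[symmetric] ennreal_mult_eq_top_iff)
  qed
  have Fm: "?F g \<in> borel_measurable (lborel \<Otimes>\<^sub>M lborel)" "?U g \<in> borel_measurable (lborel \<Otimes>\<^sub>M lborel)"
    if [measurable]: "g \<in> borel_measurable borel" for g
    using energy_integrand_measurable[OF that] majorant_measurable[OF that Dm]
    by (simp_all cong: measurable_cong_sets)
  note fatou = integral_nonneg_fatou[where Fj = "\<lambda>j. ?F (\<phi> j)" and Uj = "\<lambda>j. ?U (\<phi> j)" and U = "?U \<eta>",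
      OF Fm(1) Fm(2) Fm(1) Fm(2) limF limU maj majorant_nonneg[OF c] majorant_nonneg[OF c] fin UU]
  show "integrable (lborel \<Otimes>\<^sub>M lborel) (?F \<eta>)"
    by (rule fatou(1)) (use \<phi>0 \<phi>supp \<eta>0 u_test[OF \<phi>test \<phi>0] in auto)
  show "0 \<le> (\<integral>z. ?F \<eta> z \<partial>(lborel \<Otimes>\<^sub>M lborel))"
    by (rule fatou(2)) (use \<phi>0 \<phi>supp \<eta>0 u_test[OF \<phi>test \<phi>0] in auto)
qed

end

section \<open>The Caccioppoli estimate\<close>

text \<open>Here a, b are two values of w, and \<alpha>, \<beta> those of the cutoff. By symmetry b
  \<le> a, and only \<alpha> < \<beta> can make the left side positive. The tangent inequality then
  bounds it by X^(p - 1) (p a (\<beta> - \<alpha>) - X) with X = (a - b) \<beta>, which is positive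
  only if X < p a (\<beta> - \<alpha>); this yields p^p. The customary energy of the truncation is
  dropped, as the gain comes from the superlevel set.\<close>

lemma powr_caccioppoli:
  fixes a b \<alpha> \<beta> :: real
  assumes "0 \<le> a" "0 \<le> b" "0 \<le> \<alpha>" "0 \<le> \<beta>" "1 < p"
  shows "\<bar>b - a\<bar> powr (p - 2) * (b - a) * (a * \<alpha> powr p - b * \<beta> powr p)
    \<le> p powr p * ((a powr p + b powr p) * \<bar>\<alpha> - \<beta>\<bar> powr p)"
proof -
  have main: "\<bar>b - a\<bar> powr (p - 2) * (b - a) * (a * \<alpha> powr p - b * \<beta> powr p)
    \<le> p powr p * ((a powr p + b powr p) * \<bar>\<alpha> - \<beta>\<bar> powr p)"
    if ba: "b \<le> a" and nn: "0 \<le> a" "0 \<le> b" "0 \<le> \<alpha>" "0 \<le> \<beta>" for a b \<alpha> \<beta> :: real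
  proof -
    let ?d = "a - b" and ?R = "p powr p * ((a powr p + b powr p) * \<bar>\<alpha> - \<beta>\<bar> powr p)"
    have R0: "0 \<le> ?R" by simp
    have L: "\<bar>b - a\<bar> powr (p - 2) * (b - a) * (a * \<alpha> powr p - b * \<beta> powr p)
        = ?d powr (p - 1) * (b * \<beta> powr p - a * \<alpha> powr p)"
      using ba abs_powr_pred[of ?d p] by (simp add: abs_minus_commute algebra_simps)
    show ?thesis
    proof (cases "\<beta> \<le> \<alpha>")
      case True
      then have "b * \<beta> powr p \<le> a * \<alpha> powr p"
        using ba nn assms by (intro mult_mono powr_mono2) auto
      then have "?d powr (p - 1) * (b * \<beta> powr p - a * \<alpha> powr p) \<le> 0"
        by (intro mult_nonneg_nonpos) auto
      then show ?thesis using L R0 by linarith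
    next
      case False
      let ?\<Delta> = "\<beta> - \<alpha>" and ?X = "?d * \<beta>"
      have \<Delta>: "0 \<le> ?\<Delta>" "0 \<le> ?X" using False ba nn by auto
      have "\<beta> powr p - \<alpha> powr p \<le> p * \<beta> powr (p - 1) * ?\<Delta>"
        using powr_tangent[of \<beta> \<alpha> p] nn assms by (simp add: algebra_simps)
      then have "a * (\<beta> powr p - \<alpha> powr p) \<le> a * (p * \<beta> powr (p - 1) * ?\<Delta>)"
        using nn by (intro mult_left_mono)
      then have "b * \<beta> powr p - a * \<alpha> powr p \<le> a * (p * \<beta> powr (p - 1) * ?\<Delta>) - ?d * \<beta> powr p"
        by (simp add: algebra_simps)
      then have "?d powr (p - 1) * (b * \<beta> powr p - a * \<alpha> powr p)
          \<le> ?d powr (p - 1) * (a * (p * \<beta> powr (p - 1) * ?\<Delta>) - ?d * \<beta> powr p)"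
        by (intro mult_left_mono) auto
      also have "\<dots> = ?X powr (p - 1) * (p * a * ?\<Delta> - ?X)"
      proof -
        have "?X powr (p - 1) = ?d powr (p - 1) * \<beta> powr (p - 1)"
          using ba nn by (intro powr_mult)
        moreover have "\<beta> powr p = \<beta> * \<beta> powr (p - 1)"
          using nn by (simp add: powr_mult_base)
        ultimately show ?thesis by (simp add: algebra_simps)
      qed
      also have "\<dots> \<le> ?R"
      proof (cases "?X \<le> p * a * ?\<Delta>")
        case True
        have "?X powr (p - 1) * (p * a * ?\<Delta> - ?X) \<le> (p * a * ?\<Delta>) powr (p - 1) * (p * a * ?\<Delta>)"
        proof (rule mult_mono)
          show "?X powr (p - 1) \<le> (p * a * ?\<Delta>) powr (p - 1)"
            using True \<Delta> assms by (intro powr_mono2) auto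
        qed (use True \<Delta> assms nn in auto)
        also have "\<dots> = (p * a * ?\<Delta>) powr p"
          using \<Delta> nn assms powr_mult_base[of "p * a * ?\<Delta>" "p - 1"] by (simp add: mult.commute)
        also have "\<dots> = p powr p * (a powr p * \<bar>\<alpha> - \<beta>\<bar> powr p)"
          using \<Delta> nn assms by (simp add: powr_mult abs_minus_commute[of \<alpha>])
        also have "\<dots> \<le> ?R" by (intro mult_left_mono mult_right_mono) auto
        finally show ?thesis .
      next
        case False
        then have "?X powr (p - 1) * (p * a * ?\<Delta> - ?X) \<le> 0" by (intro mult_nonneg_nonpos) auto
        then show ?thesis using R0 by linarith
      qed
      finally show ?thesis using L by linarith
    qed
  qed
  show ?thesis
  proof (cases "b \<le> a")
    case True
    then show ?thesis using assms by (intro main)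
  next
    case False
    then have "\<bar>a - b\<bar> powr (p - 2) * (a - b) * (b * \<beta> powr p - a * \<alpha> powr p)
      \<le> p powr p * ((b powr p + a powr p) * \<bar>\<beta> - \<alpha>\<bar> powr p)"
      using assms by (intro main) auto
    then show ?thesis by (simp add: abs_minus_commute algebra_simps)
  qed
qed

text \<open>Beyond distance 1/L the bound |f| \<le> 1 is used, within it the Lipschitz bound, where
  |x - y|^(p - s p - n) is integrable because s < 1. Both parts scale as L^(s p).\<close>

lemma nn_integral_kern_cutoff:
  fixes s p :: real
  assumes s: "0 < s" "s < 1" and p: "1 < p"
  shows "\<exists>C>0. \<forall>L>0. \<forall>(x::'a::euclidean_space) f. (\<forall>y. \<bar>f y\<bar> \<le> 1) \<longrightarrow> (\<forall>y. \<bar>f y\<bar> \<le> L * dist x y) \<longrightarrow>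
      (\<integral>\<^sup>+y. ennreal (\<bar>f y\<bar> powr p * kern (s * p) (x - y)) \<partial>lborel) \<le> ennreal (C * L powr (s * p))"
proof -
  have sp: "0 < s * p" using assms by simp
  have b: "0 < p - s * p" using assms by simp
  obtain C1 where C1: "0 < C1" "\<And>r x::'a. 0 < r \<Longrightarrow>
      (\<integral>\<^sup>+y. ennreal (kern (s * p) (x - y)) * indicator {y. r \<le> dist x y} y \<partial>lborel) \<le> ennreal (C1 * r powr - (s * p))"
    using nn_integral_kern_outside[OF sp] by blast
  obtain C2 where C2: "0 < C2" "\<And>r x::'a. 0 < r \<Longrightarrow>
      (\<integral>\<^sup>+y. ennreal (kern (- (p - s * p)) (x - y)) * indicator {y. dist x y < r} y \<partial>lborel) \<le> ennreal (C2 * r powr (p - s * p))"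
    using nn_integral_kern_inside[OF b] by blast
  show ?thesis
  proof (intro exI[of _ "C1 + C2"] conjI allI impI)
    show "0 < C1 + C2" using C1 C2 by simp
    fix L and x :: 'a and f :: "'a \<Rightarrow> real"
    assume L: "0 < L" and "\<forall>y. \<bar>f y\<bar> \<le> 1" "\<forall>y. \<bar>f y\<bar> \<le> L * dist x y"
    then have f1: "\<bar>f y\<bar> \<le> 1" and f2: "\<bar>f y\<bar> \<le> L * dist x y" for y by auto
    let ?r = "1 / L"
    have le: "ennreal (\<bar>f y\<bar> powr p * kern (s * p) (x - y)) \<le>
       ennreal (kern (s * p) (x - y)) * indicator {y. ?r \<le> dist x y} y +
       ennreal (L powr p) * (ennreal (kern (- (p - s * p)) (x - y)) * indicator {y. dist x y < ?r} y)" for y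
    proof (cases "?r \<le> dist x y")
      case True
      have "\<bar>f y\<bar> powr p * kern (s * p) (x - y) \<le> 1 * kern (s * p) (x - y)"
        using f1[of y] p by (intro mult_right_mono powr_le1) auto
      then show ?thesis using True by (simp add: ennreal_leI)
    next
      case False
      show ?thesis
      proof (cases "x = y")
        case True then show ?thesis by (simp add: kern_def)
      next
        case neq: False
        have "\<bar>f y\<bar> powr p * kern (s * p) (x - y) \<le> (L * dist x y) powr p * kern (s * p) (x - y)"
          using f2[of y] p by (intro mult_right_mono powr_mono2) auto
        also have "\<dots> = L powr p * kern (- (p - s * p)) (x - y)"
          using neq L by (simp add: powr_mult dist_norm kern_def mult.assoc powr_add[symmetric] algebra_simps)
        finally show ?thesis using False by (simp add: ennreal_mult[symmetric] ennreal_leI)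
      qed
    qed
    have "(\<integral>\<^sup>+y. ennreal (\<bar>f y\<bar> powr p * kern (s * p) (x - y)) \<partial>lborel) \<le>
      (\<integral>\<^sup>+y. ennreal (kern (s * p) (x - y)) * indicator {y. ?r \<le> dist x y} y +
       ennreal (L powr p) * (ennreal (kern (- (p - s * p)) (x - y)) * indicator {y. dist x y < ?r} y) \<partial>lborel)"
      by (intro nn_integral_mono le)
    also have "\<dots> = (\<integral>\<^sup>+y. ennreal (kern (s * p) (x - y)) * indicator {y. ?r \<le> dist x y} y \<partial>lborel) +
       ennreal (L powr p) * (\<integral>\<^sup>+y. ennreal (kern (- (p - s * p)) (x - y)) * indicator {y. dist x y < ?r} y \<partial>lborel)"
      by (subst nn_integral_add) (auto simp: nn_integral_cmult)
    also have "\<dots> \<le> ennreal (C1 * ?r powr - (s * p)) + ennreal (L powr p) * ennreal (C2 * ?r powr (p - s * p))"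
      using L by (intro add_mono mult_left_mono C1 C2) auto
    also have "\<dots> = ennreal (C1 * ?r powr - (s * p) + L powr p * (C2 * ?r powr (p - s * p)))"
      using C1 C2 by (simp add: ennreal_mult)
    also have "C1 * ?r powr - (s * p) + L powr p * (C2 * ?r powr (p - s * p)) = (C1 + C2) * L powr (s * p)"
    proof -
      have 1: "?r powr - (s * p) = L powr (s * p)" using L by (simp add: powr_minus powr_divide)
      have "?r powr (p - s * p) = L powr (- (p - s * p))" using L powr_minus_divide[of L "p - s * p"] by (simp add: powr_divide)
      then have 2: "L powr p * ?r powr (p - s * p) = L powr (s * p)" by (simp add: powr_add[symmetric])
      have "L powr p * (C2 * ?r powr (p - s * p)) = C2 * (L powr p * ?r powr (p - s * p))" by simp
      then show ?thesis unfolding 1 2 by (simp add: algebra_simps)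
    qed
    finally show "(\<integral>\<^sup>+y. ennreal (\<bar>f y\<bar> powr p * kern (s * p) (x - y)) \<partial>lborel) \<le> ennreal ((C1 + C2) * L powr (s * p))" .
  qed
qed

lemma nn_integral_le_of_integral_nonneg:
  fixes F B G :: "'b \<Rightarrow> real"
  assumes F: "integrable M F" "0 \<le> (\<integral>z. F z \<partial>M)"
    and [measurable]: "B \<in> borel_measurable M" "G \<in> borel_measurable M"
    and B0: "\<And>z. 0 \<le> B z" and le: "AE z in M. F z + G z \<le> B z" and G0: "\<And>z. 0 \<le> G z"
  shows "(\<integral>\<^sup>+z. ennreal (G z) \<partial>M) \<le> (\<integral>\<^sup>+z. ennreal (B z) \<partial>M)"
proof (cases "(\<integral>\<^sup>+z. ennreal (B z) \<partial>M) < \<infinity>")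
  case True
  then have iB: "integrable M B" using B0 by (intro integrableI_nonneg) auto
  have "(\<integral>\<^sup>+z. ennreal (G z) \<partial>M) \<le> (\<integral>\<^sup>+z. ennreal (B z - F z) \<partial>M)"
    using le by (intro nn_integral_mono_AE) (auto elim!: eventually_mono intro: ennreal_leI)
  also have "\<dots> = ennreal (\<integral>z. B z - F z \<partial>M)"
  proof (rule nn_integral_eq_integral)
    show "AE z in M. 0 \<le> B z - F z"
      using le by eventually_elim (use G0 in \<open>smt (verit)\<close>)
  qed (use iB F in simp)
  also have "\<dots> \<le> ennreal (\<integral>z. B z \<partial>M)" using F iB by (intro ennreal_leI) simp
  also have "\<dots> = (\<integral>\<^sup>+z. ennreal (B z) \<partial>M)" using iB B0 by (simp add: nn_integral_eq_integral)
  finally show ?thesis .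
qed (simp add: less_top[symmetric] top_unique)

section \<open>Cutoffs and truncations\<close>

definition cutoff :: "'a::metric_space \<Rightarrow> real \<Rightarrow> real \<Rightarrow> 'a \<Rightarrow> real" where
  "cutoff x0 r R x = min 1 (max 0 ((R - dist x0 x) / (R - r)))"

lemma cutoff_bounds: "0 \<le> cutoff x0 r R x" "cutoff x0 r R x \<le> 1"
  by (auto simp: cutoff_def)

lemma cutoff_eq_1: "r < R \<Longrightarrow> dist x0 x \<le> r \<Longrightarrow> cutoff x0 r R x = 1"
  by (auto simp: cutoff_def field_simps)

lemma cutoff_eq_0: "r < R \<Longrightarrow> R \<le> dist x0 x \<Longrightarrow> cutoff x0 r R x = 0"
  by (auto simp: cutoff_def divide_nonpos_pos)

lemma cutoff_lipschitz:
  assumes "r < R"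
  shows "\<bar>cutoff x0 r R x - cutoff x0 r R y\<bar> \<le> 1 / (R - r) * dist x y"
proof -
  have "\<bar>cutoff x0 r R x - cutoff x0 r R y\<bar> \<le> \<bar>(R - dist x0 x) / (R - r) - (R - dist x0 y) / (R - r)\<bar>"
    unfolding cutoff_def by linarith
  also have "\<dots> = \<bar>dist x0 y - dist x0 x\<bar> / (R - r)"
    using assms by (simp add: diff_divide_distrib[symmetric])
  also have "\<dots> \<le> dist x y / (R - r)"
    using assms dist_triangle[of x0 y x] dist_triangle[of x0 x y]
    by (intro divide_right_mono) (auto simp: dist_commute)
  finally show ?thesis by simp
qed

lemma cutoff_diff_le_1: "\<bar>cutoff x0 r R x - cutoff x0 r R y\<bar> \<le> 1"
  using cutoff_bounds[of x0 r R x] cutoff_bounds[of x0 r R y] by linarith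

lemma cutoff_measurable [measurable]: "cutoff (x0::'a::euclidean_space) r R \<in> borel_measurable borel"
  unfolding cutoff_def[abs_def] by measurable

lemma powr_diff_lipschitz:
  fixes \<alpha> \<beta> :: real
  assumes "0 \<le> \<alpha>" "\<alpha> \<le> 1" "0 \<le> \<beta>" "\<beta> \<le> 1" "1 < p"
  shows "\<bar>\<alpha> powr p - \<beta> powr p\<bar> \<le> p * \<bar>\<alpha> - \<beta>\<bar>"
proof -
  have main: "\<beta> powr p - \<alpha> powr p \<le> p * (\<beta> - \<alpha>)"
    if "\<alpha> \<le> \<beta>" "0 \<le> \<alpha>" "\<beta> \<le> 1" for \<alpha> \<beta> :: real
  proof -
    have "\<beta> powr p - \<alpha> powr p \<le> \<beta> powr (p - 1) * (p * (\<beta> - \<alpha>))"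
      using powr_tangent[of \<beta> \<alpha> p] that assms by (simp add: algebra_simps)
    also have "\<dots> \<le> 1 * (p * (\<beta> - \<alpha>))"
      using that assms by (intro mult_right_mono powr_le1) auto
    finally show ?thesis by simp
  qed
  show ?thesis
  proof (cases "\<alpha> \<le> \<beta>")
    case True
    then have "\<alpha> powr p \<le> \<beta> powr p" using assms by (intro powr_mono2) auto
    then show ?thesis using main[of \<alpha> \<beta>] True assms by simp
  next
    case False
    then have "\<beta> powr p \<le> \<alpha> powr p" using assms by (intro powr_mono2) auto
    then show ?thesis using main[of \<beta> \<alpha>] False assms by simp
  qed
qed

context borel_supersolution
begin

definition defect :: "real \<Rightarrow> 'a \<Rightarrow> real" where
  "defect l x = max (l - u x) 0"

lemma defect_nonneg [simp]: "0 \<le> defect l x"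
  by (simp add: defect_def)

lemma defect_measurable [measurable]: "defect l \<in> borel_measurable borel"
  unfolding defect_def[abs_def] by measurable

lemma defect_powr_finite:
  assumes "cball x0 R \<subseteq> \<Omega>"
  shows "(\<integral>\<^sup>+x. ennreal (indicator (ball x0 R) x * defect l x powr p) \<partial>lborel) < \<infinity>"
proof -
  have [measurable]: "ball x0 R \<in> sets borel" by simp
  have le: "indicator (ball x0 R) x * defect l x powr p \<le>
      2 powr p * \<bar>l\<bar> powr p * indicator (ball x0 R) x + 2 powr p * (indicator (ball x0 R) x * \<bar>u x\<bar> powr p)" for x
  proof -
    have "defect l x powr p \<le> (\<bar>l\<bar> + \<bar>u x\<bar>) powr p"
      using p by (intro powr_mono2) (auto simp: defect_def)
    also have "\<dots> \<le> 2 powr p * (\<bar>l\<bar> powr p + \<bar>u x\<bar> powr p)" using p by (intro powr_add_le) auto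
    finally show ?thesis by (auto split: split_indicator simp: algebra_simps)
  qed
  have "(\<integral>\<^sup>+x. ennreal (indicator (ball x0 R) x * defect l x powr p) \<partial>lborel) \<le>
    (\<integral>\<^sup>+x. ennreal (2 powr p * \<bar>l\<bar> powr p) * indicator (ball x0 R) x + ennreal (2 powr p) * ennreal (indicator (ball x0 R) x * \<bar>u x\<bar> powr p) \<partial>lborel)"
  proof (rule nn_integral_mono)
    fix x
    have "ennreal (indicator (ball x0 R) x * defect l x powr p) \<le> ennreal (2 powr p * \<bar>l\<bar> powr p * indicator (ball x0 R) x + 2 powr p * (indicator (ball x0 R) x * \<bar>u x\<bar> powr p))"
      by (rule ennreal_leI[OF le])
    then show "ennreal (indicator (ball x0 R) x * defect l x powr p) \<le> ennreal (2 powr p * \<bar>l\<bar> powr p) * indicator (ball x0 R) x + ennreal (2 powr p) * ennreal (indicator (ball x0 R) x * \<bar>u x\<bar> powr p)"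
      by (simp add: ennreal_mult ennreal_indicator)
  qed
  also have "\<dots> = ennreal (2 powr p * \<bar>l\<bar> powr p) * emeasure lborel (ball x0 R) + ennreal (2 powr p) * (\<integral>\<^sup>+x. ennreal (indicator (ball x0 R) x * \<bar>u x\<bar> powr p) \<partial>lborel)"
    by (simp add: nn_integral_add nn_integral_cmult nn_integral_cmult_indicator)
  also have "\<dots> < \<infinity>"
    using u_powr_finite[OF assms] emeasure_bounded_finite[of "ball x0 R"] 
    by (auto simp: ennreal_mult_less_top)
  finally show ?thesis .
qed

definition mass :: "'a \<Rightarrow> real \<Rightarrow> real \<Rightarrow> ennreal" where
  "mass x0 r l = (\<integral>\<^sup>+x. ennreal (indicator (ball x0 r) x * defect l x powr p) \<partial>lborel)"

text \<open>The kernel is centred at x0, so that one number serves all inner points; moving the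
  centre is paid for by a constant in the Caccioppoli estimate.\<close>

definition tail :: "'a \<Rightarrow> real \<Rightarrow> real \<Rightarrow> ennreal" where
  "tail x0 r l = (\<integral>\<^sup>+y. ennreal (indicator (- ball x0 r) y * defect l y powr (p - 1) * kern (s * p) (x0 - y)) \<partial>lborel)"

text \<open>Increments split as (w x - w y) \<psi> x + w y (\<psi> x - \<psi> y), with \<psi> the
  p-th power of the cutoff. The first part is controlled by the energy of u, since w is a
  1-Lipschitz function of u, and the second by the kernel integral of a Lipschitz function. If a
  point leaves the ball of radius r2, its cutoff vanishes and only the second kind remains.\<close>

lemma truncation_admissible:
  fixes l :: real
  assumes r: "r1 < r" "r < r2" and \<Omega>: "cball x0 r2 \<subseteq> \<Omega>"
  defines "\<eta> \<equiv> \<lambda>x. defect l x * cutoff x0 r1 r x powr p"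
  shows "(\<integral>\<^sup>+x. ennreal (\<eta> x powr p) \<partial>lborel) < \<infinity>"
    and "(\<integral>\<^sup>+x. (\<integral>\<^sup>+y. ennreal (\<bar>\<eta> x - \<eta> y\<bar> powr p) * ennreal (kern (s * p) (x - y)) \<partial>lborel) \<partial>lborel) < \<infinity>"
proof -
  let ?D = "ball x0 r2" and ?w = "defect l" and ?k = "\<lambda>x y. kern (s * p) (x - y)"
  define \<psi> where "\<psi> x = cutoff x0 r1 r x powr p" for x
  have Dm [measurable]: "?D \<in> sets borel" by simp
  have [measurable]: "\<psi> \<in> borel_measurable borel" unfolding \<psi>_def[abs_def] by measurable
  have \<psi>01: "0 \<le> \<psi> x" "\<psi> x \<le> 1" for x
    using cutoff_bounds[of x0 r1 r x] p by (auto simp: \<psi>_def intro!: powr_le1)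
  have \<psi>0: "\<psi> x = 0" if "r \<le> dist x0 x" for x
    using cutoff_eq_0[OF r(1) that] p by (simp add: \<psi>_def)
  have \<psi>1: "\<bar>\<psi> x - \<psi> y\<bar> \<le> 1" for x y using \<psi>01[of x] \<psi>01[of y] by linarith
  have \<psi>L: "\<bar>\<psi> x - \<psi> y\<bar> \<le> p / (r - r1) * dist x y" for x y
  proof -
    have "\<bar>\<psi> x - \<psi> y\<bar> \<le> p * \<bar>cutoff x0 r1 r x - cutoff x0 r1 r y\<bar>"
      unfolding \<psi>_def using p by (intro powr_diff_lipschitz cutoff_bounds)
    also have "\<dots> \<le> p * (1 / (r - r1) * dist x y)"
      using p by (intro mult_left_mono cutoff_lipschitz r) auto
    finally show ?thesis by simp
  qed
  have W: "(\<integral>\<^sup>+x. ennreal (indicator ?D x * ?w x powr p) \<partial>lborel) < \<infinity>"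
    by (rule defect_powr_finite[OF \<Omega>])
  show "(\<integral>\<^sup>+x. ennreal (\<eta> x powr p) \<partial>lborel) < \<infinity>"
  proof (rule le_less_trans[OF nn_integral_mono W], rule ennreal_leI)
    fix x
    show "\<eta> x powr p \<le> indicator ?D x * ?w x powr p"
    proof (cases "r \<le> dist x0 x")
      case True then show ?thesis using \<psi>0[OF True] by (simp add: \<eta>_def \<psi>_def)
    next
      case False
      have "\<eta> x \<le> ?w x * 1"
        unfolding \<eta>_def \<psi>_def[symmetric] using \<psi>01 by (intro mult_left_mono) auto
      then have "\<eta> x powr p \<le> ?w x powr p"
        using p \<psi>01[of x] by (intro powr_mono2) (auto simp: \<eta>_def \<psi>_def[symmetric])
      then show ?thesis using False r by simp
    qed
  qed
  obtain C where C: "0 < C" "\<forall>L>0. \<forall>(x::'a) f. (\<forall>y. \<bar>f y\<bar> \<le> 1) \<longrightarrow> (\<forall>y. \<bar>f y\<bar> \<le> L * dist x y) \<longrightarrow>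
      (\<integral>\<^sup>+y. ennreal (\<bar>f y\<bar> powr p * kern (s * p) (x - y)) \<partial>lborel) \<le> ennreal (C * L powr (s * p))"
    using nn_integral_kern_cutoff[OF s p, where 'a = 'a] by blast
  define A where "A = C * (p / (r - r1)) powr (s * p)"
  have A: "(\<integral>\<^sup>+y. ennreal (\<bar>\<psi> x - \<psi> y\<bar> powr p * ?k x y) \<partial>lborel) \<le> ennreal A" for x
    unfolding A_def using p r by (intro C(2)[rule_format] \<psi>1 \<psi>L) auto
  let ?W = "\<lambda>x y. indicator ?D x * ?w x powr p * (\<bar>\<psi> x - \<psi> y\<bar> powr p * ?k x y)"
  let ?N = "\<lambda>x y. indicator ?D x * indicator ?D y * \<bar>u x - u y\<bar> powr p * ?k x y"
  have le: "\<bar>\<eta> x - \<eta> y\<bar> powr p * ?k x y \<le> 2 powr p * (?N x y + (?W x y + ?W y x))" for x y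
  proof -
    have W0: "0 \<le> ?W x y" "0 \<le> ?W y x" "0 \<le> ?N x y" by auto
    have one: "1 \<le> 2 powr p" using p by (intro ge_one_powr_ge_zero) auto
    have mono: "t \<le> 2 powr p * t'" if "t \<le> t'" "0 \<le> t'" for t t' :: real
      using that mult_right_mono[OF one that(2)] by simp
    have \<eta>: "\<eta> x = ?w x * \<psi> x" for x by (simp add: \<eta>_def \<psi>_def)
    show ?thesis
    proof (cases "x \<in> ?D \<and> y \<in> ?D")
      case True
      have "\<bar>?w x - ?w y\<bar> \<le> \<bar>u x - u y\<bar>" by (auto simp: defect_def max_def)
      then have "\<bar>?w x - ?w y\<bar> * \<psi> x \<le> \<bar>u x - u y\<bar> * 1" using \<psi>01[of x] by (intro mult_mono) auto
      moreover have "\<eta> x - \<eta> y = (?w x - ?w y) * \<psi> x + ?w y * (\<psi> x - \<psi> y)" by (simp add: \<eta> algebra_simps)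
      then have "\<bar>\<eta> x - \<eta> y\<bar> \<le> \<bar>?w x - ?w y\<bar> * \<psi> x + ?w y * \<bar>\<psi> x - \<psi> y\<bar>"
        using abs_triangle_ineq[of "(?w x - ?w y) * \<psi> x" "?w y * (\<psi> x - \<psi> y)"] \<psi>01[of x] by (simp add: abs_mult)
      ultimately have "\<bar>\<eta> x - \<eta> y\<bar> \<le> \<bar>u x - u y\<bar> + ?w y * \<bar>\<psi> x - \<psi> y\<bar>" by simp
      then have "\<bar>\<eta> x - \<eta> y\<bar> powr p \<le> (\<bar>u x - u y\<bar> + ?w y * \<bar>\<psi> x - \<psi> y\<bar>) powr p"
        using p by (intro powr_mono2) auto
      also have "\<dots> \<le> 2 powr p * (\<bar>u x - u y\<bar> powr p + (?w y * \<bar>\<psi> x - \<psi> y\<bar>) powr p)"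
        using p by (intro powr_add_le) auto
      finally have "\<bar>\<eta> x - \<eta> y\<bar> powr p * ?k x y \<le> 2 powr p * (\<bar>u x - u y\<bar> powr p + (?w y * \<bar>\<psi> x - \<psi> y\<bar>) powr p) * ?k x y"
        by (rule mult_right_mono) simp
      also have "\<dots> = 2 powr p * (?N x y + ?W y x)"
        using True by (simp add: powr_mult algebra_simps abs_minus_commute[of "\<psi> y"] kern_minus[of _ y])
      also have "\<dots> \<le> 2 powr p * (?N x y + (?W x y + ?W y x))"
        using W0 by (intro mult_left_mono) auto
      finally show ?thesis .
    next
      case False
      have "\<psi> x = 0 \<or> \<psi> y = 0" using False \<psi>0[of x] \<psi>0[of y] r by fastforce
      moreover have "\<psi> x = 0 \<Longrightarrow> \<bar>\<eta> x - \<eta> y\<bar> powr p * ?k x y \<le> ?W y x"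
        using \<psi>01[of y] \<psi>0[of y] r by (cases "y \<in> ?D") (auto simp: \<eta> powr_mult kern_minus[of _ y])
      moreover have "\<psi> y = 0 \<Longrightarrow> \<bar>\<eta> x - \<eta> y\<bar> powr p * ?k x y \<le> ?W x y"
        using \<psi>01[of x] \<psi>0[of x] r by (cases "x \<in> ?D") (auto simp: \<eta> powr_mult)
      ultimately have "\<bar>\<eta> x - \<eta> y\<bar> powr p * ?k x y \<le> ?W y x \<or> \<bar>\<eta> x - \<eta> y\<bar> powr p * ?k x y \<le> ?W x y"
        by blast
      then have "\<bar>\<eta> x - \<eta> y\<bar> powr p * ?k x y \<le> ?N x y + (?W x y + ?W y x)"
        using W0 by linarith
      then show ?thesis using W0 by (intro mono add_nonneg_nonneg)
    qed
  qed
  let ?M = "lborel \<Otimes>\<^sub>M lborel :: ('a \<times> 'a) measure"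
  have Wfin: "(\<integral>\<^sup>+x. (\<integral>\<^sup>+y. ennreal (?W x y) \<partial>lborel) \<partial>lborel) < \<infinity>"
  proof -
    have "(\<integral>\<^sup>+x. (\<integral>\<^sup>+y. ennreal (?W x y) \<partial>lborel) \<partial>lborel) \<le> (\<integral>\<^sup>+x. ennreal (indicator ?D x * ?w x powr p) * ennreal A \<partial>lborel)"
    proof (rule nn_integral_mono)
      fix x
      have "(\<integral>\<^sup>+y. ennreal (?W x y) \<partial>lborel) = ennreal (indicator ?D x * ?w x powr p) * (\<integral>\<^sup>+y. ennreal (\<bar>\<psi> x - \<psi> y\<bar> powr p * ?k x y) \<partial>lborel)"
        by (subst nn_integral_cmult[symmetric]) (auto simp: ennreal_mult)
      then show "(\<integral>\<^sup>+y. ennreal (?W x y) \<partial>lborel) \<le> ennreal (indicator ?D x * ?w x powr p) * ennreal A"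
        using A by (simp add: mult_left_mono)
    qed
    also have "\<dots> < \<infinity>" using W by (simp add: nn_integral_multc ennreal_mult_less_top)
    finally show ?thesis .
  qed
  have Wfin2: "(\<integral>\<^sup>+x. (\<integral>\<^sup>+y. ennreal (?W y x) \<partial>lborel) \<partial>lborel) < \<infinity>"
    by (subst lborel_pair.Fubini') (use Wfin in auto)
  have "(\<integral>\<^sup>+x. (\<integral>\<^sup>+y. ennreal (\<bar>\<eta> x - \<eta> y\<bar> powr p) * ennreal (?k x y) \<partial>lborel) \<partial>lborel)
      \<le> (\<integral>\<^sup>+x. (\<integral>\<^sup>+y. ennreal (2 powr p) * (ennreal (?N x y) + (ennreal (?W x y) + ennreal (?W y x))) \<partial>lborel) \<partial>lborel)"
    using le by (intro nn_integral_mono) (simp add: ennreal_mult[symmetric] ennreal_plus[symmetric] ennreal_leI del: ennreal_plus)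
  also have "\<dots> = ennreal (2 powr p) * ((\<integral>\<^sup>+x. (\<integral>\<^sup>+y. ennreal (?N x y) \<partial>lborel) \<partial>lborel) +
     ((\<integral>\<^sup>+x. (\<integral>\<^sup>+y. ennreal (?W x y) \<partial>lborel) \<partial>lborel) + (\<integral>\<^sup>+x. (\<integral>\<^sup>+y. ennreal (?W y x) \<partial>lborel) \<partial>lborel)))"
    by (simp add: nn_integral_add nn_integral_cmult)
  also have "(\<integral>\<^sup>+x. (\<integral>\<^sup>+y. ennreal (?N x y) \<partial>lborel) \<partial>lborel) = near_energy ?D"
    unfolding near_energy_def by (subst lborel.nn_integral_fst[symmetric]) auto
  finally show "(\<integral>\<^sup>+x. (\<integral>\<^sup>+y. ennreal (\<bar>\<eta> x - \<eta> y\<bar> powr p) * ennreal (?k x y) \<partial>lborel) \<partial>lborel) < \<infinity>"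
    using u_energy_finite[OF \<Omega>] Wfin Wfin2
    by (auto simp: near_energy_def ennreal_mult_less_top elim!: le_less_trans)
qed


text \<open>If both values of u lie below l, the flux is that of w and the elementary inequality
  applies. If only u x < l, the integrand is at most -w(x)^p \<phi>(x)^p K, and this negative amount
  pays for the good term on the left. If u x \<ge> l, the integrand is nonpositive. Recording the
  good term for one order of the pair suffices.\<close>

lemma truncated_flux_le:
  fixes x0 :: 'a and l :: real
  assumes r: "r1 < r" "r < r2" and z: "k \<le> \<Lambda> * K x y" "K x y \<le> \<Lambda> * k" "k = kern (s * p) (x - y)"
  defines "\<phi> \<equiv> cutoff x0 r1 r" and "w \<equiv> defect l" and "D \<equiv> ball x0 r2"
  shows "energy_integrand p K u (\<lambda>x. w x * \<phi> x powr p) (x, y)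
      + (indicator (ball x0 r1) x * w x powr p) * (indicator {y\<in>D. l \<le> u y} y * k) / \<Lambda>
    \<le> p powr p * (\<Lambda> * (indicator D x * indicator D y * (w x powr p + w y powr p) * (\<bar>\<phi> x - \<phi> y\<bar> powr p * k)))
      + (indicator (ball x0 r) x * w x) * (indicator (- D) y * w y powr (p - 1)) * (\<Lambda> * k)
      + (indicator (ball x0 r) y * w y) * (indicator (- D) x * w x powr (p - 1)) * (\<Lambda> * k)"
    (is "?F + ?G \<le> ?N + ?Q1 + ?Q2")
proof -
  have k0: "0 \<le> k" and K0: "0 \<le> K x y" using K_nonneg z(3) by auto
  have \<Lambda>0: "0 < \<Lambda>" using \<Lambda> by simp
  have w0: "0 \<le> w x" for x by (simp add: w_def)
  have \<phi>b: "0 \<le> \<phi> x" "\<phi> x \<le> 1" "0 \<le> \<phi> x powr p" "\<phi> x powr p \<le> 1" for x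
    using cutoff_bounds[of x0 r1 r x] p by (auto simp: \<phi>_def intro!: powr_le1)
  have \<phi>0: "\<phi> x powr p = 0" if "r \<le> dist x0 x" for x
    using cutoff_eq_0[OF r(1) that] by (simp add: \<phi>_def)
  have nn: "0 \<le> ?N" "0 \<le> ?Q1" "0 \<le> ?Q2"
    using \<Lambda>0 k0 w0 by (auto intro!: mult_nonneg_nonneg add_nonneg_nonneg)
  have F: "?F = \<bar>u x - u y\<bar> powr (p - 2) * (u x - u y) * (w x * \<phi> x powr p - w y * \<phi> y powr p) * K x y"
    by (simp add: energy_integrand_def)
  consider (a) "u x < l" "u y < l" | (b) "u x < l" "l \<le> u y" | (c) "l \<le> u x" by linarith
  then show ?thesis
  proof cases
    case a
    have G0: "?G = 0" using a by simp
    have F': "?F = \<bar>w y - w x\<bar> powr (p - 2) * (w y - w x) * (w x * \<phi> x powr p - w y * \<phi> y powr p) * K x y"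
      using a unfolding F by (simp add: w_def defect_def)
    \<comment> \<open>If b \<le> a the flux has the favourable sign. Otherwise b - a \<le> b, and
      the far point contributes through b^(p - 1), the quantity that the tail integrates.\<close>
    have far: "\<bar>b - a\<bar> powr (p - 2) * (b - a) * (a * t) * K x y \<le> a * b powr (p - 1) * (\<Lambda> * k)"
      if "0 \<le> a" "0 \<le> b" "0 \<le> t" "t \<le> 1" for a b t
    proof (cases "b \<le> a")
      case True
      then have "\<bar>b - a\<bar> powr (p - 2) * (b - a) * (a * t) * K x y \<le> 0"
        using that K0 by (intro mult_nonpos_nonneg mult_nonneg_nonpos) auto
      also have "0 \<le> a * b powr (p - 1) * (\<Lambda> * k)" using that \<Lambda>0 k0 by simp
      finally show ?thesis .
    next
      case False
      then have "\<bar>b - a\<bar> powr (p - 2) * (b - a) = (b - a) powr (p - 1)"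
        using abs_powr_pred[of "b - a" p] by simp
      also have "\<dots> \<le> b powr (p - 1)" using False that p by (intro powr_mono2) auto
      finally have "\<bar>b - a\<bar> powr (p - 2) * (b - a) * (a * t) * K x y \<le> b powr (p - 1) * (a * 1) * (\<Lambda> * k)"
        using that K0 z(2) False by (intro mult_mono) auto
      then show ?thesis by (simp add: mult_ac)
    qed
    consider "r \<le> dist x0 x" "r \<le> dist x0 y" | "dist x0 x < r2" "dist x0 y < r2"
      | "dist x0 x < r" "r2 \<le> dist x0 y" | "dist x0 y < r" "r2 \<le> dist x0 x"
      using r by linarith
    then show ?thesis
    proof cases
      case 1
      then have "?F = 0" by (simp add: F \<phi>0)
      then show ?thesis using G0 nn by linarith
    next
      case 2
      have "?F \<le> p powr p * ((w x powr p + w y powr p) * \<bar>\<phi> x - \<phi> y\<bar> powr p) * K x y"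
        unfolding F' using w0 \<phi>b p K0 by (intro mult_right_mono powr_caccioppoli) auto
      also have "\<dots> \<le> p powr p * ((w x powr p + w y powr p) * \<bar>\<phi> x - \<phi> y\<bar> powr p) * (\<Lambda> * k)"
        using z(2) by (intro mult_left_mono) auto
      also have "\<dots> = ?N" using 2 by (simp add: D_def algebra_simps)
      finally show ?thesis using G0 nn by linarith
    next
      case 3
      then have "\<phi> y powr p = 0" using r by (intro \<phi>0) simp
      then have "?F \<le> w x * w y powr (p - 1) * (\<Lambda> * k)"
        using far[of "w x" "w y" "\<phi> x powr p"] w0 \<phi>b by (simp add: F')
      also have "\<dots> = ?Q1" using 3 by (simp add: D_def)
      finally show ?thesis using G0 nn by linarith
    next
      case 4
      then have "\<phi> x powr p = 0" using r by (intro \<phi>0) simp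
      then have "?F = \<bar>w x - w y\<bar> powr (p - 2) * (w x - w y) * (w y * \<phi> y powr p) * K x y"
        by (simp add: F' abs_minus_commute algebra_simps)
      also have "\<dots> \<le> w y * w x powr (p - 1) * (\<Lambda> * k)"
        using far[of "w y" "w x" "\<phi> y powr p"] w0 \<phi>b by simp
      also have "\<dots> = ?Q2" using 4 by (simp add: D_def)
      finally show ?thesis using G0 nn by linarith
    qed
  next
    case b
    have wy: "w y = 0" using b by (simp add: w_def defect_def)
    have wx: "0 < w x" "w x \<le> u y - u x" using b by (auto simp: w_def defect_def)
    have "\<bar>u x - u y\<bar> powr (p - 2) * (u x - u y) = - ((u y - u x) powr (p - 1))"
      using wx abs_powr_pred[of "u y - u x" p] by (simp add: abs_minus_commute algebra_simps)
    then have "?F = - ((u y - u x) powr (p - 1)) * (w x * \<phi> x powr p - 0 * \<phi> y powr p) * K x y"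
      unfolding F wy by (rule arg_cong)
    then have "?F = - ((u y - u x) powr (p - 1) * (w x * \<phi> x powr p) * K x y)"
      by simp
    moreover have "w x powr (p - 1) * (w x * \<phi> x powr p) * K x y \<le> (u y - u x) powr (p - 1) * (w x * \<phi> x powr p) * K x y"
      using wx p \<phi>b K0 w0 by (intro mult_right_mono powr_mono2) auto
    moreover have "?G \<le> w x powr (p - 1) * (w x * \<phi> x powr p) * K x y"
    proof (cases "x \<in> ball x0 r1 \<and> y \<in> D")
      case True
      then have 1: "\<phi> x = 1" using r cutoff_eq_1[of r1 r x0 x] by (simp add: \<phi>_def)
      have "?G = w x powr p * (k / \<Lambda>)" using True b by simp
      also have "\<dots> \<le> w x powr p * K x y"
        using z(1) \<Lambda>0 by (intro mult_left_mono) (auto simp: field_simps)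
      also have "\<dots> = w x powr (p - 1) * w x * K x y"
        using powr_mult_base[of "w x" "p - 1"] w0 by (simp add: mult.commute)
      finally show ?thesis by (simp add: 1)
    next
      case False
      then have "?G = 0" by auto
      moreover have "0 \<le> w x powr (p - 1) * (w x * \<phi> x powr p) * K x y" using w0 \<phi>b K0 by simp
      ultimately show ?thesis by linarith
    qed
    ultimately show ?thesis using nn by linarith
  next
    case c
    have wx: "w x = 0" using c by (simp add: w_def defect_def)
    then have G: "?G = 0" using p by simp
    have "?F \<le> 0"
    proof (cases "l \<le> u y")
      case True
      then have "w y = 0" by (simp add: w_def defect_def)
      then show ?thesis by (simp add: F wx)
    next
      case False
      then have "0 \<le> u x - u y" using c by simp
      then show ?thesis
        unfolding F wx using w0 \<phi>b K0 by (intro mult_nonpos_nonneg mult_nonneg_nonpos) auto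
    qed
    then show ?thesis using G nn by linarith
  qed
qed

text \<open>The pointwise estimate is integrated against the weak inequality. The cutoff lives in
  the ball of the middle radius r, away from the complement of the outer ball; the far interaction
  then factorises into the tail at x0 and an L^1 norm.\<close>

lemma caccioppoli:
  obtains C where "0 < C"
    and "\<And>x0 r1 r2 l. 0 < r1 \<Longrightarrow> r1 < r2 \<Longrightarrow> cball x0 r2 \<subseteq> \<Omega> \<Longrightarrow>
      (\<integral>\<^sup>+x. ennreal (indicator (ball x0 r1) x * defect l x powr p) *
         (\<integral>\<^sup>+y. ennreal (indicator {y\<in>ball x0 r2. l \<le> u y} y * kern (s * p) (x - y)) \<partial>lborel) \<partial>lborel)
      \<le> ennreal C * (ennreal ((r2 - r1) powr - (s * p)) * mass x0 r2 l
         + ennreal ((2 * r2 / (r2 - r1)) powr (real DIM('a) + s * p)) *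
           (tail x0 r2 l *
            (\<integral>\<^sup>+x. ennreal (indicator (ball x0 r2) x * defect l x) \<partial>lborel)))"
proof -
  obtain C0 where C0: "0 < C0" "\<forall>L>0. \<forall>(x::'a) f. (\<forall>y. \<bar>f y\<bar> \<le> 1) \<longrightarrow> (\<forall>y. \<bar>f y\<bar> \<le> L * dist x y) \<longrightarrow>
      (\<integral>\<^sup>+y. ennreal (\<bar>f y\<bar> powr p * kern (s * p) (x - y)) \<partial>lborel) \<le> ennreal (C0 * L powr (s * p))"
    using nn_integral_kern_cutoff[OF s p, where 'a = 'a] by blast
  \<comment> \<open>One factor \<Lambda> bounds K from above, the other clears the division by
    \<Lambda> in the good term; 2 counts the two orders of a pair, and 2^(s p) stems from the
    Lipschitz constant 2/(r2 - r1) of the cutoff.\<close>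
  define C where "C = 2 * \<Lambda>\<^sup>2 * (p powr p * C0 * 2 powr (s * p) + 1)"
  have \<Lambda>0: "0 < \<Lambda>" using \<Lambda> by simp
  have Cpos: "0 < C" unfolding C_def using \<Lambda>0 C0 by (intro mult_pos_pos add_nonneg_pos) auto
  show ?thesis
  proof (rule that[OF Cpos])
    fix x0 :: 'a and r1 r2 l :: real
    assume r1: "0 < r1" and r12: "r1 < r2" and \<Omega>: "cball x0 r2 \<subseteq> \<Omega>"
    define r where "r = (r1 + r2) / 2"
    have r: "r1 < r" "r < r2" using r12 by (auto simp: r_def)
    let ?\<phi> = "cutoff x0 r1 r" and ?w = "defect l" and ?D = "ball x0 r2" and ?k = "\<lambda>x y. kern (s * p) (x - y)"
    let ?t = "2 * r2 / (r2 - r1)"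
    let ?t' = "?t powr (real DIM('a) + s * p)"
    let ?S = "{y\<in>?D. l \<le> u y}"
    let ?M = "lborel \<Otimes>\<^sub>M lborel :: ('a \<times> 'a) measure"
    let ?\<eta> = "\<lambda>x. ?w x * ?\<phi> x powr p"
    have [measurable]: "ball x0 \<rho> \<in> sets borel" for \<rho> by simp
    have [measurable]: "?S \<in> sets borel" by measurable
    define W where "W = mass x0 r2 l"
    define W1 where "W1 = (\<integral>\<^sup>+x. ennreal (indicator ?D x * ?w x) \<partial>lborel)"
    define T where "T = tail x0 r2 l"
    define A where "A = C0 * (2 / (r2 - r1)) powr (s * p)"
    have A0: "0 \<le> A" using C0 by (simp add: A_def)
    have tt0: "0 \<le> ?t'" by simp
    \<comment> \<open>Here |x - y| \<ge> |y - x0| - r \<ge> |y - x0| (1 - r/r2), and 1 - r/r2 is the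
      reciprocal of \<open>?t\<close>.\<close>
    have far: "?k x y \<le> ?t' * kern (s * p) (x0 - y)" if "dist x0 x < r" "r2 \<le> dist x0 y" for x y
    proof -
      have r20: "0 < r2" using r1 r12 by simp
      have pos: "0 < dist x0 y" using that r20 by linarith
      have tpos: "0 < ?t" using r20 r12 by simp
      have neg: "- real DIM('a) - s * p = - (real DIM('a) + s * p)" by simp
      have "dist x0 y / ?t = dist x0 y * (r2 - r) / r2" using r20 r12 by (simp add: r_def field_simps)
      also have "\<dots> = dist x0 y - r * (dist x0 y / r2)" using r20 by (simp add: field_simps)
      also have "\<dots> \<le> dist x0 y - r * 1"
        using that r20 r r1 by (intro diff_left_mono mult_left_mono) auto
      also have "\<dots> \<le> norm (x - y)" using that dist_triangle[of x0 y x] by (simp add: dist_norm)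
      finally have "dist x0 y / ?t \<le> norm (x - y)" .
      then have "?k x y \<le> (dist x0 y / ?t) powr (- real DIM('a) - s * p)"
        by (rule kern_mono[OF divide_pos_pos[OF pos tpos] _ sp_pos])
      also have "\<dots> = dist x0 y powr - (real DIM('a) + s * p) / ?t powr - (real DIM('a) + s * p)"
        unfolding neg by (rule powr_divide)
      also have "\<dots> = ?t' * kern (s * p) (x0 - y)"
        unfolding kern_def neg dist_norm powr_minus[of ?t] by (simp only: divide_inverse inverse_inverse_eq mult.commute)
      finally show ?thesis .
    qed
    have adm: "(\<integral>\<^sup>+x. ennreal (?\<eta> x powr p) \<partial>lborel) < \<infinity>"
      "(\<integral>\<^sup>+x. (\<integral>\<^sup>+y. ennreal (\<bar>?\<eta> x - ?\<eta> y\<bar> powr p) * ennreal (kern (s * p) (x - y)) \<partial>lborel) \<partial>lborel) < \<infinity>"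
      using truncation_admissible[OF r \<Omega>, of l] by auto
    have \<eta>m: "?\<eta> \<in> borel_measurable borel" by measurable
    have \<eta>s: "?\<eta> x = 0" if "r \<le> dist x0 x" for x
      using cutoff_eq_0[OF r(1) that] by simp
    have weak: "integrable ?M (energy_integrand p K u ?\<eta>)" "0 \<le> (\<integral>z. energy_integrand p K u ?\<eta> z \<partial>?M)"
      using weak_inequality[OF \<eta>m _ \<eta>s r(2) \<Omega> adm] by auto
    let ?G = "\<lambda>z. (indicator (ball x0 r1) (fst z) * ?w (fst z) powr p) * (indicator ?S (snd z) * ?k (fst z) (snd z)) / \<Lambda>"
    let ?N1 = "\<lambda>x y. (indicator ?D x * ?w x powr p) * (\<bar>?\<phi> x - ?\<phi> y\<bar> powr p * ?k x y)"
    let ?f = "\<lambda>x. indicator ?D x * ?w x"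
    let ?h = "\<lambda>y. indicator (- ?D) y * ?w y powr (p - 1) * kern (s * p) (x0 - y)"
    let ?B = "\<lambda>z. p powr p * \<Lambda> * (?N1 (fst z) (snd z) + ?N1 (snd z) (fst z))
       + \<Lambda> * ?t' * (?f (fst z) * ?h (snd z) + ?f (snd z) * ?h (fst z))"
    have N10: "0 \<le> ?N1 x y" for x y by simp
    have le: "AE z in ?M. energy_integrand p K u ?\<eta> z + ?G z \<le> ?B z"
      using K_le K_ge
    proof eventually_elim
      case (elim z)
      obtain x y where z: "z = (x, y)" by (cases z)
      have Q: "(indicator (ball x0 r) x * ?w x) * (indicator (- ?D) y * ?w y powr (p - 1)) * (\<Lambda> * ?k x y)
          \<le> \<Lambda> * ?t' * (?f x * ?h y)" for x y
      proof (cases "dist x0 x < r \<and> r2 \<le> dist x0 y")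
        case True
        have "?w x * ?w y powr (p - 1) * (\<Lambda> * ?k x y) \<le> ?w x * ?w y powr (p - 1) * (\<Lambda> * (?t' * kern (s * p) (x0 - y)))"
          using far[of x y] True \<Lambda>0 by (intro mult_left_mono) auto
        then show ?thesis using True r by (simp add: mult_ac)
      next
        case False
        have "0 \<le> \<Lambda> * ?t' * (?f x * ?h y)" using \<Lambda>0 by simp
        then show ?thesis using False by auto
      qed
      have N: "p powr p * (\<Lambda> * (indicator ?D x * indicator ?D y * (?w x powr p + ?w y powr p) * (\<bar>?\<phi> x - ?\<phi> y\<bar> powr p * ?k x y)))
        \<le> p powr p * \<Lambda> * (?N1 x y + ?N1 y x)"
      proof -
        have "indicator ?D x * indicator ?D y * (?w x powr p + ?w y powr p) * (\<bar>?\<phi> x - ?\<phi> y\<bar> powr p * ?k x y)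
            \<le> ?N1 x y + ?N1 y x"
          using N10[of x y] N10[of y x]
          by (auto split: split_indicator simp: algebra_simps abs_minus_commute[of "?\<phi> y"] kern_minus[of _ y])
        then have "p powr p * \<Lambda> * (indicator ?D x * indicator ?D y * (?w x powr p + ?w y powr p) * (\<bar>?\<phi> x - ?\<phi> y\<bar> powr p * ?k x y))
            \<le> p powr p * \<Lambda> * (?N1 x y + ?N1 y x)"
          using \<Lambda>0 by (intro mult_left_mono) auto
        then show ?thesis by (simp only: mult.assoc)
      qed
      have "energy_integrand p K u ?\<eta> (x, y) + ?G (x, y) \<le>
        p powr p * (\<Lambda> * (indicator ?D x * indicator ?D y * (?w x powr p + ?w y powr p) * (\<bar>?\<phi> x - ?\<phi> y\<bar> powr p * ?k x y)))
        + (indicator (ball x0 r) x * ?w x) * (indicator (- ?D) y * ?w y powr (p - 1)) * (\<Lambda> * ?k x y)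
        + (indicator (ball x0 r) y * ?w y) * (indicator (- ?D) x * ?w x powr (p - 1)) * (\<Lambda> * ?k x y)"
        using truncated_flux_le[OF r, where k = "?k x y" and x = x and y = y and ?x0.0 = x0 and l = l] elim by (simp add: z)
      also have "\<dots> \<le> ?B (x, y)"
        using N Q[of x y] Q[of y x] kern_minus[of "s * p" x y] by (simp add: distrib_left)
      finally show ?case by (simp add: z)
    qed
    have "(\<integral>\<^sup>+z. ennreal (?G z) \<partial>?M) \<le> (\<integral>\<^sup>+z. ennreal (?B z) \<partial>?M)"
    proof (rule nn_integral_le_of_integral_nonneg[OF weak _ _ _ le])
      show "0 \<le> ?B z" for z
        using \<Lambda>0 by (intro add_nonneg_nonneg mult_nonneg_nonneg) auto
      show "0 \<le> ?G z" for z using \<Lambda>0 by simp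
    qed measurable
    also have "\<dots> = ennreal (p powr p * \<Lambda>) * ((\<integral>\<^sup>+z. ennreal (?N1 (fst z) (snd z)) \<partial>?M) + (\<integral>\<^sup>+z. ennreal (?N1 (snd z) (fst z)) \<partial>?M))
        + ennreal (\<Lambda> * ?t') * ((\<integral>\<^sup>+z. ennreal (?f (fst z) * ?h (snd z)) \<partial>?M) + (\<integral>\<^sup>+z. ennreal (?f (snd z) * ?h (fst z)) \<partial>?M))"
    proof -
      have "(\<integral>\<^sup>+z. ennreal (?B z) \<partial>?M) = (\<integral>\<^sup>+z. ennreal (p powr p * \<Lambda>) * (ennreal (?N1 (fst z) (snd z)) + ennreal (?N1 (snd z) (fst z)))
        + ennreal (\<Lambda> * ?t') * (ennreal (?f (fst z) * ?h (snd z)) + ennreal (?f (snd z) * ?h (fst z))) \<partial>?M)"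
        using \<Lambda>0 by (intro nn_integral_cong) (simp add: ennreal_mult[symmetric] ennreal_plus[symmetric] del: ennreal_plus)
      also have "\<dots> = ennreal (p powr p * \<Lambda>) * ((\<integral>\<^sup>+z. ennreal (?N1 (fst z) (snd z)) \<partial>?M) + (\<integral>\<^sup>+z. ennreal (?N1 (snd z) (fst z)) \<partial>?M))
        + ennreal (\<Lambda> * ?t') * ((\<integral>\<^sup>+z. ennreal (?f (fst z) * ?h (snd z)) \<partial>?M) + (\<integral>\<^sup>+z. ennreal (?f (snd z) * ?h (fst z)) \<partial>?M))"
        by (simp add: nn_integral_add nn_integral_cmult)
      finally show ?thesis .
    qed
    also have "\<dots> \<le> ennreal (p powr p * \<Lambda>) * (ennreal A * W + ennreal A * W) + ennreal (\<Lambda> * ?t') * (W1 * T + W1 * T)"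
    proof -
      have I: "(\<integral>\<^sup>+x. (\<integral>\<^sup>+y. ennreal (?N1 x y) \<partial>lborel) \<partial>lborel) \<le> ennreal A * W"
      proof -
        have "(\<integral>\<^sup>+y. ennreal (?N1 x y) \<partial>lborel) \<le> ennreal A * ennreal (indicator ?D x * ?w x powr p)" for x
        proof -
          have "(\<integral>\<^sup>+y. ennreal (?N1 x y) \<partial>lborel) = ennreal (indicator ?D x * ?w x powr p) * (\<integral>\<^sup>+y. ennreal (\<bar>?\<phi> x - ?\<phi> y\<bar> powr p * ?k x y) \<partial>lborel)"
            by (subst nn_integral_cmult[symmetric]) (auto simp: ennreal_mult)
          also have "\<dots> \<le> ennreal (indicator ?D x * ?w x powr p) * ennreal A"
          proof (rule mult_left_mono)
            have rr: "1 / (r - r1) = 2 / (r2 - r1)" using r12 by (simp add: r_def field_simps)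
            have 1: "\<forall>y. \<bar>?\<phi> x - ?\<phi> y\<bar> \<le> 1" by (simp add: cutoff_diff_le_1)
            have 2: "\<forall>y. \<bar>?\<phi> x - ?\<phi> y\<bar> \<le> 2 / (r2 - r1) * dist x y"
              using cutoff_lipschitz[OF r(1), of x0 x] unfolding rr by auto
            have 3: "0 < 2 / (r2 - r1)" using r12 by simp
            show "(\<integral>\<^sup>+y. ennreal (\<bar>?\<phi> x - ?\<phi> y\<bar> powr p * ?k x y) \<partial>lborel) \<le> ennreal A"
              using C0(2)[rule_format, OF 3 1[rule_format] 2[rule_format]] by (simp add: A_def)
          qed simp
          finally show ?thesis by (simp add: mult.commute)
        qed
        then have "(\<integral>\<^sup>+x. (\<integral>\<^sup>+y. ennreal (?N1 x y) \<partial>lborel) \<partial>lborel) \<le> (\<integral>\<^sup>+x. ennreal A * ennreal (indicator ?D x * ?w x powr p) \<partial>lborel)"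
          by (intro nn_integral_mono)
        also have "\<dots> = ennreal A * W" by (simp add: W_def mass_def nn_integral_cmult)
        finally show ?thesis .
      qed
      have "(\<integral>\<^sup>+z. ennreal (?N1 (fst z) (snd z)) \<partial>?M) = (\<integral>\<^sup>+x. (\<integral>\<^sup>+y. ennreal (?N1 x y) \<partial>lborel) \<partial>lborel)"
        by (subst lborel.nn_integral_fst[symmetric]) auto
      moreover have "(\<integral>\<^sup>+z. ennreal (?N1 (snd z) (fst z)) \<partial>?M) = (\<integral>\<^sup>+x. (\<integral>\<^sup>+y. ennreal (?N1 x y) \<partial>lborel) \<partial>lborel)"
        by (subst lborel_pair.nn_integral_snd[symmetric]) auto
      moreover have "(\<integral>\<^sup>+z. ennreal (?f (fst z) * ?h (snd z)) \<partial>?M) = W1 * T"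
        unfolding W1_def T_def tail_def by (rule nn_integral_pair_mult(1)) auto
      moreover have "(\<integral>\<^sup>+z. ennreal (?f (snd z) * ?h (fst z)) \<partial>?M) = W1 * T"
        unfolding W1_def T_def tail_def by (rule nn_integral_pair_mult(2)) auto
      ultimately show ?thesis using I by (simp add: add_mono mult_left_mono)
    qed
    finally have fin: "(\<integral>\<^sup>+z. ennreal (?G z) \<partial>?M) \<le> ennreal (p powr p * \<Lambda>) * (ennreal A * W + ennreal A * W) + ennreal (\<Lambda> * ?t') * (W1 * T + W1 * T)" .
    let ?L = "\<integral>\<^sup>+x. ennreal (indicator (ball x0 r1) x * ?w x powr p) * (\<integral>\<^sup>+y. ennreal (indicator ?S y * ?k x y) \<partial>lborel) \<partial>lborel"
    have "?L = (\<integral>\<^sup>+x. (\<integral>\<^sup>+y. ennreal \<Lambda> * ennreal (?G (x, y)) \<partial>lborel) \<partial>lborel)"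
    proof (rule nn_integral_cong)
      fix x
      have "ennreal (indicator (ball x0 r1) x * ?w x powr p) * (\<integral>\<^sup>+y. ennreal (indicator ?S y * ?k x y) \<partial>lborel)
        = (\<integral>\<^sup>+y. ennreal (indicator (ball x0 r1) x * ?w x powr p) * ennreal (indicator ?S y * ?k x y) \<partial>lborel)"
        by (rule nn_integral_cmult[symmetric]) measurable
      also have "\<dots> = (\<integral>\<^sup>+y. ennreal \<Lambda> * ennreal (?G (x, y)) \<partial>lborel)"
        using \<Lambda>0 by (intro nn_integral_cong) (simp add: ennreal_mult[symmetric])
      finally show "ennreal (indicator (ball x0 r1) x * ?w x powr p) * (\<integral>\<^sup>+y. ennreal (indicator ?S y * ?k x y) \<partial>lborel)
        = (\<integral>\<^sup>+y. ennreal \<Lambda> * ennreal (?G (x, y)) \<partial>lborel)" .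
    qed
    also have "\<dots> = (\<integral>\<^sup>+z. ennreal \<Lambda> * ennreal (?G z) \<partial>?M)"
      by (rule lborel.nn_integral_fst) measurable
    also have "\<dots> = ennreal \<Lambda> * (\<integral>\<^sup>+z. ennreal (?G z) \<partial>?M)"
      by (rule nn_integral_cmult) measurable
    also have "\<dots> \<le> ennreal \<Lambda> * (ennreal (p powr p * \<Lambda>) * (ennreal A * W + ennreal A * W) + ennreal (\<Lambda> * ?t') * (W1 * T + W1 * T))"
      by (rule mult_left_mono[OF fin]) simp
    also have "\<dots> = ennreal (2 * \<Lambda>\<^sup>2 * p powr p * A) * W + ennreal (2 * \<Lambda>\<^sup>2) * (ennreal ?t' * (T * W1))"
    proof -
      have "ennreal A * W + ennreal A * W = ennreal (2 * A) * W"
        using A0 by (simp add: ennreal_mult mult_2[symmetric] mult.assoc)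
      moreover have "W1 * T + W1 * T = ennreal 2 * (T * W1)"
        by (simp add: mult_2[symmetric] mult.commute)
      moreover have "ennreal \<Lambda> * (ennreal (p powr p * \<Lambda>) * (ennreal (2 * A) * W)) = ennreal (2 * \<Lambda>\<^sup>2 * p powr p * A) * W"
        using A0 \<Lambda>0 by (simp only: mult.assoc[symmetric]) (simp add: ennreal_mult[symmetric] power2_eq_square mult_ac)
      moreover have "ennreal \<Lambda> * (ennreal (\<Lambda> * ?t') * (ennreal 2 * (T * W1))) = ennreal (2 * \<Lambda>\<^sup>2) * (ennreal ?t' * (T * W1))"
      proof -
        have "ennreal \<Lambda> * (ennreal (\<Lambda> * ?t') * ennreal 2) = ennreal (2 * \<Lambda>\<^sup>2) * ennreal ?t'"
          using \<Lambda>0 tt0 by (simp add: ennreal_mult[symmetric] power2_eq_square mult_ac del: ennreal_numeral)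
        then show ?thesis by (simp only: mult.assoc[symmetric])
      qed
      ultimately show ?thesis by (simp only: distrib_left)
    qed
    also have "\<dots> \<le> ennreal (C * (r2 - r1) powr - (s * p)) * W + ennreal C * (ennreal ?t' * (T * W1))"
    proof (intro add_mono mult_right_mono ennreal_leI)
      have "2 * \<Lambda>\<^sup>2 * p powr p * A = 2 * \<Lambda>\<^sup>2 * (p powr p * C0 * 2 powr (s * p)) * (r2 - r1) powr - (s * p)"
      proof -
        have "A = C0 * (2 powr (s * p) / (r2 - r1) powr (s * p))" unfolding A_def by (simp only: powr_divide)
        then show ?thesis by (simp add: powr_minus divide_inverse)
      qed
      also have "\<dots> \<le> C * (r2 - r1) powr - (s * p)"
        unfolding C_def by (intro mult_right_mono mult_left_mono) auto
      finally show "2 * \<Lambda>\<^sup>2 * p powr p * A \<le> C * (r2 - r1) powr - (s * p)" .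
      have "2 * \<Lambda>\<^sup>2 * 1 \<le> C"
        unfolding C_def using C0 by (intro mult_left_mono) auto
      then show "2 * \<Lambda>\<^sup>2 \<le> C" by simp
    qed auto
    also have "\<dots> = ennreal C * (ennreal ((r2 - r1) powr - (s * p)) * W + ennreal ?t' * (T * W1))"
      using Cpos by (simp add: ennreal_mult distrib_left mult.assoc)
    finally show "?L \<le> ennreal C * (ennreal ((r2 - r1) powr - (s * p)) * mass x0 r2 l
         + ennreal ?t' * (tail x0 r2 l *
            (\<integral>\<^sup>+x. ennreal (indicator ?D x * ?w x) \<partial>lborel)))"
      unfolding W_def T_def W1_def .
  qed
qed

end

section \<open>De Giorgi iteration\<close>

context borel_supersolution
begin

lemma defect_mono: "l \<le> l' \<Longrightarrow> defect l x \<le> defect l' x"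
  by (auto simp: defect_def)

lemma mass_mono: "r \<le> r' \<Longrightarrow> l \<le> l' \<Longrightarrow> mass x0 r l \<le> mass x0 r' l'"
  unfolding mass_def using p
  by (intro nn_integral_mono ennreal_leI mult_mono powr_mono2 defect_mono)
    (auto split: split_indicator)

lemma tail_mono: "r \<le> r' \<Longrightarrow> l' \<le> l \<Longrightarrow> tail x0 r' l' \<le> tail x0 r l"
  unfolding tail_def using p
  by (intro nn_integral_mono ennreal_leI mult_mono powr_mono2 defect_mono)
    (auto split: split_indicator)

text \<open>
  This bound replaces the Sobolev inequality: the smaller the sublevel set, the smaller \<open>t\<close> can be chosen.
\<close>

lemma superlevel_potential_ge:
  assumes x: "x \<in> ball x0 r1" and t: "0 < t" "t \<le> r2 - r1"
    and small: "emeasure lborel {y\<in>ball x0 r2. u y < l} \<le> ennreal (unit_ball_vol (real DIM('a)) * t ^ DIM('a) / 2)"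
  shows "ennreal (unit_ball_vol (real DIM('a)) / 2 * t powr - (s * p)) \<le>
    (\<integral>\<^sup>+y. ennreal (indicator {y\<in>ball x0 r2. l \<le> u y} y * kern (s * p) (x - y)) \<partial>lborel)"
proof -
  let ?\<omega> = "unit_ball_vol (real DIM('a))"
  let ?S = "{y\<in>ball x0 r2. l \<le> u y}" and ?A = "{y\<in>ball x0 r2. u y < l}"
  have [measurable]: "ball x0 r2 \<in> sets borel" "ball x t \<in> sets borel" by auto
  have [measurable]: "?S \<in> sets borel" "?A \<in> sets borel" by measurable
  have sub: "ball x t \<subseteq> ball x0 r2"
  proof
    fix y assume "y \<in> ball x t"
    then show "y \<in> ball x0 r2" using x t dist_triangle[of x0 y x] by auto
  qed
  \<comment> \<open>The ball of radius t about x stays inside the larger ball, and the sublevel set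
    fills at most half of it; on the rest the kernel is at least t^(-n - s p).\<close>
  have "ennreal (?\<omega> * t ^ DIM('a)) = emeasure lborel (ball x t)" using t by (simp add: emeasure_ball)
  also have "\<dots> \<le> emeasure lborel (?S \<inter> ball x t \<union> ?A)"
    using sub by (intro emeasure_mono) auto
  also have "\<dots> \<le> emeasure lborel (?S \<inter> ball x t) + emeasure lborel ?A"
    by (intro emeasure_subadditive) auto
  also have "\<dots> \<le> emeasure lborel (?S \<inter> ball x t) + ennreal (?\<omega> * t ^ DIM('a) / 2)"
    by (intro add_left_mono small)
  finally have "ennreal (?\<omega> * t ^ DIM('a)) - ennreal (?\<omega> * t ^ DIM('a) / 2) \<le> emeasure lborel (?S \<inter> ball x t)"
    by (simp add: ennreal_minus_le_iff add.commute)
  moreover have "ennreal (?\<omega> * t ^ DIM('a)) - ennreal (?\<omega> * t ^ DIM('a) / 2) = ennreal (?\<omega> * t ^ DIM('a) / 2)"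
    using t by (subst ennreal_minus) auto
  ultimately have half: "ennreal (?\<omega> * t ^ DIM('a) / 2) \<le> emeasure lborel (?S \<inter> ball x t)" by simp
  have "t powr (- real DIM('a) - s * p) * (?\<omega> * t ^ DIM('a) / 2) = ?\<omega> / 2 * t powr - (s * p)"
    using t by (simp add: powr_realpow[symmetric] powr_add[symmetric] powr_diff powr_minus field_simps)
  then have "ennreal (?\<omega> / 2 * t powr - (s * p)) = ennreal (t powr (- real DIM('a) - s * p) * (?\<omega> * t ^ DIM('a) / 2))"
    by (simp only:)
  also have "\<dots> = ennreal (t powr (- real DIM('a) - s * p)) * ennreal (?\<omega> * t ^ DIM('a) / 2)"
    by (rule ennreal_mult) (use t in auto)
  also have "\<dots> \<le> ennreal (t powr (- real DIM('a) - s * p)) * emeasure lborel (?S \<inter> ball x t)"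
    by (intro mult_left_mono half) auto
  also have "\<dots> = (\<integral>\<^sup>+y. ennreal (t powr (- real DIM('a) - s * p)) * indicator (?S \<inter> ball x t) y \<partial>lborel)"
    by (rule nn_integral_cmult_indicator[symmetric]) auto
  also have "\<dots> \<le> (\<integral>\<^sup>+y. ennreal (indicator ?S y * kern (s * p) (x - y)) \<partial>lborel)"
  proof (rule nn_integral_mono_AE)
    \<comment> \<open>Almost everywhere only, as \<open>kern\<close> is 0 at y = x.\<close>
    show "AE y in lborel. ennreal (t powr (- real DIM('a) - s * p)) * indicator (?S \<inter> ball x t) y \<le> ennreal (indicator ?S y * kern (s * p) (x - y))"
      using AE_lborel_singleton[of x]
    proof eventually_elim
      case (elim y)
      show ?case
      proof (cases "y \<in> ?S \<inter> ball x t")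
        case True
        then have "t powr (- real DIM('a) - s * p) \<le> kern (s * p) (x - y)"
          unfolding kern_def using elim sp_pos by (intro powr_mono2') (auto simp: dist_norm)
        then show ?thesis using True by (auto intro!: ennreal_leI)
      qed auto
    qed
  qed
  finally show ?thesis .
qed

text \<open>By Chebyshev the mass m at level l' controls both missing quantities at level l: the
  sublevel set has measure at most (l' - l)^(-p) m, and the L^1 norm of the defect is at most (l' -
  l)^(1 - p) m. The resulting bound is linear in m; t stays a parameter, to be taken as small as the
  measure condition permits.\<close>

lemma mass_step:
  obtains C where "0 < C"
    and "\<And>x0 r1 r2 l l' t m \<tau>. 0 < r1 \<Longrightarrow> r1 < r2 \<Longrightarrow> cball x0 r2 \<subseteq> \<Omega> \<Longrightarrow> l < l' \<Longrightarrow> 0 < t \<Longrightarrow> t \<le> r2 - r1 \<Longrightarrow>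
      0 \<le> m \<Longrightarrow> 0 \<le> \<tau> \<Longrightarrow> mass x0 r2 l' \<le> ennreal m \<Longrightarrow> tail x0 r2 l \<le> ennreal \<tau> \<Longrightarrow>
      (l' - l) powr - p * m \<le> unit_ball_vol (real DIM('a)) * t ^ DIM('a) / 2 \<Longrightarrow>
      mass x0 r1 l \<le> ennreal (C * t powr (s * p) * ((r2 - r1) powr - (s * p)
          + (2 * r2 / (r2 - r1)) powr (real DIM('a) + s * p) * (\<tau> * (l' - l) powr (1 - p))) * m)"
proof -
  let ?\<omega> = "unit_ball_vol (real DIM('a))"
  have \<omega>: "0 < ?\<omega>" by simp
  obtain C where C: "0 < C" "\<And>x0 r1 r2 l. 0 < r1 \<Longrightarrow> r1 < r2 \<Longrightarrow> cball x0 r2 \<subseteq> \<Omega> \<Longrightarrow>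
      (\<integral>\<^sup>+x. ennreal (indicator (ball x0 r1) x * defect l x powr p) *
         (\<integral>\<^sup>+y. ennreal (indicator {y\<in>ball x0 r2. l \<le> u y} y * kern (s * p) (x - y)) \<partial>lborel) \<partial>lborel)
      \<le> ennreal C * (ennreal ((r2 - r1) powr - (s * p)) * mass x0 r2 l
         + ennreal ((2 * r2 / (r2 - r1)) powr (real DIM('a) + s * p)) *
           (tail x0 r2 l * (\<integral>\<^sup>+x. ennreal (indicator (ball x0 r2) x * defect l x) \<partial>lborel)))"
    by (rule caccioppoli) blast
  show ?thesis
  proof (rule that[of "2 / ?\<omega> * C"])
    show "0 < 2 / ?\<omega> * C" using C by simp
    fix x0 :: 'a and r1 r2 l l' t m \<tau> :: real
    assume r1: "0 < r1" and r12: "r1 < r2" and \<Omega>: "cball x0 r2 \<subseteq> \<Omega>" and l: "l < l'" and t: "0 < t" "t \<le> r2 - r1"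
      and m0: "0 \<le> m" and \<tau>0: "0 \<le> \<tau>" and m: "mass x0 r2 l' \<le> ennreal m" and \<tau>: "tail x0 r2 l \<le> ennreal \<tau>"
      and small: "(l' - l) powr - p * m \<le> ?\<omega> * t ^ DIM('a) / 2"
    let ?D = "ball x0 r2" and ?\<delta> = "l' - l"
    have \<delta>: "0 < ?\<delta>" using l by simp
    have [measurable]: "ball x0 r \<in> sets borel" for r by simp
    have "emeasure lborel {y\<in>?D. u y < l} = (\<integral>\<^sup>+y. indicator {y\<in>?D. u y < l} y \<partial>lborel)" by simp
    also have "\<dots> \<le> (\<integral>\<^sup>+y. ennreal (?\<delta> powr - p) * ennreal (indicator ?D y * defect l' y powr p) \<partial>lborel)"
    proof (rule nn_integral_mono)
      fix y
      show "indicator {y\<in>?D. u y < l} y \<le> ennreal (?\<delta> powr - p) * ennreal (indicator ?D y * defect l' y powr p)"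
      proof (cases "y \<in> ?D \<and> u y < l")
        case True
        have "?\<delta> powr p \<le> defect l' y powr p"
          using True \<delta> p by (intro powr_mono2) (auto simp: defect_def)
        then have "?\<delta> powr - p * ?\<delta> powr p \<le> ?\<delta> powr - p * defect l' y powr p"
          by (intro mult_left_mono) auto
        then have "1 \<le> ?\<delta> powr - p * defect l' y powr p" using \<delta> by (simp add: powr_add[symmetric])
        then show ?thesis using True by (simp add: ennreal_mult[symmetric])
      qed auto
    qed
    also have "\<dots> = ennreal (?\<delta> powr - p) * mass x0 r2 l'"
      unfolding mass_def by (rule nn_integral_cmult) measurable
    also have "\<dots> \<le> ennreal (?\<delta> powr - p) * ennreal m" by (intro mult_left_mono m) auto
    also have "\<dots> \<le> ennreal (?\<omega> * t ^ DIM('a) / 2)"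
      using small m0 by (simp add: ennreal_mult[symmetric] ennreal_leI)
    finally have sm: "emeasure lborel {y\<in>?D. u y < l} \<le> ennreal (?\<omega> * t ^ DIM('a) / 2)" .
    have W1: "(\<integral>\<^sup>+x. ennreal (indicator ?D x * defect l x) \<partial>lborel) \<le> ennreal (?\<delta> powr (1 - p) * m)"
    proof -
      have "(\<integral>\<^sup>+x. ennreal (indicator ?D x * defect l x) \<partial>lborel)
          \<le> (\<integral>\<^sup>+y. ennreal (?\<delta> powr (1 - p)) * ennreal (indicator ?D y * defect l' y powr p) \<partial>lborel)"
      proof (rule nn_integral_mono)
        fix y
        \<comment> \<open>Where u < l the defect at level l' is at least \<delta>, so a first power
          is traded for a p-th power at the price \<delta>^(1 - p).\<close>
        have "defect l y \<le> ?\<delta> powr (1 - p) * defect l' y powr p"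
        proof (cases "u y < l")
          case True
          have d: "?\<delta> \<le> defect l' y" "0 < defect l' y" using True \<delta> by (auto simp: defect_def)
          have "defect l y \<le> defect l' y" using l by (intro defect_mono) simp
          also have "\<dots> = ?\<delta> powr (1 - p) * (?\<delta> powr (p - 1) * defect l' y)"
            using \<delta> by (simp add: mult.assoc[symmetric] powr_add[symmetric])
          also have "\<dots> \<le> ?\<delta> powr (1 - p) * (defect l' y powr (p - 1) * defect l' y)"
            using d \<delta> p by (intro mult_left_mono mult_right_mono powr_mono2) auto
          also have "defect l' y powr (p - 1) * defect l' y = defect l' y powr p"
            using d powr_mult_base[of "defect l' y" "p - 1"] by (simp add: mult.commute)
          finally show ?thesis .
        qed (simp add: defect_def)
        then show "ennreal (indicator ?D y * defect l y) \<le> ennreal (?\<delta> powr (1 - p)) * ennreal (indicator ?D y * defect l' y powr p)"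
          by (auto simp: ennreal_mult[symmetric] split: split_indicator intro!: ennreal_leI)
      qed
      also have "\<dots> = ennreal (?\<delta> powr (1 - p)) * mass x0 r2 l'"
        unfolding mass_def by (rule nn_integral_cmult) measurable
      also have "\<dots> \<le> ennreal (?\<delta> powr (1 - p)) * ennreal m" by (intro mult_left_mono m) auto
      finally show ?thesis using m0 by (simp add: ennreal_mult)
    qed
    let ?a = "?\<omega> / 2 * t powr - (s * p)"
    let ?t' = "(2 * r2 / (r2 - r1)) powr (real DIM('a) + s * p)"
    let ?H = "(r2 - r1) powr - (s * p) + ?t' * (\<tau> * ?\<delta> powr (1 - p))"
    have H0: "0 \<le> ?H" using \<tau>0 by simp
    have a0: "0 < ?a" using \<omega> t by simp
    have "ennreal ?a * mass x0 r1 l = (\<integral>\<^sup>+x. ennreal (indicator (ball x0 r1) x * defect l x powr p) * ennreal ?a \<partial>lborel)"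
      unfolding mass_def by (subst nn_integral_multc) (auto simp: mult.commute)
    also have "\<dots> \<le> (\<integral>\<^sup>+x. ennreal (indicator (ball x0 r1) x * defect l x powr p) *
         (\<integral>\<^sup>+y. ennreal (indicator {y\<in>?D. l \<le> u y} y * kern (s * p) (x - y)) \<partial>lborel) \<partial>lborel)"
    proof (rule nn_integral_mono)
      fix x
      show "ennreal (indicator (ball x0 r1) x * defect l x powr p) * ennreal ?a \<le> ennreal (indicator (ball x0 r1) x * defect l x powr p) *
         (\<integral>\<^sup>+y. ennreal (indicator {y\<in>?D. l \<le> u y} y * kern (s * p) (x - y)) \<partial>lborel)"
        using superlevel_potential_ge[OF _ t sm, of x]
        by (cases "x \<in> ball x0 r1") (auto intro!: mult_left_mono)
    qed
    also have "\<dots> \<le> ennreal C * (ennreal ((r2 - r1) powr - (s * p)) * mass x0 r2 l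
         + ennreal ?t' * (tail x0 r2 l * (\<integral>\<^sup>+x. ennreal (indicator ?D x * defect l x) \<partial>lborel)))"
      by (rule C(2)[OF r1 r12 \<Omega>])
    also have "\<dots> \<le> ennreal C * (ennreal ((r2 - r1) powr - (s * p)) * ennreal m
         + ennreal ?t' * (ennreal \<tau> * ennreal (?\<delta> powr (1 - p) * m)))"
    proof -
      have "mass x0 r2 l \<le> ennreal m" using m mass_mono[of r2 r2 l l' x0] l by auto
      then show ?thesis by (intro mult_left_mono add_mono mult_mono W1 \<tau>) auto
    qed
    also have "\<dots> = ennreal (C * (?H * m))"
      using C m0 \<tau>0 by (simp add: ennreal_mult[symmetric] ennreal_plus[symmetric] algebra_simps del: ennreal_plus)
    finally have fin: "ennreal ?a * mass x0 r1 l \<le> ennreal (C * (?H * m))" .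
    have inv: "ennreal (1 / a) * ennreal a = 1" if "0 < a" for a :: real
      using that by (simp add: ennreal_mult[symmetric])
    have "mass x0 r1 l = ennreal (1 / ?a) * (ennreal ?a * mass x0 r1 l)"
      unfolding mult.assoc[symmetric] inv[OF a0] by simp
    also have "\<dots> \<le> ennreal (1 / ?a) * ennreal (C * (?H * m))" by (intro mult_left_mono fin) auto
    also have "\<dots> = ennreal (1 / ?a * (C * (?H * m)))"
      using a0 C H0 m0 by (intro ennreal_mult[symmetric]) auto
    also have "1 / ?a * (C * (?H * m)) = 2 / ?\<omega> * C * t powr (s * p) * ?H * m"
      using t by (simp add: powr_minus field_simps)
    finally show "mass x0 r1 l \<le> ennreal (2 / ?\<omega> * C * t powr (s * p) * ?H * m)" .
  qed
qed


text \<open>A may be any constant, with \<mu> chosen afterwards: a tail of the natural order only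
  adds a constant factor to a step, which a smaller t compensates. Only the mass has to be
  small.\<close>

lemma degiorgi:
  assumes A: "0 \<le> A"
  obtains \<mu> where "0 < \<mu>"
    and "\<And>x0 r k \<epsilon>. 0 < r \<Longrightarrow> 0 < \<epsilon> \<Longrightarrow> cball x0 (2 * r) \<subseteq> \<Omega> \<Longrightarrow>
      mass x0 (2 * r) k \<le> ennreal (\<mu> * \<epsilon> powr p * r ^ DIM('a)) \<Longrightarrow>
      tail x0 r k \<le> ennreal (A * \<epsilon> powr (p - 1) * r powr - (s * p)) \<Longrightarrow>
      AE y in lborel. y \<in> ball x0 r \<longrightarrow> k - \<epsilon> \<le> u y"
proof -
  let ?n = "real DIM('a)" and ?\<omega> = "unit_ball_vol (real DIM('a))"
  have \<omega>: "0 < ?\<omega>" by simp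
  obtain C where C: "0 < C"
    "\<And>x0 r1 r2 l l' t m \<tau>. 0 < r1 \<Longrightarrow> r1 < r2 \<Longrightarrow> cball x0 r2 \<subseteq> \<Omega> \<Longrightarrow> l < l' \<Longrightarrow> 0 < t \<Longrightarrow> t \<le> r2 - r1 \<Longrightarrow>
      0 \<le> m \<Longrightarrow> 0 \<le> \<tau> \<Longrightarrow> mass x0 r2 l' \<le> ennreal m \<Longrightarrow> tail x0 r2 l \<le> ennreal \<tau> \<Longrightarrow>
      (l' - l) powr - p * m \<le> ?\<omega> * t ^ DIM('a) / 2 \<Longrightarrow>
      mass x0 r1 l \<le> ennreal (C * t powr (s * p) * ((r2 - r1) powr - (s * p)
          + (2 * r2 / (r2 - r1)) powr (?n + s * p) * (\<tau> * (l' - l) powr (1 - p))) * m)"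
    by (rule mass_step) blast
  \<comment> \<open>At step j the radius gap is 2^(-j-1) r and the level gap 2^(-j-1) \<epsilon>; H
    and b collect the resulting powers of 2, so that the bracket in the one-step bound is at most
    r^(-s p) H b^j.\<close>
  define H where "H = 2 powr (s * p) + A * 2 powr (3 * (?n + s * p) + (p - 1))"
  define b :: real where "b = 2 powr (?n + s * p + p)"
  have H: "0 < H" using A unfolding H_def by (intro add_pos_nonneg) auto
  have b: "0 < b" by (simp add: b_def)
  \<comment> \<open>\<open>\<sigma>\<close> absorbs the geometric growth \<open>b ^ j\<close> of the constants. With \<open>\<theta> = \<sigma>\<^sup>n 2 powr (- p)\<close>, the decay
    \<open>\<theta> ^ j\<close> of the masses gives sublevel sets that fit into balls of radius \<open>\<tau>0 \<sigma> ^ j r\<close>.\<close>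
  define \<sigma> where "\<sigma> = min (1/2) (b powr (- 1 / (s * p)))"
  have \<sigma>: "0 < \<sigma>" "\<sigma> \<le> 1/2" using b by (auto simp: \<sigma>_def)
  have b\<sigma>: "b * \<sigma> powr (s * p) \<le> 1"
  proof -
    have "\<sigma> powr (s * p) \<le> (b powr (- 1 / (s * p))) powr (s * p)"
      using \<sigma> sp_pos by (intro powr_mono2) (auto simp: \<sigma>_def)
    also have "\<dots> = b powr (- 1 / (s * p) * (s * p))" by (rule powr_powr)
    also have "- 1 / (s * p) * (s * p) = - 1" using s p by simp
    also have "b powr - 1 = inverse b" using b by (simp add: powr_minus)
    finally have "b * \<sigma> powr (s * p) \<le> b * inverse b" using b by (intro mult_left_mono) auto
    then show ?thesis using b by simp
  qed
  define \<theta> where "\<theta> = \<sigma> ^ DIM('a) * 2 powr - p"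
  have \<theta>: "0 < \<theta>" using \<sigma> by (simp add: \<theta>_def)
  have \<theta>1: "\<theta> < 1"
  proof -
    have "\<sigma> ^ DIM('a) * 2 powr - p \<le> 1 * 2 powr - p"
      using \<sigma> by (intro mult_right_mono power_le_one) auto
    also have "\<dots> < 1" using p by (simp add: powr_less_one)
    finally show ?thesis by (simp add: \<theta>_def)
  qed
  \<comment> \<open>The second entry makes one step contract the mass by \<theta>; the entry 1/2,
    together with \<sigma> \<le> 1/2, keeps the radius \<open>\<tau>0 * \<sigma> ^ j * r\<close>
    within the gap 2^(-j-1) r.\<close>
  define \<tau>0 where "\<tau>0 = min (1/2) ((\<theta> / (C * H)) powr (1 / (s * p)))"
  have \<tau>0: "0 < \<tau>0" "\<tau>0 \<le> 1/2" using \<theta> C H by (auto simp: \<tau>0_def)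
  have \<tau>\<theta>: "C * H * \<tau>0 powr (s * p) \<le> \<theta>"
  proof -
    have "\<tau>0 powr (s * p) \<le> ((\<theta> / (C * H)) powr (1 / (s * p))) powr (s * p)"
      using \<tau>0 sp_pos by (intro powr_mono2) (auto simp: \<tau>0_def)
    also have "\<dots> = (\<theta> / (C * H)) powr (1 / (s * p) * (s * p))" by (rule powr_powr)
    also have "1 / (s * p) * (s * p) = 1" using s p by simp
    also have "(\<theta> / (C * H)) powr 1 = \<theta> / (C * H)" using \<theta> C H by simp
    finally show ?thesis using C H by (simp add: field_simps)
  qed
  \<comment> \<open>Chosen so that the measure condition of the one-step bound holds with equality
    at every step: \<theta>^j offsets both the shrinking level gaps and the shrinking
    volumes.\<close>
  define \<mu> where "\<mu> = ?\<omega> / 2 * \<tau>0 ^ DIM('a) * 2 powr - p"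
  have \<mu>: "0 < \<mu>" using \<omega> \<tau>0 by (simp add: \<mu>_def)
  show ?thesis
  proof (rule that[OF \<mu>])
    fix x0 :: 'a and r k \<epsilon> :: real
    assume r: "0 < r" and \<epsilon>: "0 < \<epsilon>" and \<Omega>: "cball x0 (2 * r) \<subseteq> \<Omega>"
      and m0: "mass x0 (2 * r) k \<le> ennreal (\<mu> * \<epsilon> powr p * r ^ DIM('a))"
      and tl: "tail x0 r k \<le> ennreal (A * \<epsilon> powr (p - 1) * r powr - (s * p))"
    \<comment> \<open>Radii decrease from 2r towards r and levels from k towards k - \<epsilon>.
      Hence every mass in the sequence dominates the one at radius r and level k - \<epsilon>, and
      every tail is at most the given one.\<close>
    define q :: "nat \<Rightarrow> real" where "q j = (1/2) ^ j" for j
    have q: "0 < q j" "q j \<le> 1" "q (Suc j) = q j / 2" for j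
      by (auto simp: q_def power_le_one)
    define m where "m j = \<mu> * \<epsilon> powr p * r ^ DIM('a) * \<theta> ^ j" for j
    have mpos: "0 \<le> m j" for j using \<mu> r \<theta> by (simp add: m_def)
    have claim: "mass x0 ((1 + q j) * r) (k - \<epsilon> * (1 - q j)) \<le> ennreal (m j)" for j
    proof (induction j)
      case 0
      then show ?case using m0 by (simp add: q_def m_def)
    next
      case (Suc j)
      let ?r1 = "(1 + q (Suc j)) * r" and ?r2 = "(1 + q j) * r"
      let ?l = "k - \<epsilon> * (1 - q (Suc j))" and ?l' = "k - \<epsilon> * (1 - q j)"
      let ?t = "\<tau>0 * \<sigma> ^ j * r" and ?\<tau> = "A * \<epsilon> powr (p - 1) * r powr - (s * p)"
      let ?g = "q j / 2 * r" and ?\<delta> = "\<epsilon> * (q j / 2)"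
      have g: "?r2 - ?r1 = ?g" using q(3)[of j] by (simp add: algebra_simps)
      have d: "?l' - ?l = ?\<delta>" using q(3)[of j] by (simp add: algebra_simps)
      have gpos: "0 < ?g" and dpos: "0 < ?\<delta>" using q(1)[of j] r \<epsilon> by auto
      have q2: "q j = 2 powr - real j"
        by (simp add: q_def powr_minus powr_realpow power_one_over inverse_eq_divide)
      have qh: "q j / 2 = 2 powr - (real j + 1)"
        unfolding q2 by (simp add: powr_diff powr_minus powr_add)
      have tg: "?t \<le> ?r2 - ?r1"
      proof -
        have "\<tau>0 * \<sigma> ^ j \<le> (1/2) * (1/2) ^ j"
          using \<tau>0 \<sigma> by (intro mult_mono power_mono) auto
        then have "\<tau>0 * \<sigma> ^ j \<le> q j / 2" by (simp add: q_def)
        then show ?thesis unfolding g using r by (intro mult_right_mono) auto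
      qed
      have sm: "(?l' - ?l) powr - p * m j \<le> ?\<omega> * ?t ^ DIM('a) / 2"
      proof -
        have "?\<delta> powr - p = \<epsilon> powr - p * (2 powr ((real j + 1) * p))"
          unfolding qh by (simp add: powr_mult powr_powr algebra_simps)
        then have "?\<delta> powr - p * m j = 2 powr ((real j + 1) * p) * \<mu> * r ^ DIM('a) * \<theta> ^ j * (\<epsilon> powr - p * \<epsilon> powr p)"
          unfolding m_def by (simp only: mult_ac)
        also have "\<epsilon> powr - p * \<epsilon> powr p = 1" using \<epsilon> by (simp add: powr_add[symmetric])
        also have "2 powr ((real j + 1) * p) = 2 powr p * (2 powr p) ^ j"
        proof -
          have e: "(real j + 1) * p = p + real j * p" by (simp add: algebra_simps)
          show ?thesis unfolding e powr_add by (simp add: powr_power mult.commute)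
        qed
        also have "2 powr p * (2 powr p) ^ j * \<mu> * r ^ DIM('a) * \<theta> ^ j * 1 = (2 powr p * \<mu>) * ((2 powr p * \<theta>) ^ j * r ^ DIM('a))"
          by (simp add: power_mult_distrib mult_ac)
        also have "2 powr p * \<theta> = \<sigma> ^ DIM('a)" by (simp add: \<theta>_def powr_minus)
        also have "2 powr p * \<mu> = ?\<omega> / 2 * \<tau>0 ^ DIM('a)" by (simp add: \<mu>_def powr_minus)
        also have "?\<omega> / 2 * \<tau>0 ^ DIM('a) * ((\<sigma> ^ DIM('a)) ^ j * r ^ DIM('a)) = ?\<omega> * ?t ^ DIM('a) / 2"
          by (simp add: power_mult_distrib power_mult[symmetric] mult.commute)
        finally show ?thesis unfolding d by simp
      qed
      have \<Omega>': "cball x0 ?r2 \<subseteq> \<Omega>"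
      proof -
        have "?r2 \<le> 2 * r" using q(2)[of j] r by (intro mult_right_mono) auto
        then show ?thesis using \<Omega> by (meson order_trans subset_cball)
      qed
      have tl': "tail x0 ?r2 ?l \<le> ennreal ?\<tau>"
      proof (rule order_trans[OF tail_mono tl])
        show "r \<le> ?r2" using q(1)[of j] r by simp
        show "?l \<le> k" using q(2)[of "Suc j"] \<epsilon> by simp
      qed
      have "mass x0 ?r1 ?l \<le> ennreal (C * ?t powr (s * p) * ((?r2 - ?r1) powr - (s * p)
          + (2 * ?r2 / (?r2 - ?r1)) powr (?n + s * p) * (?\<tau> * (?l' - ?l) powr (1 - p))) * m j)"
      proof (rule C(2)[OF _ _ \<Omega>' _ _ tg mpos _ Suc.IH tl' sm])
        show "0 < ?r1" using q(1)[of "Suc j"] r by simp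
        show "?r1 < ?r2" using g gpos by simp
        show "?l < ?l'" using d dpos by simp
        show "0 < ?t" using \<tau>0 \<sigma> r by simp
        show "0 \<le> ?\<tau>" using A by simp
      qed
      also have "\<dots> \<le> ennreal (\<theta> * m j)"
      proof (intro ennreal_leI mult_right_mono mpos)
        have 1: "(?r2 - ?r1) powr - (s * p) = r powr - (s * p) * 2 powr ((real j + 1) * (s * p))"
          unfolding g qh by (simp add: powr_mult powr_powr algebra_simps)
        have 2: "(2 * ?r2 / (?r2 - ?r1)) powr (?n + s * p) \<le> 2 powr ((real j + 3) * (?n + s * p))"
        proof -
          have "2 * ?r2 / (?r2 - ?r1) = 2 * (1 + q j) / (q j / 2)" unfolding g using r by simp
          also have "\<dots> \<le> 4 / (q j / 2)" using q(1,2)[of j] by (intro divide_right_mono) auto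
          also have "\<dots> = 2 powr (real j + 3)"
            unfolding q2 by (simp add: powr_minus powr_add field_simps)
          finally have "2 * ?r2 / (?r2 - ?r1) \<le> 2 powr (real j + 3)" .
          then have "(2 * ?r2 / (?r2 - ?r1)) powr (?n + s * p) \<le> (2 powr (real j + 3)) powr (?n + s * p)"
            using sp_pos gpos q(1)[of j] r unfolding g by (intro powr_mono2) auto
          then show ?thesis by (simp add: powr_powr)
        qed
        have 3: "?\<tau> * (?l' - ?l) powr (1 - p) = A * r powr - (s * p) * 2 powr ((real j + 1) * (p - 1))"
        proof -
          have "?\<delta> powr (1 - p) = \<epsilon> powr (1 - p) * 2 powr ((real j + 1) * (p - 1))"
            unfolding qh by (simp add: powr_mult powr_powr algebra_simps)
          then have "?\<tau> * ?\<delta> powr (1 - p) = A * r powr - (s * p) * 2 powr ((real j + 1) * (p - 1)) * (\<epsilon> powr (p - 1) * \<epsilon> powr (1 - p))"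
            by (simp only: mult_ac)
          also have "\<epsilon> powr (p - 1) * \<epsilon> powr (1 - p) = 1" using \<epsilon> by (simp add: powr_add[symmetric])
          finally show ?thesis unfolding d by simp
        qed
        let ?J = "real j"
        have bj: "b ^ j = 2 powr (?J * (?n + s * p + p))" by (simp add: b_def powr_power mult.commute)
        have "(?r2 - ?r1) powr - (s * p) + (2 * ?r2 / (?r2 - ?r1)) powr (?n + s * p) * (?\<tau> * (?l' - ?l) powr (1 - p))
          \<le> r powr - (s * p) * 2 powr ((?J + 1) * (s * p))
            + 2 powr ((?J + 3) * (?n + s * p)) * (A * r powr - (s * p) * 2 powr ((?J + 1) * (p - 1)))"
          unfolding 1 3 using A by (intro add_left_mono mult_right_mono 2) auto
        also have "\<dots> = r powr - (s * p) * (2 powr ((?J + 1) * (s * p)) + A * 2 powr ((?J + 3) * (?n + s * p) + (?J + 1) * (p - 1)))"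
          unfolding powr_add[of 2 "(?J + 3) * (?n + s * p)"] by (simp only: distrib_left mult_ac)
        also have "\<dots> \<le> r powr - (s * p) * (2 powr (s * p + ?J * (?n + s * p + p)) + A * 2 powr (3 * (?n + s * p) + (p - 1) + ?J * (?n + s * p + p)))"
        proof -
          have e1: "(?J + 1) * (s * p) \<le> s * p + ?J * (?n + s * p + p)"
            using p by (simp add: distrib_left distrib_right)
          have e2: "(?J + 3) * (?n + s * p) + (?J + 1) * (p - 1) \<le> 3 * (?n + s * p) + (p - 1) + ?J * (?n + s * p + p)"
            by (simp add: algebra_simps)
          show ?thesis
            by (rule mult_left_mono[OF add_mono[OF powr_mono[OF e1] mult_left_mono[OF powr_mono[OF e2] A]]]) auto
        qed
        also have "\<dots> = r powr - (s * p) * (H * b ^ j)"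
          unfolding H_def bj powr_add[of 2 _ "?J * (?n + s * p + p)"]
          by (simp only: distrib_left distrib_right mult.assoc)
        finally have br: "(?r2 - ?r1) powr - (s * p) + (2 * ?r2 / (?r2 - ?r1)) powr (?n + s * p) * (?\<tau> * (?l' - ?l) powr (1 - p))
          \<le> r powr - (s * p) * (H * b ^ j)" .
        \<comment> \<open>The powers of r cancel, \<sigma> keeps the product depending on j at most
          1, and \<tau>0 leaves the factor \<theta>.\<close>
        have "?t powr (s * p) = \<tau>0 powr (s * p) * (\<sigma> powr (s * p)) ^ j * r powr (s * p)"
        proof -
          have "(\<sigma> ^ j) powr (s * p) = (\<sigma> powr (s * p)) ^ j"
            using \<sigma> by (induction j) (auto simp: powr_mult)
          then show ?thesis by (simp add: powr_mult)
        qed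
        then have "C * ?t powr (s * p) * (r powr - (s * p) * (H * b ^ j))
            = (C * H * \<tau>0 powr (s * p)) * (b * \<sigma> powr (s * p)) ^ j * (r powr (s * p) * r powr - (s * p))"
          by (simp add: power_mult_distrib mult_ac)
        also have "r powr (s * p) * r powr - (s * p) = 1" using r by (simp add: powr_add[symmetric])
        also have "(C * H * \<tau>0 powr (s * p)) * (b * \<sigma> powr (s * p)) ^ j * 1 \<le> \<theta> * 1 * 1"
          using \<tau>\<theta> b\<sigma> C H b \<theta> by (intro mult_mono power_le_one) auto
        finally have "C * ?t powr (s * p) * (r powr - (s * p) * (H * b ^ j)) \<le> \<theta>" by simp
        moreover have "C * ?t powr (s * p) * ((?r2 - ?r1) powr - (s * p)
          + (2 * ?r2 / (?r2 - ?r1)) powr (?n + s * p) * (?\<tau> * (?l' - ?l) powr (1 - p)))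
          \<le> C * ?t powr (s * p) * (r powr - (s * p) * (H * b ^ j))"
          using C by (intro mult_left_mono br) auto
        ultimately show "C * ?t powr (s * p) * ((?r2 - ?r1) powr - (s * p)
          + (2 * ?r2 / (?r2 - ?r1)) powr (?n + s * p) * (?\<tau> * (?l' - ?l) powr (1 - p))) \<le> \<theta>" by linarith
      qed
      also have "\<theta> * m j = m (Suc j)" by (simp add: m_def mult_ac)
      finally show ?case .
    qed
    have le: "mass x0 r (k - \<epsilon>) \<le> ennreal (m j)" for j
    proof (rule order_trans[OF mass_mono claim[of j]])
      show "r \<le> (1 + q j) * r" using q(1)[of j] r by simp
      show "k - \<epsilon> \<le> k - \<epsilon> * (1 - q j)" using q(1)[of j] \<epsilon> by (simp add: algebra_simps)
    qed
    have "(\<lambda>j. \<mu> * \<epsilon> powr p * r ^ DIM('a) * \<theta> ^ j) \<longlonglongrightarrow> \<mu> * \<epsilon> powr p * r ^ DIM('a) * 0"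
      using \<theta> \<theta>1 by (intro tendsto_mult_left LIMSEQ_realpow_zero) auto
    then have "m \<longlonglongrightarrow> 0" by (simp add: m_def[abs_def])
    then have "(\<lambda>j. ennreal (m j)) \<longlonglongrightarrow> ennreal 0" by (rule tendsto_ennrealI)
    then have "mass x0 r (k - \<epsilon>) \<le> ennreal 0"
      by (rule LIMSEQ_le_const) (use le in auto)
    then have "mass x0 r (k - \<epsilon>) = 0" by simp
    moreover have [measurable]: "ball x0 r \<in> sets borel" by simp
    ultimately have "AE y in lborel. ennreal (indicator (ball x0 r) y * defect (k - \<epsilon>) y powr p) = 0"
      unfolding mass_def by (subst (asm) nn_integral_0_iff_AE) auto
    then show "AE y in lborel. y \<in> ball x0 r \<longrightarrow> k - \<epsilon> \<le> u y"
    proof eventually_elim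
      case (elim y)
      show ?case
      proof
        assume "y \<in> ball x0 r"
        then have "defect (k - \<epsilon>) y powr p = 0" using elim by (simp add: ennreal_eq_0_iff)
        then show "k - \<epsilon> \<le> u y" by (simp add: defect_def max_def split: if_splits)
      qed
    qed
  qed
qed

end

section \<open>Pointwise lower bounds\<close>

context borel_supersolution
begin

text \<open>The defect is at most |k| plus the negative part of u, so off D the integral is
  controlled by the integrable weight and the assumed tail. The set D may be any Borel set
  containing a ball about x.\<close>

lemma tail_outside_finite:
  assumes d: "0 < d" "ball x d \<subseteq> D" and [measurable]: "D \<in> sets borel"
  shows "(\<integral>\<^sup>+y. ennreal (indicator (- D) y * defect k y powr (p - 1) * kern (s * p) (x - y)) \<partial>lborel) < \<infinity>"
proof -
  define L where "L = ((1 + norm x) / d + 1) powr (real DIM('a) + s * p)"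
  let ?c = "2 powr (p - 1) * L"
  have L: "0 \<le> L" by (simp add: L_def)
  have le: "indicator (- D) y * defect k y powr (p - 1) * kern (s * p) (x - y) \<le>
      ?c * \<bar>k\<bar> powr (p - 1) * weight (s * p) y + ?c * (max (- u y) 0 powr (p - 1) * weight (s * p) y)" for y
  proof (cases "y \<in> D")
    case True then show ?thesis using L by simp
  next
    case False
    then have "d \<le> norm (x - y)" using d(2) by (force simp: dist_norm)
    then have k: "kern (s * p) (x - y) \<le> L * weight (s * p) y"
      unfolding L_def using d sp_pos by (intro kern_le_weight) auto
    have "defect k y powr (p - 1) \<le> (\<bar>k\<bar> + max (- u y) 0) powr (p - 1)"
      using p by (intro powr_mono2) (auto simp: defect_def)
    also have "\<dots> \<le> 2 powr (p - 1) * (\<bar>k\<bar> powr (p - 1) + max (- u y) 0 powr (p - 1))"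
      using p by (intro powr_add_le) auto
    finally have "defect k y powr (p - 1) * kern (s * p) (x - y)
        \<le> 2 powr (p - 1) * (\<bar>k\<bar> powr (p - 1) + max (- u y) 0 powr (p - 1)) * (L * weight (s * p) y)"
      using k by (intro mult_mono) auto
    then show ?thesis using False by (simp add: algebra_simps)
  qed
  have "(\<integral>\<^sup>+y. ennreal (indicator (- D) y * defect k y powr (p - 1) * kern (s * p) (x - y)) \<partial>lborel) \<le>
      (\<integral>\<^sup>+y. ennreal (?c * \<bar>k\<bar> powr (p - 1)) * ennreal (weight (s * p) y) +
        ennreal ?c * ennreal (max (- u y) 0 powr (p - 1) * weight (s * p) y) \<partial>lborel)"
    using L le by (intro nn_integral_mono) (simp add: ennreal_mult[symmetric] ennreal_plus[symmetric] ennreal_leI del: ennreal_plus)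
  also have "\<dots> = ennreal (?c * \<bar>k\<bar> powr (p - 1)) * (\<integral>\<^sup>+y. ennreal (weight (s * p) (y::'a)) \<partial>lborel) +
        ennreal ?c * (\<integral>\<^sup>+y. ennreal (max (- u y) 0 powr (p - 1) * weight (s * p) y) \<partial>lborel)"
    by (simp add: nn_integral_add nn_integral_cmult)
  also have "\<dots> < \<infinity>"
    using u_tail_finite nn_integral_weight_finite[OF sp_pos, where 'a = 'a] by (simp add: ennreal_mult_less_top)
  finally show ?thesis .
qed

text \<open>For y in the ball of radius 2r the factor (2r)^(n + s p) |x - y|^(-n - s p) is at least
  1, so the mass is O(r^(n + s p)), better by r^(s p) than \<open>degiorgi\<close> asks. This spare
  factor lets one finite integral at x replace a Lebesgue point argument.\<close>

lemma lower_bound_at_point: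
  assumes x: "k \<le> u x" and D: "cball x d \<subseteq> \<Omega>" "ball x d \<subseteq> D" "0 < d" and Dm [measurable]: "D \<in> sets borel"
    and fin: "(\<integral>\<^sup>+y. ennreal (indicator D y * defect k y powr p * kern (s * p) (x - y)) \<partial>lborel) < \<infinity>"
      (is "?I < \<infinity>")
    and \<epsilon>: "0 < \<epsilon>"
  shows "\<exists>r>0. AE y in lborel. y \<in> ball x r \<longrightarrow> k - \<epsilon> \<le> u y"
proof -
  let ?n = "real DIM('a)"
  let ?T = "\<integral>\<^sup>+y. ennreal (indicator (- D) y * defect k y powr (p - 1) * kern (s * p) (x - y)) \<partial>lborel"
  obtain C where C: "0 < C" "\<And>r x::'a. 0 < r \<Longrightarrow>
      (\<integral>\<^sup>+y. ennreal (kern (s * p) (x - y)) * indicator {y. r \<le> dist x y} y \<partial>lborel) \<le> ennreal (C * r powr - (s * p))"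
    using nn_integral_kern_outside[OF sp_pos] by blast
  \<comment> \<open>In the tail bound C comes from the kernel outside radius r, multiplied by
    \<epsilon>^(p - 1); the part governed by \<open>?I\<close> and the tail off D contribute one
    unit each once r is small.\<close>
  have C2: "0 \<le> C + 2" using C(1) by simp
  obtain \<mu> where \<mu>: "0 < \<mu>" "\<And>x0 r k \<epsilon>. 0 < r \<Longrightarrow> 0 < \<epsilon> \<Longrightarrow> cball x0 (2 * r) \<subseteq> \<Omega> \<Longrightarrow>
      mass x0 (2 * r) k \<le> ennreal (\<mu> * \<epsilon> powr p * r ^ DIM('a)) \<Longrightarrow>
      tail x0 r k \<le> ennreal ((C + 2) * \<epsilon> powr (p - 1) * r powr - (s * p)) \<Longrightarrow>
      AE y in lborel. y \<in> ball x0 r \<longrightarrow> k - \<epsilon> \<le> u y"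
    by (rule degiorgi[OF C2]) blast
  define i where "i = enn2real ?I"
  define \<tau> where "\<tau> = enn2real ?T"
  have i: "?I = ennreal i" "0 \<le> i" using fin by (auto simp: i_def)
  have \<tau>: "?T = ennreal \<tau>" "0 \<le> \<tau>" using tail_outside_finite[OF D(3,2) Dm] by (auto simp: \<tau>_def)
  \<comment> \<open>An upper bound for r^(s p) with one entry per requirement: the mass, the share
    of \<open>?I\<close> in the tail, and the tail off D. The added 1 avoids division by
    zero.\<close>
  define c where "c = min (\<mu> * \<epsilon> powr p / (2 powr (?n + s * p) * (i + 1))) (min (\<epsilon> powr p / (i + 1)) (\<epsilon> powr (p - 1) / (\<tau> + 1)))"
  have c: "0 < c" using \<mu> \<epsilon> i \<tau> by (auto simp: c_def intro!: divide_pos_pos mult_pos_pos)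
  define r where "r = min (d / 2) (c powr (1 / (s * p)))"
  have r: "0 < r" "2 * r \<le> d" using D(3) c by (auto simp: r_def)
  have rc: "r powr (s * p) \<le> c"
  proof -
    have "r powr (s * p) \<le> (c powr (1 / (s * p))) powr (s * p)"
      using r sp_pos by (intro powr_mono2) (auto simp: r_def)
    also have "\<dots> = c powr (1 / (s * p) * (s * p))" by (rule powr_powr)
    also have "1 / (s * p) * (s * p) = 1" using s p by simp
    finally show ?thesis using c by simp
  qed
  have rc': "i * r powr (s * p) \<le> \<epsilon> powr p" "\<tau> * r powr (s * p) \<le> \<epsilon> powr (p - 1)"
      "2 powr (?n + s * p) * i * r powr (s * p) \<le> \<mu> * \<epsilon> powr p"
  proof -
    have aux: "a * r powr (s * p) \<le> e" if "r powr (s * p) \<le> e / (a + 1)" "0 \<le> a" for a e :: real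
    proof -
      have "(a + 1) * r powr (s * p) \<le> e" using that by (simp add: field_simps)
      moreover have "(a + 1) * r powr (s * p) = a * r powr (s * p) + r powr (s * p)" by (simp add: distrib_right)
      moreover have "0 \<le> r powr (s * p)" by simp
      ultimately show ?thesis by linarith
    qed
    show "i * r powr (s * p) \<le> \<epsilon> powr p" "\<tau> * r powr (s * p) \<le> \<epsilon> powr (p - 1)"
      using rc i \<tau> by (auto intro!: aux simp: c_def)
    have "i * r powr (s * p) \<le> \<mu> * \<epsilon> powr p / 2 powr (?n + s * p)"
      using rc i by (intro aux) (auto simp: c_def)
    then show "2 powr (?n + s * p) * i * r powr (s * p) \<le> \<mu> * \<epsilon> powr p"
      by (simp add: field_simps)
  qed
  have rinv: "r powr (s * p) * r powr - (s * p) = 1" using r by (simp add: powr_add[symmetric])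
  \<comment> \<open>Needed at y = x, where \<open>kern\<close> is 0 and dominates nothing; the
    defect itself vanishes there.\<close>
  have wx: "defect k x = 0" using x by (simp add: defect_def)
  have mass: "mass x (2 * r) k \<le> ennreal (\<mu> * \<epsilon> powr p * r ^ DIM('a))"
  proof -
    have le: "ennreal (indicator (ball x (2 * r)) y * defect k y powr p) \<le>
       ennreal ((2 * r) powr (?n + s * p)) * ennreal (indicator D y * defect k y powr p * kern (s * p) (x - y))" for y
    proof (cases "y \<in> ball x (2 * r) \<and> y \<noteq> x")
      case True
      then have yD: "y \<in> D" using r D(2) by (auto intro!: subsetD[OF D(2)])
      have "(2 * r) powr (- ?n - s * p) \<le> kern (s * p) (x - y)"
        unfolding kern_def using True sp_pos by (intro powr_mono2') (auto simp: dist_norm)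
      then have "(2 * r) powr (?n + s * p) * (2 * r) powr (- ?n - s * p) \<le> (2 * r) powr (?n + s * p) * kern (s * p) (x - y)"
        by (intro mult_left_mono) auto
      moreover have "(2 * r) powr (?n + s * p) * (2 * r) powr (- ?n - s * p) = 1"
        using r by (simp add: powr_add[symmetric])
      ultimately have "defect k y powr p * 1 \<le> defect k y powr p * ((2 * r) powr (?n + s * p) * kern (s * p) (x - y))"
        by (intro mult_left_mono) auto
      then show ?thesis using True yD by (simp add: ennreal_mult[symmetric] mult_ac ennreal_leI)
    next
      case False
      then show ?thesis using wx p by auto
    qed
    have "mass x (2 * r) k \<le> (\<integral>\<^sup>+y. ennreal ((2 * r) powr (?n + s * p)) * ennreal (indicator D y * defect k y powr p * kern (s * p) (x - y)) \<partial>lborel)"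
      unfolding mass_def by (intro nn_integral_mono le)
    also have "\<dots> = ennreal ((2 * r) powr (?n + s * p)) * ?I" by (rule nn_integral_cmult) measurable
    also have "\<dots> = ennreal ((2 * r) powr (?n + s * p) * i)" using i by (simp add: ennreal_mult)
    also have "\<dots> \<le> ennreal (\<mu> * \<epsilon> powr p * r ^ DIM('a))"
    proof (rule ennreal_leI)
      have "(2 * r) powr (?n + s * p) * i = (2 powr (?n + s * p) * i * r powr (s * p)) * r ^ DIM('a)"
        using r by (simp add: powr_mult powr_add[of r] powr_realpow)
      also have "\<dots> \<le> \<mu> * \<epsilon> powr p * r ^ DIM('a)" using r by (intro mult_right_mono rc') auto
      finally show "(2 * r) powr (?n + s * p) * i \<le> \<mu> * \<epsilon> powr p * r ^ DIM('a)" .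
    qed
    finally show ?thesis .
  qed
  have tl: "tail x r k \<le> ennreal ((C + 2) * \<epsilon> powr (p - 1) * r powr - (s * p))"
  proof -
    have le: "ennreal (indicator (- ball x r) y * defect k y powr (p - 1) * kern (s * p) (x - y)) \<le>
        ennreal (\<epsilon> powr (p - 1)) * (ennreal (kern (s * p) (x - y)) * indicator {y. r \<le> dist x y} y)
        + (ennreal (1 / \<epsilon>) * ennreal (indicator D y * defect k y powr p * kern (s * p) (x - y))
        + ennreal (indicator (- D) y * defect k y powr (p - 1) * kern (s * p) (x - y)))" for y
    proof (cases "r \<le> dist x y")
      case True
      \<comment> \<open>Values up to \<epsilon> give the first term; a value w > \<epsilon>
        satisfies w^(p - 1) \<le> w^p/\<epsilon>, whose integral over D is bounded by
        \<open>?I\<close>.\<close>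
      have "defect k y powr (p - 1) \<le> \<epsilon> powr (p - 1) + 1 / \<epsilon> * defect k y powr p"
      proof (cases "defect k y \<le> \<epsilon>")
        case True
        then have "defect k y powr (p - 1) \<le> \<epsilon> powr (p - 1)" using p by (intro powr_mono2) auto
        then show ?thesis using \<epsilon> by (simp add: add_increasing2)
      next
        case False
        then have "defect k y powr (p - 1) * \<epsilon> \<le> defect k y powr (p - 1) * defect k y" by (intro mult_left_mono) auto
        also have "\<dots> = defect k y powr p"
          using powr_mult_base[of "defect k y" "p - 1"] by (simp add: mult.commute)
        finally have "defect k y powr (p - 1) \<le> 1 / \<epsilon> * defect k y powr p" using \<epsilon> by (simp add: field_simps)
        then show ?thesis by (simp add: add_increasing)
      qed
      then have "defect k y powr (p - 1) * kern (s * p) (x - y) \<le> (\<epsilon> powr (p - 1) + 1 / \<epsilon> * defect k y powr p) * kern (s * p) (x - y)"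
        by (intro mult_right_mono) auto
      then have "indicator (- ball x r) y * defect k y powr (p - 1) * kern (s * p) (x - y) \<le>
        \<epsilon> powr (p - 1) * kern (s * p) (x - y) + (1 / \<epsilon> * (indicator D y * defect k y powr p * kern (s * p) (x - y))
        + indicator (- D) y * defect k y powr (p - 1) * kern (s * p) (x - y))"
        using True \<epsilon> by (cases "y \<in> D") (auto simp: algebra_simps)
      then have "ennreal (indicator (- ball x r) y * defect k y powr (p - 1) * kern (s * p) (x - y)) \<le>
        ennreal (\<epsilon> powr (p - 1) * kern (s * p) (x - y) + (1 / \<epsilon> * (indicator D y * defect k y powr p * kern (s * p) (x - y))
        + indicator (- D) y * defect k y powr (p - 1) * kern (s * p) (x - y)))"
        by (rule ennreal_leI)
      also have "\<dots> = ennreal (\<epsilon> powr (p - 1)) * ennreal (kern (s * p) (x - y)) +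
        (ennreal (1 / \<epsilon>) * ennreal (indicator D y * defect k y powr p * kern (s * p) (x - y)) +
         ennreal (indicator (- D) y * defect k y powr (p - 1) * kern (s * p) (x - y)))"
      proof -
        have split: "ennreal (a * b + (c * X + Y)) = ennreal a * ennreal b + (ennreal c * ennreal X + ennreal Y)"
          if "0 \<le> a" "0 \<le> b" "0 \<le> c" "0 \<le> X" "0 \<le> Y" for a b c X Y :: real
          using that by (simp add: ennreal_mult)
        show ?thesis by (rule split) (use \<epsilon> in auto)
      qed
      finally show ?thesis using True by simp
    qed simp
    have "tail x r k \<le> (\<integral>\<^sup>+y. ennreal (\<epsilon> powr (p - 1)) * (ennreal (kern (s * p) (x - y)) * indicator {y. r \<le> dist x y} y)
        + (ennreal (1 / \<epsilon>) * ennreal (indicator D y * defect k y powr p * kern (s * p) (x - y))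
        + ennreal (indicator (- D) y * defect k y powr (p - 1) * kern (s * p) (x - y))) \<partial>lborel)"
      unfolding tail_def by (intro nn_integral_mono le)
    also have "\<dots> = ennreal (\<epsilon> powr (p - 1)) * (\<integral>\<^sup>+y. ennreal (kern (s * p) (x - y)) * indicator {y. r \<le> dist x y} y \<partial>lborel)
        + (ennreal (1 / \<epsilon>) * ?I + ?T)"
      by (subst nn_integral_add; (subst nn_integral_add)?) (auto simp: nn_integral_cmult)
    also have "\<dots> \<le> ennreal (\<epsilon> powr (p - 1)) * ennreal (C * r powr - (s * p)) + (ennreal (1 / \<epsilon>) * ennreal i + ennreal \<tau>)"
      unfolding i(1) \<tau>(1) by (intro add_right_mono mult_left_mono C r) auto
    also have "\<dots> = ennreal (\<epsilon> powr (p - 1) * (C * r powr - (s * p)) + (1 / \<epsilon> * i + \<tau>))"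
      using \<epsilon> C i \<tau> by (simp add: ennreal_mult[symmetric] ennreal_plus[symmetric] del: ennreal_plus)
    also have "\<dots> \<le> ennreal ((C + 2) * \<epsilon> powr (p - 1) * r powr - (s * p))"
    proof (rule ennreal_leI)
      let ?R = "r powr - (s * p)"
      have "i = i * r powr (s * p) * ?R" using rinv by (simp add: mult.assoc)
      also have "\<dots> \<le> \<epsilon> powr p * ?R" by (intro mult_right_mono rc') auto
      also have "\<epsilon> powr p = \<epsilon> * \<epsilon> powr (p - 1)" using \<epsilon> by (simp add: powr_mult_base)
      finally have 1: "1 / \<epsilon> * i \<le> \<epsilon> powr (p - 1) * ?R" using \<epsilon> by (simp add: field_simps)
      have "\<tau> = \<tau> * r powr (s * p) * ?R" using rinv by (simp add: mult.assoc)
      also have "\<dots> \<le> \<epsilon> powr (p - 1) * ?R" by (intro mult_right_mono rc') auto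
      finally have 2: "\<tau> \<le> \<epsilon> powr (p - 1) * ?R" .
      have "(C + 2) * \<epsilon> powr (p - 1) * ?R = \<epsilon> powr (p - 1) * (C * ?R) + (\<epsilon> powr (p - 1) * ?R + \<epsilon> powr (p - 1) * ?R)"
        by (simp add: algebra_simps)
      then show "\<epsilon> powr (p - 1) * (C * ?R) + (1 / \<epsilon> * i + \<tau>) \<le> (C + 2) * \<epsilon> powr (p - 1) * ?R"
        using 1 2 by linarith
    qed
    finally show ?thesis .
  qed
  have "cball x (2 * r) \<subseteq> \<Omega>" using D(1) r by (meson order_trans subset_cball)
  from \<mu>(2)[OF r(1) \<epsilon> this mass tl] show ?thesis using r(1) by blast
qed

text \<open>The condition k \<le> u x gives \<open>defect k y\<close> \<le> |u x - u y|, so the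
  integral required at x is dominated by a section of the fractional energy, which Tonelli makes
  finite for almost every x.\<close>

lemma AE_lower_bound_in_ball:
  assumes \<Omega>: "cball z \<rho> \<subseteq> \<Omega>"
  shows "AE x in lborel. x \<in> ball z \<rho> \<longrightarrow> k \<le> u x \<longrightarrow> (\<forall>\<epsilon>>0. \<exists>r>0. AE y in lborel. y \<in> ball x r \<longrightarrow> k - \<epsilon> \<le> u y)"
proof -
  let ?D = "ball z \<rho>"
  have Dm [measurable]: "?D \<in> sets borel" by simp
  let ?g = "\<lambda>x y. indicator ?D x * indicator ?D y * \<bar>u x - u y\<bar> powr p * kern (s * p) (x - y)"
  have "(\<integral>\<^sup>+x. (\<integral>\<^sup>+y. ennreal (?g x y) \<partial>lborel) \<partial>lborel) =
     (\<integral>\<^sup>+z. ennreal (?g (fst z) (snd z)) \<partial>(lborel \<Otimes>\<^sub>M lborel))"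
    by (subst lborel.nn_integral_fst[symmetric]) auto
  also have "\<dots> < \<infinity>" by (rule u_energy_finite[OF \<Omega>])
  finally have "AE x in lborel. (\<integral>\<^sup>+y. ennreal (?g x y) \<partial>lborel) \<noteq> \<infinity>"
    by (intro nn_integral_PInf_AE) auto
  then show ?thesis
  proof eventually_elim
    case (elim x)
    show ?case
    proof (intro impI allI)
      fix \<epsilon> :: real assume x: "x \<in> ?D" "k \<le> u x" and \<epsilon>: "0 < \<epsilon>"
      obtain d where d: "0 < d" "cball x d \<subseteq> ?D"
        using x(1) open_ball open_contains_cball by blast
      have le: "indicator ?D y * defect k y powr p * kern (s * p) (x - y) \<le> ?g x y" for y
      proof -
        have "defect k y powr p \<le> \<bar>u x - u y\<bar> powr p"
          using x p by (intro powr_mono2) (auto simp: defect_def)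
        then show ?thesis using x(1) by (auto intro!: mult_right_mono mult_left_mono)
      qed
      have "(\<integral>\<^sup>+y. ennreal (indicator ?D y * defect k y powr p * kern (s * p) (x - y)) \<partial>lborel) \<le> (\<integral>\<^sup>+y. ennreal (?g x y) \<partial>lborel)"
        by (intro nn_integral_mono ennreal_leI le)
      also have "\<dots> < \<infinity>" using elim by (simp add: less_top)
      finally have fin: "(\<integral>\<^sup>+y. ennreal (indicator ?D y * defect k y powr p * kern (s * p) (x - y)) \<partial>lborel) < \<infinity>" .
      have "cball x d \<subseteq> \<Omega>" using d(2) \<Omega> ball_subset_cball[of z \<rho>] by blast
      moreover have "ball x d \<subseteq> ?D" using d(2) ball_subset_cball[of x d] by blast
      ultimately show "\<exists>r>0. AE y in lborel. y \<in> ball x r \<longrightarrow> k - \<epsilon> \<le> u y"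
        by (rule lower_bound_at_point[OF x(2) _ _ d(1) Dm fin \<epsilon>])
    qed
  qed
qed

end

section \<open>Essential lower limits and exceptional null sets\<close>

lemma countable_rational_balls:
  obtains D :: "'a::euclidean_space set" where "countable D"
    and "\<And>x e. 0 < e \<Longrightarrow> \<exists>z\<in>D. \<exists>\<rho>\<in>\<rat>. x \<in> ball z \<rho> \<and> cball z \<rho> \<subseteq> ball x e"
proof -
  obtain D :: "'a set" where D: "countable D" "\<And>X. open X \<Longrightarrow> X \<noteq> {} \<Longrightarrow> \<exists>d\<in>D. d \<in> X"
    by (rule countable_dense_setE) blast
  show ?thesis
  proof (rule that[OF D(1)])
    fix x :: 'a and e :: real assume e: "0 < e"
    obtain \<rho> where \<rho>: "\<rho> \<in> \<rat>" "0 < \<rho>" "\<rho> < e / 2" using Rats_dense_in_real[of 0 "e/2"] e by auto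
    obtain z where z: "z \<in> D" "z \<in> ball x \<rho>" using D(2)[of "ball x \<rho>"] \<rho> by auto
    have "cball z \<rho> \<subseteq> ball x e"
    proof
      fix y assume "y \<in> cball z \<rho>"
      then show "y \<in> ball x e" using z \<rho> dist_triangle[of x y z] by (auto simp: dist_commute)
    qed
    then show "\<exists>z\<in>D. \<exists>\<rho>\<in>\<rat>. x \<in> ball z \<rho> \<and> cball z \<rho> \<subseteq> ball x e"
      using z \<rho> by (intro bexI[of _ z] bexI[of _ \<rho>]) (auto simp: dist_commute)
  qed
qed

text \<open>For a fixed ball and rational level the assertion is trivial off a null set. Every ball
  about x contains one of countably many balls around x, and a real c above u x would leave room for
  a rational level between them.\<close>

lemma AE_ge_of_essential_lower_bound:
  fixes u :: "'a::euclidean_space \<Rightarrow> real"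
  shows "AE x in lborel. \<forall>r>0. \<forall>c. (AE y in lborel. y \<in> ball x r \<longrightarrow> c \<le> u y) \<longrightarrow> c \<le> u x"
proof -
  obtain D :: "'a set" where D: "countable D"
    "\<And>x e. 0 < e \<Longrightarrow> \<exists>z\<in>D. \<exists>\<rho>\<in>\<rat>. x \<in> ball z \<rho> \<and> cball z \<rho> \<subseteq> ball x e"
    by (rule countable_rational_balls) blast
  have "AE x in lborel. \<forall>z\<in>D. \<forall>\<rho>\<in>\<rat>. \<forall>q\<in>\<rat>. (AE y in lborel. y \<in> ball z \<rho> \<longrightarrow> q \<le> u y) \<longrightarrow> x \<in> ball z \<rho> \<longrightarrow> q \<le> u x"
  proof (intro AE_ball_countable[THEN iffD2] D(1) countable_rat ballI)
    fix z :: 'a and \<rho> q :: real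
    \<comment> \<open>The inner condition does not depend on x: if it holds, it is the claim itself
      with y renamed; if not, the implication is vacuous.\<close>
    show "AE x in lborel. (AE y in lborel. y \<in> ball z \<rho> \<longrightarrow> q \<le> u y) \<longrightarrow> x \<in> ball z \<rho> \<longrightarrow> q \<le> u x"
      by (cases "AE y in lborel. y \<in> ball z \<rho> \<longrightarrow> q \<le> u y") simp_all
  qed
  then show ?thesis
  proof eventually_elim
    case (elim x)
    show ?case
    proof (intro allI impI)
      fix r c :: real assume r: "0 < r" and c: "AE y in lborel. y \<in> ball x r \<longrightarrow> c \<le> u y"
      show "c \<le> u x"
      proof (rule ccontr)
        assume "\<not> c \<le> u x"
        then obtain q where q: "q \<in> \<rat>" "u x < q" "q < c" using Rats_dense_in_real[of "u x" c] by auto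
        obtain z \<rho> where z: "z \<in> D" "\<rho> \<in> \<rat>" "x \<in> ball z \<rho>" "cball z \<rho> \<subseteq> ball x r" using D(2)[OF r] by blast
        have "AE y in lborel. y \<in> ball z \<rho> \<longrightarrow> q \<le> u y"
          using c
        proof eventually_elim
          case (elim y)
          show ?case
          proof
            assume "y \<in> ball z \<rho>"
            then have "y \<in> ball x r" using z(4) ball_subset_cball by blast
            then show "q \<le> u y" using elim q by auto
          qed
        qed
        then have "q \<le> u x" using elim z q(1) by blast
        then show False using q by simp
      qed
    qed
  qed
qed

text \<open>\<open>AE_lower_bound_in_ball\<close> fixes the level, whereas here the level follows u
  x. A rational k between u x - \<epsilon>/2 and u x, with countably many balls, keeps the
  exceptional set null; the other \<epsilon>/2 is the loss at level k.\<close>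

lemma (in borel_supersolution) AE_lower_bound:
  assumes "open \<Omega>"
  shows "AE x in lborel. x \<in> \<Omega> \<longrightarrow> (\<forall>\<epsilon>>0. \<exists>r>0. AE y in lborel. y \<in> ball x r \<longrightarrow> u x - \<epsilon> \<le> u y)"
proof -
  obtain D :: "'a set" where D: "countable D"
    "\<And>x e. 0 < e \<Longrightarrow> \<exists>z\<in>D. \<exists>\<rho>\<in>\<rat>. x \<in> ball z \<rho> \<and> cball z \<rho> \<subseteq> ball x e"
    by (rule countable_rational_balls) blast
  have "AE x in lborel. \<forall>z\<in>D. \<forall>\<rho>\<in>\<rat>. \<forall>k\<in>\<rat>. cball z \<rho> \<subseteq> \<Omega> \<longrightarrow> x \<in> ball z \<rho> \<longrightarrow> k \<le> u x \<longrightarrow>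
      (\<forall>\<epsilon>>0. \<exists>r>0. AE y in lborel. y \<in> ball x r \<longrightarrow> k - \<epsilon> \<le> u y)"
    using AE_lower_bound_in_ball by (intro AE_ball_countable[THEN iffD2] D(1) countable_rat ballI) auto
  then show ?thesis
  proof eventually_elim
    case (elim x)
    show ?case
    proof (intro allI impI)
      fix \<epsilon> :: real assume x: "x \<in> \<Omega>" and \<epsilon>: "0 < \<epsilon>"
      obtain e where e: "0 < e" "ball x e \<subseteq> \<Omega>" using assms x open_contains_ball by blast
      obtain z \<rho> where z: "z \<in> D" "\<rho> \<in> \<rat>" "x \<in> ball z \<rho>" "cball z \<rho> \<subseteq> ball x e" using D(2)[OF e(1)] by blast
      obtain k where k: "k \<in> \<rat>" "u x - \<epsilon> / 2 < k" "k < u x" using Rats_dense_in_real[of "u x - \<epsilon> / 2" "u x"] \<epsilon> by auto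
      have "cball z \<rho> \<subseteq> \<Omega>" using z(4) e(2) by blast
      then obtain r where r: "0 < r" "AE y in lborel. y \<in> ball x r \<longrightarrow> k - \<epsilon> / 2 \<le> u y"
        using elim[rule_format, OF z(1,2) k(1) _ z(3) less_imp_le[OF k(3)] half_gt_zero[OF \<epsilon>]] by blast
      from r(2) have "AE y in lborel. y \<in> ball x r \<longrightarrow> u x - \<epsilon> \<le> u y"
        by eventually_elim (use k in auto)
      then show "\<exists>r>0. AE y in lborel. y \<in> ball x r \<longrightarrow> u x - \<epsilon> \<le> u y" using r(1) by blast
    qed
  qed
qed

lemma AE_lebesgue_on_ball_iff:
  "(AE y in lebesgue_on (ball x r). P y) \<longleftrightarrow> (AE y in lborel. y \<in> ball (x::'a::euclidean_space) r \<longrightarrow> P y)"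
proof -
  have "ball x r \<inter> space lebesgue \<in> sets lebesgue" by simp
  then show ?thesis by (simp add: AE_restrict_space_iff AE_completion_iff)
qed

lemma ess_inf_antimono:
  fixes u :: "'a::euclidean_space \<Rightarrow> real"
  assumes "ball y r' \<subseteq> ball x r"
  shows "ess_inf (ball x r) u \<le> ess_inf (ball y r') u"
  unfolding ess_inf_def AE_lebesgue_on_ball_iff
proof (rule Sup_subset_mono, rule Collect_mono, rule impI)
  fix c assume "AE z in lborel. z \<in> ball x r \<longrightarrow> c \<le> ereal (u z)"
  then show "AE z in lborel. z \<in> ball y r' \<longrightarrow> c \<le> ereal (u z)"
    by eventually_elim (use assms in auto)
qed

text \<open>Essential infima increase as the radius decreases. The supremum form turns
  \<open>c < ess_lim_inf u x\<close> into a condition at a single radius.\<close>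

lemma ess_lim_inf_eq_SUP:
  fixes u :: "'a::euclidean_space \<Rightarrow> real"
  shows "ess_lim_inf u x = (SUP r\<in>{0<..}. ess_inf (ball x r) u)"
proof -
  let ?S = "SUP r\<in>{0<..}. ess_inf (ball x r) u"
  have le: "ess_inf (ball x r) u \<le> ?S" if "0 < r" for r using that by (intro SUP_upper) auto
  have pos: "eventually (\<lambda>r::real. 0 < r) (at_right 0)" by (simp add: eventually_at_filter)
  have "((\<lambda>r. ess_inf (ball x r) u) \<longlongrightarrow> ?S) (at_right 0)"
  proof (rule order_tendstoI)
    fix a assume "a < ?S"
    then obtain r0 where r0: "0 < r0" "a < ess_inf (ball x r0) u" by (auto simp: less_SUP_iff)
    have "eventually (\<lambda>r::real. r < r0) (at_right 0)"
      using r0(1) by (intro order_tendstoD(2)[OF tendsto_ident_at]) 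
    then show "eventually (\<lambda>r. a < ess_inf (ball x r) u) (at_right 0)"
    proof eventually_elim
      case (elim r)
      have "ess_inf (ball x r0) u \<le> ess_inf (ball x r) u"
        using elim by (intro ess_inf_antimono subset_ball) simp
      then show ?case using r0(2) by simp
    qed
  next
    fix a assume "?S < a"
    then show "eventually (\<lambda>r. ess_inf (ball x r) u < a) (at_right 0)"
      using pos by (auto elim!: eventually_mono intro: le_less_trans[OF le])
  qed
  then show ?thesis unfolding ess_lim_inf_def by (intro tendsto_Lim) auto
qed

lemma ess_lim_inf_eqI:
  fixes u :: "'a::euclidean_space \<Rightarrow> real"
  assumes lower: "\<And>\<epsilon>. 0 < \<epsilon> \<Longrightarrow> \<exists>r>0. AE y in lborel. y \<in> ball x r \<longrightarrow> u x - \<epsilon> \<le> u y"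
    and upper: "\<And>r c. 0 < r \<Longrightarrow> AE y in lborel. y \<in> ball x r \<longrightarrow> c \<le> u y \<Longrightarrow> c \<le> u x"
  shows "ess_lim_inf u x = ereal (u x)"
proof (rule antisym)
  show "ess_lim_inf u x \<le> ereal (u x)"
    unfolding ess_lim_inf_eq_SUP ess_inf_def AE_lebesgue_on_ball_iff
  proof (intro SUP_least Sup_least, elim CollectE)
    fix r c assume r: "r \<in> {0<..}" and c: "AE y in lborel. y \<in> ball x r \<longrightarrow> c \<le> ereal (u y)"
    show "c \<le> ereal (u x)"
    proof (rule ccontr)
      assume "\<not> c \<le> ereal (u x)"
      \<comment> \<open>The bound c is extended real, possibly infinite, while the hypothesis speaks
        of real bounds.\<close>
      then obtain q where q: "ereal (u x) < ereal q" "ereal q < c" using ereal_dense2[of "ereal (u x)" c] by (auto simp: not_le)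
      have "AE y in lborel. y \<in> ball x r \<longrightarrow> q \<le> u y"
        using c
      proof eventually_elim
        case (elim y)
        show ?case
        proof
          assume "y \<in> ball x r"
          then have "ereal q < ereal (u y)" using elim q(2) less_le_trans by blast
          then show "q \<le> u y" by simp
        qed
      qed
      then have "q \<le> u x" using r by (intro upper) auto
      then show False using q(1) by simp
    qed
  qed
  show "ereal (u x) \<le> ess_lim_inf u x"
  proof (rule ereal_le_epsilon2)
    fix \<epsilon> :: real assume "0 < \<epsilon>"
    then obtain r where r: "0 < r" "AE y in lborel. y \<in> ball x r \<longrightarrow> u x - \<epsilon> \<le> u y" using lower by blast
    have "ereal (u x - \<epsilon>) \<le> ess_inf (ball x r) u"
      unfolding ess_inf_def AE_lebesgue_on_ball_iff by (intro Sup_upper) (use r(2) in simp)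
    also have "\<dots> \<le> ess_lim_inf u x" unfolding ess_lim_inf_eq_SUP using r(1) by (intro SUP_upper) auto
    finally show "ereal (u x) \<le> ess_lim_inf u x + ereal \<epsilon>"
      by (cases "ess_lim_inf u x") auto
  qed
qed

text \<open>An essential bound on a ball about x is inherited by a small ball about each of its
  points, so strict lower bounds for the essential lower limit are open conditions.\<close>

lemma lower_semicontinuous_ess_lim_inf:
  fixes u :: "'a::euclidean_space \<Rightarrow> real"
  assumes "\<And>x. x \<in> S \<Longrightarrow> v x = ess_lim_inf u x"
  shows "lower_semicontinuous_on S v"
  unfolding lower_semicontinuous_on_def
proof (intro ballI)
  fix x assume x: "x \<in> S"
  show "v x \<le> Liminf (at x within S) v"
    unfolding le_Liminf_iff
  proof (intro allI impI)
    fix c assume "c < v x"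
    then obtain r where r: "0 < r" "c < ess_inf (ball x r) u"
      using assms[OF x] by (auto simp: ess_lim_inf_eq_SUP less_SUP_iff)
    have "eventually (\<lambda>y. y \<in> ball x r \<and> y \<in> S) (at x within S)"
      using r(1) by (auto simp: eventually_at dist_commute intro!: exI[of _ r])
    then show "eventually (\<lambda>y. c < v y) (at x within S)"
    proof eventually_elim
      case (elim y)
      then obtain r' where r': "0 < r'" "ball y r' \<subseteq> ball x r"
        using open_ball open_contains_ball by blast
      have "c < ess_inf (ball x r) u" by (rule r)
      also have "\<dots> \<le> ess_inf (ball y r') u" by (rule ess_inf_antimono[OF r'(2)])
      also have "\<dots> \<le> ess_lim_inf u y" unfolding ess_lim_inf_eq_SUP using r'(1) by (intro SUP_upper) auto
      finally show ?case using assms elim by simp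
    qed
  qed
qed

section \<open>Reduction to Borel representatives\<close>

lemma weak_supersolution_ess_lim_inf:
  fixes s p \<Lambda> :: real and K :: "'a::euclidean_space \<Rightarrow> 'a \<Rightarrow> real" and \<Omega> :: "'a set" and u :: "'a \<Rightarrow> real"
  assumes sp: "0 < s" "s < 1" "1 < p" "1 \<le> \<Lambda>" and K: "admissible_kernel s p \<Lambda> K"
    and \<Omega>: "open \<Omega>" and u: "weak_supersolution s p K \<Omega> u"
  shows "AE x in lebesgue. x \<in> \<Omega> \<longrightarrow> ereal (u x) = ess_lim_inf u x"
proof -
  let ?M = "lborel \<Otimes>\<^sub>M lborel :: ('a \<times> 'a) measure"
  let ?k = "kern (s * p) :: 'a \<Rightarrow> real"
  have sp0: "0 < s * p" using sp by simp
  have "u \<in> borel_measurable lebesgue" using u by (simp add: weak_supersolution_def)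
  from completion_ex_borel_measurable_real[OF this] obtain u' where
    u'm: "u' \<in> borel_measurable lborel" and u': "AE x in lborel. u x = u' x" by blast
  have [measurable]: "u' \<in> borel_measurable borel" using u'm by simp
  have "(\<lambda>(x, y). K x y) \<in> borel_measurable lebesgue" using K by (simp add: admissible_kernel_def)
  from completion_ex_borel_measurable_real[OF this] obtain K0 where
    K0m: "K0 \<in> borel_measurable (lborel :: ('a \<times> 'a) measure)" and K0: "AE z in lborel. (case z of (x, y) \<Rightarrow> K x y) = K0 z" by blast
  have [measurable]: "K0 \<in> borel_measurable (borel \<Otimes>\<^sub>M borel)"
    using K0m by (simp add: borel_prod)
  \<comment> \<open>The Borel version agrees with K only almost everywhere; the maximum restores
    nonnegativity at every point, as the locale demands.\<close>
  define K' where "K' x y = max (K0 (x, y)) 0" for x y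
  have Knn: "0 \<le> K x y" for x y using K by (simp add: admissible_kernel_def)
  have K': "AE z in ?M. K (fst z) (snd z) = K' (fst z) (snd z)"
  proof -
    have "AE z in ?M. (case z of (x, y) \<Rightarrow> K x y) = K0 z" using K0 unfolding lborel_prod .
    then show ?thesis
    proof eventually_elim
      case (elim z)
      then show ?case using Knn[of "fst z" "snd z"] by (simp add: K'_def case_prod_beta)
    qed
  qed
  have u'2: "AE z in ?M. u (fst z) = u' (fst z) \<and> u (snd z) = u' (snd z)" by (rule AE_pair_lborel[OF u'])
  \<comment> \<open>The two-sided bound is given for K multiplied by |x - y|^(n + s p), and division
    is possible only off the diagonal, a null set.\<close>
  have diag: "AE z in ?M. fst z \<noteq> snd z"
  proof -
    have "AE x in lborel. AE y in lborel. fst (x, y) \<noteq> snd (x, y :: 'a)"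
    proof (rule AE_I2)
      show "AE y in lborel. fst (x, y) \<noteq> snd (x, y)" for x :: 'a
        using AE_lborel_singleton[of x] by eventually_elim simp
    qed
    moreover have "Measurable.pred ?M (\<lambda>z. fst z \<noteq> snd z)" by measurable
    ultimately show ?thesis unfolding pred_def by (intro lborel_pair.AE_pair_measure)
  qed
  have Kb: "AE z in ?M. K' (fst z) (snd z) \<le> \<Lambda> * ?k (fst z - snd z) \<and> ?k (fst z - snd z) \<le> \<Lambda> * K' (fst z) (snd z)"
  proof -
    have "AE z in lborel. (case z of (x, y) \<Rightarrow> inverse \<Lambda> \<le> K x y * norm (x - y) powr (real DIM('a) + s * p) \<and>
        K x y * norm (x - y) powr (real DIM('a) + s * p) \<le> \<Lambda>)"
      using K unfolding admissible_kernel_def AE_completion_iff by blast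
    then have "AE z in ?M. (case z of (x, y) \<Rightarrow> inverse \<Lambda> \<le> K x y * norm (x - y) powr (real DIM('a) + s * p) \<and>
        K x y * norm (x - y) powr (real DIM('a) + s * p) \<le> \<Lambda>)"
      unfolding lborel_prod .
    then show ?thesis
      using K' diag
    proof eventually_elim
      case (elim z)
      obtain x y where z: "z = (x, y)" by (cases z)
      let ?N = "norm (x - y) powr (real DIM('a) + s * p)"
      have neq: "x \<noteq> y" using elim by (simp add: z)
      have N: "0 < ?N" using neq by simp
      have k: "?k (x - y) = inverse ?N" by (rule kern_eq_inverse)
      have KN: "inverse \<Lambda> \<le> K x y * ?N" "K x y * ?N \<le> \<Lambda>" using elim by (auto simp: z)
      have "\<Lambda> * inverse \<Lambda> \<le> \<Lambda> * (K x y * ?N)" using KN(1) sp(4) by (intro mult_left_mono) auto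
      then have "1 \<le> \<Lambda> * K x y * ?N" using sp(4) by simp
      then have 1: "inverse ?N \<le> \<Lambda> * K x y"
        by (simp only: inverse_eq_divide pos_divide_le_eq[OF N])
      have 2: "K x y \<le> \<Lambda> * inverse ?N"
        using KN(2) by (simp only: divide_inverse[symmetric] pos_le_divide_eq[OF N])
      have "K' x y = K x y" using elim(2) by (simp add: z)
      then show ?case unfolding z fst_conv snd_conv k using 1 2 by simp
    qed
  qed
  have EI: "AE z in ?M. energy_integrand p K u \<eta> z = energy_integrand p K' u' \<eta> z" for \<eta>
    using K' u'2 by eventually_elim (simp add: energy_integrand_def case_prod_beta)
  have W: "u \<in> frac_sobolev s p (ball x0 R)" if "cball x0 R \<subseteq> \<Omega>" for x0 R
  proof -
    have "closure (ball x0 R) \<subseteq> cball x0 R" by (intro closure_minimal) auto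
    then have "compactly_contained (ball x0 R) \<Omega>"
      using that unfolding compactly_contained_def by (meson bounded_cball bounded_subset closed_closure compact_eq_bounded_closed order_trans)
    then show ?thesis using u by (auto simp: weak_supersolution_def frac_sobolev_loc_def)
  qed
  interpret B: borel_supersolution s p \<Lambda> K' \<Omega> u'
  proof
    show "(\<lambda>(x, y). K' x y) \<in> borel_measurable (borel \<Otimes>\<^sub>M borel)" unfolding K'_def by measurable
    show "0 \<le> K' x y" for x y by (simp add: K'_def)
    show "AE z in ?M. K' (fst z) (snd z) \<le> \<Lambda> * kern (s * p) (fst z - snd z)"
      "AE z in ?M. kern (s * p) (fst z - snd z) \<le> \<Lambda> * K' (fst z) (snd z)"
      using Kb by auto
  next
    fix x0 :: 'a and R assume R: "cball x0 R \<subseteq> \<Omega>"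
    have "(\<integral>\<^sup>+x. ennreal (indicator (ball x0 R) x * \<bar>u' x\<bar> powr p) \<partial>lborel) = (\<integral>\<^sup>+x\<in>ball x0 R. ennreal (\<bar>u x\<bar> powr p) \<partial>lebesgue)"
      unfolding nn_integral_completion using u'
      by (intro nn_integral_cong_AE) (auto elim!: eventually_mono split: split_indicator)
    then show "(\<integral>\<^sup>+x. ennreal (indicator (ball x0 R) x * \<bar>u' x\<bar> powr p) \<partial>lborel) < \<infinity>"
      using W[OF R] by (simp add: frac_sobolev_def)
    have "(\<integral>\<^sup>+z. ennreal (indicator (ball x0 R) (fst z) * indicator (ball x0 R) (snd z) *
        \<bar>u' (fst z) - u' (snd z)\<bar> powr p * kern (s * p) (fst z - snd z)) \<partial>?M)
      = (\<integral>\<^sup>+(x, y)\<in>ball x0 R \<times> ball x0 R. ennreal (\<bar>u x - u y\<bar> powr p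
             / norm (x - y) powr (real DIM('a) + s * p)) \<partial>lebesgue)"
      unfolding nn_integral_completion lborel_prod[symmetric]
    proof (rule nn_integral_cong_AE)
      show "AE z in ?M. ennreal (indicator (ball x0 R) (fst z) * indicator (ball x0 R) (snd z) *
        \<bar>u' (fst z) - u' (snd z)\<bar> powr p * kern (s * p) (fst z - snd z)) =
        (case z of (x, y) \<Rightarrow> ennreal (\<bar>u x - u y\<bar> powr p / norm (x - y) powr (real DIM('a) + s * p))) * indicator (ball x0 R \<times> ball x0 R) z"
        using u'2
        by eventually_elim (auto simp: kern_eq_inverse divide_inverse case_prod_beta mem_Times_iff split: split_indicator)
    qed
    also have "\<dots> < \<infinity>" using W[OF R] by (simp add: frac_sobolev_def)
    finally show "(\<integral>\<^sup>+z. ennreal (indicator (ball x0 R) (fst z) * indicator (ball x0 R) (snd z) *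
        \<bar>u' (fst z) - u' (snd z)\<bar> powr p * kern (s * p) (fst z - snd z)) \<partial>?M) < \<infinity>" .
  next
    have "(\<integral>\<^sup>+x. ennreal (max (- u' x) 0 powr (p - 1) * weight (s * p) x) \<partial>lborel) =
      (\<integral>\<^sup>+x. ennreal (\<bar>max (- u x) 0\<bar> powr (p - 1) * (1 + norm x) powr (- real DIM('a) - s * p)) \<partial>lebesgue)"
      unfolding nn_integral_completion using u'
      by (intro nn_integral_cong_AE) (auto elim!: eventually_mono simp: weight_def)
    also have "\<dots> < \<infinity>" using u by (simp add: weak_supersolution_def tail_space_def)
    finally show "(\<integral>\<^sup>+x. ennreal (max (- u' x) 0 powr (p - 1) * weight (s * p) x) \<partial>lborel) < \<infinity>" .
  next
    fix \<eta> assume "\<eta> \<in> test_functions \<Omega>" "\<And>x. 0 \<le> \<eta> x"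
    then have "nonneg_lebesgue_integral (energy_integrand p K u \<eta>)" using u by (simp add: weak_supersolution_def)
    then have *: "(\<integral>\<^sup>+z. ennreal (- energy_integrand p K u \<eta> z) \<partial>?M) < \<infinity>"
      "(\<integral>\<^sup>+z. ennreal (- energy_integrand p K u \<eta> z) \<partial>?M) \<le> (\<integral>\<^sup>+z. ennreal (energy_integrand p K u \<eta> z) \<partial>?M)"
      by (auto simp: nonneg_lebesgue_integral_def nn_integral_completion lborel_prod)
    have "(\<integral>\<^sup>+z. ennreal (- energy_integrand p K u \<eta> z) \<partial>?M) = (\<integral>\<^sup>+z. ennreal (- energy_integrand p K' u' \<eta> z) \<partial>?M)"
      "(\<integral>\<^sup>+z. ennreal (energy_integrand p K u \<eta> z) \<partial>?M) = (\<integral>\<^sup>+z. ennreal (energy_integrand p K' u' \<eta> z) \<partial>?M)"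
      using EI[of \<eta>] by (auto intro!: nn_integral_cong_AE elim!: eventually_mono)
    then show "(\<integral>\<^sup>+z. ennreal (- energy_integrand p K' u' \<eta> z) \<partial>?M) < \<infinity> \<and>
      (\<integral>\<^sup>+z. ennreal (- energy_integrand p K' u' \<eta> z) \<partial>?M) \<le> (\<integral>\<^sup>+z. ennreal (energy_integrand p K' u' \<eta> z) \<partial>?M)"
      using * by simp
  qed (use sp in auto)
  \<comment> \<open>Essential bounds see only the class of u almost everywhere; pointwise values
    will be compared only at those x with u x = u' x.\<close>
  have transfer: "(AE y in lborel. y \<in> A \<longrightarrow> c \<le> u y) \<longleftrightarrow> (AE y in lborel. y \<in> A \<longrightarrow> c \<le> u' y)" for A c
  proof
    assume "AE y in lborel. y \<in> A \<longrightarrow> c \<le> u y"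
    then show "AE y in lborel. y \<in> A \<longrightarrow> c \<le> u' y" using u' by eventually_elim simp
  next
    assume "AE y in lborel. y \<in> A \<longrightarrow> c \<le> u' y"
    then show "AE y in lborel. y \<in> A \<longrightarrow> c \<le> u y" using u' by eventually_elim simp
  qed
  have "AE x in lborel. x \<in> \<Omega> \<longrightarrow> ereal (u x) = ess_lim_inf u x"
    using B.AE_lower_bound[OF \<Omega>] AE_ge_of_essential_lower_bound[of u'] u'
  proof eventually_elim
    case (elim x)
    show ?case
    proof
      assume x: "x \<in> \<Omega>"
      have "ess_lim_inf u x = ereal (u x)"
      proof (rule ess_lim_inf_eqI)
        show "\<exists>r>0. AE y in lborel. y \<in> ball x r \<longrightarrow> u x - \<epsilon> \<le> u y" if "0 < \<epsilon>" for \<epsilon>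
          unfolding transfer elim(3) using elim(1) x that by blast
        show "c \<le> u x" if "0 < r" "AE y in lborel. y \<in> ball x r \<longrightarrow> c \<le> u y" for r c
          using elim(2) that unfolding transfer elim(3) by blast
      qed
      then show "ereal (u x) = ess_lim_inf u x" by simp
    qed
  qed
  then show ?thesis by (rule AE_completion)
qed

theorem theorem9:
  fixes s p \<Lambda> :: real
    and K :: "real^'n \<Rightarrow> real^'n \<Rightarrow> real"
    and \<Omega> :: "(real^'n) set"
    and u :: "real^'n \<Rightarrow> real"
  assumes "0 < s" and "s < 1" and "1 < p" and "1 \<le> \<Lambda>"
    and "admissible_kernel s p \<Lambda> K"
    and "open \<Omega>"
    and "weak_supersolution s p K \<Omega> u"
  shows "(AE x in lebesgue. x \<in> \<Omega> \<longrightarrow> ereal (u x) = ess_lim_inf u x) \<and>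
    (\<exists>v :: real^'n \<Rightarrow> ereal.
       (AE x in lebesgue. v x = ereal (u x)) \<and> lower_semicontinuous_on \<Omega> v)"
proof
  show ae: "AE x in lebesgue. x \<in> \<Omega> \<longrightarrow> ereal (u x) = ess_lim_inf u x"
    by (rule weak_supersolution_ess_lim_inf[OF assms])
  \<comment> \<open>Off \<Omega> the function is u itself, so that the representative agrees with u
    almost everywhere in the whole space and not merely in \<Omega>.\<close>
  let ?v = "\<lambda>x. if x \<in> \<Omega> then ess_lim_inf u x else ereal (u x)"
  have "AE x in lebesgue. ?v x = ereal (u x)" using ae by eventually_elim auto
  moreover have "lower_semicontinuous_on \<Omega> ?v" by (rule lower_semicontinuous_ess_lim_inf) simp
  ultimately show "\<exists>v :: real^'n \<Rightarrow> ereal.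
       (AE x in lebesgue. v x = ereal (u x)) \<and> lower_semicontinuous_on \<Omega> v" by (intro exI[of _ ?v] conjI)
qed

end
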